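(* For each $n \in \mathbf{N}$, let $W_n = (w_{ij}^{(n)})_{i,j=1}^n$ be a random $n \times n$ real symmetric matrix whose upper triangular entries $w_{ij}^{(n)}$, $1\le i\le j\le n$, are jointly independent and have symmetric distributions. Assume that $W_1, W_2, \ldots$ are defined on the same probability space. Assume that $w_{i_nj_n}^{(n)} \Rightarrow 0$ in distribution as $n \to \infty$ for any choice of $i_n,j_n \in \{1,\ldots,n\}$ for each $n \in \mathbf{N}$. If also $\sum_{j=1}^n w_{i_nj}^{(n)} \Rightarrow N(0,1)$ in distribution for any choice of $i_n \in \{1,\ldots,n\}$ for each $n \in \mathbf{N}$, then almost surely $\mu_{W_n} \Rightarrow \mu_{\mathrm{sc}}$ as $n \to \infty$.
   Context: Upper triangular entries include the diagonal. A random variable $X$ has a symmetric distribution if $X$ and $-X$ have the same distribution. $N(0,1)$ is the standard normal distribution. For an $n\times n$ Hermitian (e.g. real symmetric) matrix $A$ with eigenvalues $\lambda_1(A)\ge\cdots\ge\lambda_n(A)$ (with multiplicity), $\mu_A := \frac1n\sum_{i=1}^n \delta_{\lambda_i(A)}$. The semicircle distribution is $\mu_{\mathrm{sc}}(dx) = \frac{1}{2\pi}\sqrt{(4-x^2)_+}\,dx$, where $x_+=\max\{x,0\}$. *)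

theory Defs
  imports "HOL-Probability.Probability" "Jordan_Normal_Form.Char_Poly"
begin

text \<open>Eigenvalues (with algebraic multiplicity) of a square real matrix:
  the multiset of real roots of its characteristic polynomial.  For a real
  symmetric matrix all roots are real, so this multiset has size n.\<close>
definition eigvals_mset :: "real mat \<Rightarrow> real multiset" where
  "eigvals_mset A = proots (char_poly A)"

definition esd :: "real mat \<Rightarrow> real measure" where
  "esd A = distr (measure_pmf (pmf_of_multiset (eigvals_mset A))) borel (\<lambda>x. x)"

definition semicircle_distribution :: "real measure" where
  "semicircle_distribution =
     density lborel (\<lambda>x. ennreal (sqrt (max 0 (4 - x\<^sup>2)) / (2 * pi)))"

end

theory Submission
  imports Defs
begin

text \<open>
  Resolvent method on the line \<open>Im z = 2\<close>. Because the entries are symmetric and uniformly small, the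
  normal limit of the row sums amounts to \<open>\<Sum>\<^sub>j E (1 - cos (t w\<^sub>i\<^sub>j)) \<rightarrow> t\<^sup>2 / 2\<close> for every \<open>t\<close>, and comparing
  \<open>t\<close> with \<open>2 t\<close> gives \<open>\<Sum>\<^sub>j E (1 - cos (t w\<^sub>i\<^sub>j))\<^sup>2 \<rightarrow> 0\<close>. Hence, uniformly in the row, with probability close to
  one no entry of a row exceeds \<open>\<epsilon>\<close>, and the truncated variances of a row sum to nearly one.

  For the resolvent \<open>G\<close>, the Schur complement and the variance of a quadratic form in the independent
  entries of row \<open>i\<close> show that \<open>G\<^sub>i\<^sub>i (- z - \<Sum>\<^sub>k \<sigma>\<^sub>i\<^sub>k\<^sup>2 G\<^sub>k\<^sub>k)\<close> is close to one. The Stieltjes transform \<open>m\<close> of the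
  semicircle law solves \<open>m (- z - m) = 1\<close>, and since \<open>\<bar>G\<^sub>i\<^sub>i\<bar>\<close> and \<open>\<bar>m\<bar>\<close> are at most 1/2, the map is a contraction
  in \<open>max\<^sub>i E \<bar>G\<^sub>i\<^sub>i - m\<bar>\<close>. Changing one row moves \<open>tr G\<close> by a bounded amount, so the bounded differences inequality
  and the Borel-Cantelli lemma give almost sure convergence of \<open>tr G / n\<close>, whatever the joint law of the
  matrices of different sizes. Finally, the imaginary part of the Stieltjes transform on the line is the
  density of the measure smoothed by a Poisson kernel; Scheffe's lemma gives convergence in \<open>L\<^sup>1\<close>, hence
  of the characteristic functions.
\<close>

section \<open>Resolvents of real symmetric matrices\<close>

text \<open>The entries may have infinite variance, so the matrix itself is never truncated.
  Truncation touches only the row \<open>i\<close> being expanded: if that row has a large entry,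
  the trivial bound 1 on \<open>|G_ii - m|\<close> is charged to the tail probability; otherwise the
  row equals its truncation. The variances within a row may be very unequal, so the equation does
  not close on the trace. This forces a bound on every diagonal entry separately, with a maximum
  over \<open>i\<close>, and hence estimates uniform in the row; the freedom to choose
  \<open>i_n\<close> in the hypotheses supplies that uniformity. The height 2 makes
  \<open>|G_ii| * |m| <= 1/4\<close>, while the truncated variances of a row sum to at most
  \<open>1 + \<epsilon> <= 2\<close>, so the contraction factor is 1/2. One fixed height identifies
  the limit because Poisson smoothing multiplies the characteristic function by a factor without
  zeros. Concentration treats a whole row as one variable: \<open>n\<close> blocks of effect O(1/n)
  give a failure probability exponentially small in \<open>n\<close>, which is summable.\<close>

definition shifted_mat :: "nat \<Rightarrow> (nat \<Rightarrow> nat \<Rightarrow> real) \<Rightarrow> complex \<Rightarrow> complex mat" where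
  "shifted_mat n A z = mat n n (\<lambda>(i, j). of_real (A i j) - (if i = j then z else 0))"

text \<open>Cramer's rule for the inverse of \<open>A - z\<close>, hence the transposed cofactor
  indices. As a quotient of polynomials in the entries it is visibly measurable, and its diagonal
  consists of principal minors over the determinant, which is how the trace meets the characteristic
  polynomial.\<close>

definition resolvent :: "nat \<Rightarrow> (nat \<Rightarrow> nat \<Rightarrow> real) \<Rightarrow> complex \<Rightarrow> nat \<Rightarrow> nat \<Rightarrow> complex" where
  "resolvent n A z i j = cofactor (shifted_mat n A z) j i / Determinant.det (shifted_mat n A z)"

definition symmetric_upto :: "nat \<Rightarrow> (nat \<Rightarrow> nat \<Rightarrow> 'b) \<Rightarrow> bool" where
  "symmetric_upto n A \<longleftrightarrow> (\<forall>i<n. \<forall>j<n. A i j = A j i)"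

lemma symmetric_uptoD: "symmetric_upto n A \<Longrightarrow> i < n \<Longrightarrow> j < n \<Longrightarrow> A i j = A j i"
  by (auto simp: symmetric_upto_def)

lemma shifted_mat_carrier [simp]: "shifted_mat n A z \<in> carrier_mat n n"
  by (simp add: shifted_mat_def)

lemma dim_shifted_mat [simp]: "dim_row (shifted_mat n A z) = n" "dim_col (shifted_mat n A z) = n"
  by (simp_all add: shifted_mat_def)

text \<open>The quadratic form \<open>S\<close> of a real symmetric matrix is real, yet here it
  equals \<open>z\<close> times the squared norm of \<open>v\<close>. Besides invertibility of
  \<open>A - z\<close>, this serves as the uniqueness principle behind \<open>resolvent_sym\<close>
  and \<open>resolvent_cnj\<close>.\<close>

lemma symmetric_eigenvector_zero:
  fixes v :: "nat \<Rightarrow> complex"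
  assumes A: "symmetric_upto n A" and z: "Im z \<noteq> 0"
    and v: "\<And>i. i < n \<Longrightarrow> (\<Sum>j<n. of_real (A i j) * v j) = z * v i"
    and i: "i < n"
  shows "v i = 0"
proof -
  define S where "S = (\<Sum>i<n. cnj (v i) * (\<Sum>j<n. of_real (A i j) * v j))"
  have "cnj S = (\<Sum>i<n. \<Sum>j<n. v i * (of_real (A i j) * cnj (v j)))"
    unfolding S_def by (simp add: sum_distrib_left)
  also have "\<dots> = (\<Sum>j<n. \<Sum>i<n. v i * (of_real (A i j) * cnj (v j)))"
    by (rule sum.swap)
  also have "\<dots> = S"
    unfolding S_def sum_distrib_left
    by (intro sum.cong refl) (simp add: symmetric_uptoD[OF A] mult_ac)
  finally have "Im S = 0" by (simp add: complex_eq_iff)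
  moreover have "S = z * of_real (\<Sum>i<n. (cmod (v i))\<^sup>2)"
  proof -
    have "S = (\<Sum>i<n. cnj (v i) * (z * v i))" unfolding S_def by (intro sum.cong refl) (simp add: v)
    then show ?thesis by (simp add: sum_distrib_left complex_norm_square mult_ac del: of_real_power)
  qed
  ultimately have "(\<Sum>i<n. (cmod (v i))\<^sup>2) = 0" using z by simp
  then have "(cmod (v i))\<^sup>2 = 0" using i by (subst (asm) sum_nonneg_eq_0_iff) auto
  then show ?thesis by simp
qed

lemma det_shifted_mat_nonzero:
  assumes A: "symmetric_upto n A" and z: "Im z \<noteq> 0"
  shows "Determinant.det (shifted_mat n A z) \<noteq> 0"
proof
  assume "Determinant.det (shifted_mat n A z) = 0"
  then obtain v where v: "v \<in> carrier_vec n" "v \<noteq> 0\<^sub>v n" "shifted_mat n A z *\<^sub>v v = 0\<^sub>v n"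
    using det_0_iff_vec_prod_zero[OF shifted_mat_carrier] by blast
  have "vec_index v i = 0" if "i < n" for i
  proof (rule symmetric_eigenvector_zero[OF A z _ that])
    fix i assume i: "i < n"
    have "0 = vec_index (shifted_mat n A z *\<^sub>v v) i" using v i by simp
    also have "\<dots> = (\<Sum>j<n. (of_real (A i j) - (if i = j then z else 0)) * vec_index v j)"
      using i v(1) by (simp add: scalar_prod_def shifted_mat_def atLeast0LessThan)
    also have "\<dots> = (\<Sum>j<n. of_real (A i j) * vec_index v j) - z * vec_index v i"
      using i by (simp add: left_diff_distrib sum_subtractf if_distrib[of "\<lambda>a. a * _"] cong: if_cong)
    finally show "(\<Sum>j<n. of_real (A i j) * vec_index v j) = z * vec_index v i" by simp
  qed
  then have "v = 0\<^sub>v n" using v(1) by (intro eq_vecI) auto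
  with v(2) show False by simp
qed

lemma resolvent_right:
  assumes A: "symmetric_upto n A" and z: "Im z \<noteq> 0" and ik: "i < n" "k < n"
  shows "(\<Sum>j<n. of_real (A i j) * resolvent n A z j k) - z * resolvent n A z i k = (if i = k then 1 else 0)"
proof -
  let ?B = "shifted_mat n A z" let ?d = "Determinant.det ?B"
  have d: "?d \<noteq> 0" by (rule det_shifted_mat_nonzero[OF A z])
  have "(?B * adj_mat ?B) $$ (i, k) = (if i = k then ?d else 0)"
    using ik by (subst adj_mat(2)[OF shifted_mat_carrier]) simp
  also have "(?B * adj_mat ?B) $$ (i, k) = (\<Sum>j<n. ?B $$ (i, j) * cofactor ?B k j)"
    using ik by (simp add: scalar_prod_def adj_mat_def atLeast0LessThan)
  finally have "(\<Sum>j<n. ?B $$ (i, j) * resolvent n A z j k) = (if i = k then 1 else 0)"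
    using d by (simp add: resolvent_def sum_divide_distrib[symmetric])
  then show ?thesis using ik
    by (simp add: shifted_mat_def left_diff_distrib sum_subtractf if_distrib[of "\<lambda>a. a * _"] cong: if_cong)
qed

lemma resolvent_left:
  assumes A: "symmetric_upto n A" and z: "Im z \<noteq> 0" and ik: "i < n" "k < n"
  shows "(\<Sum>j<n. resolvent n A z i j * of_real (A j k)) - z * resolvent n A z i k = (if i = k then 1 else 0)"
proof -
  let ?B = "shifted_mat n A z" let ?d = "Determinant.det ?B"
  have d: "?d \<noteq> 0" by (rule det_shifted_mat_nonzero[OF A z])
  have "(adj_mat ?B * ?B) $$ (i, k) = (if i = k then ?d else 0)"
    using ik by (subst adj_mat(3)[OF shifted_mat_carrier]) simp
  also have "(adj_mat ?B * ?B) $$ (i, k) = (\<Sum>j<n. cofactor ?B j i * ?B $$ (j, k))"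
    using ik by (simp add: scalar_prod_def adj_mat_def atLeast0LessThan)
  finally have "(\<Sum>j<n. resolvent n A z i j * ?B $$ (j, k)) = (if i = k then 1 else 0)"
    using d by (simp add: resolvent_def sum_divide_distrib[symmetric])
  then show ?thesis using ik
    by (simp add: shifted_mat_def right_diff_distrib sum_subtractf if_distrib[of "\<lambda>a. _ * a"] mult.commute[of z] cong: if_cong)
qed

text \<open>With \<open>G\<close> and \<open>H\<close> the two resolvents, expand
  \<open>G ((B - w) - (A - z)) H\<close> using \<open>G (A - z) = 1\<close> and
  \<open>(B - w) H = 1\<close>. Both the matrix and the spectral parameter vary so that one identity
  covers two uses: \<open>A = B\<close> with \<open>w = cnj z\<close> for the Ward identity, and
  \<open>z = w\<close> for the removal of a row.\<close>

lemma resolvent_identity: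
  assumes A: "symmetric_upto n A" "symmetric_upto n B" and z: "Im z \<noteq> 0" "Im w \<noteq> 0" and ik: "i < n" "k < n"
  shows "resolvent n A z i k - resolvent n B w i k =
    (\<Sum>j<n. \<Sum>l<n. resolvent n A z i j * (of_real (B j l - A j l) + (if j = l then z - w else 0)) * resolvent n B w l k)"
proof -
  let ?G = "resolvent n A z" let ?H = "resolvent n B w"
  define SA where "SA = (\<Sum>j<n. \<Sum>l<n. ?G i j * of_real (A j l) * ?H l k)"
  define SB where "SB = (\<Sum>j<n. \<Sum>l<n. ?G i j * of_real (B j l) * ?H l k)"
  define T where "T = (\<Sum>j<n. ?G i j * ?H j k)"
  have "?G i k = (\<Sum>j<n. ?G i j * ((\<Sum>l<n. of_real (B j l) * ?H l k) - w * ?H j k))"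
    using ik by (subst sum.cong[OF refl, where h="\<lambda>j. ?G i j * (if j = k then 1 else 0)"])
      (auto simp: resolvent_right[OF A(2) z(2)] if_distrib[of "\<lambda>a. _ * a"] cong: if_cong)
  then have G: "?G i k = SB - w * T"
    by (simp add: SB_def T_def right_diff_distrib sum_subtractf sum_distrib_left mult_ac)
  have "?H i k = (\<Sum>l<n. ((\<Sum>j<n. ?G i j * of_real (A j l)) - z * ?G i l) * ?H l k)"
    using ik by (subst sum.cong[OF refl, where h="\<lambda>l. (if i = l then 1 else 0) * ?H l k"])
      (auto simp: resolvent_left[OF A(1) z(1)] if_distrib[of "\<lambda>a. a * _"] cong: if_cong)
  also have "\<dots> = (\<Sum>l<n. \<Sum>j<n. ?G i j * of_real (A j l) * ?H l k) - z * T"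
    by (simp add: T_def algebra_simps sum_subtractf sum_distrib_left sum_distrib_right)
  also have "(\<Sum>l<n. \<Sum>j<n. ?G i j * of_real (A j l) * ?H l k) = SA"
    unfolding SA_def by (rule sum.swap)
  finally have H: "?H i k = SA - z * T" .
  have D: "(\<Sum>j<n. \<Sum>l<n. ?G i j * (if j = l then z - w else 0) * ?H l k) = (z - w) * T"
    unfolding T_def sum_distrib_left
    by (intro sum.cong refl) (simp add: if_distrib[of "\<lambda>a. a * _"] if_distrib[of "\<lambda>a. _ * a"] mult_ac cong: if_cong)
  have "(\<Sum>j<n. \<Sum>l<n. ?G i j * (of_real (B j l - A j l) + (if j = l then z - w else 0)) * ?H l k) = SB - SA + (z - w) * T"
    unfolding SA_def SB_def D[symmetric]
    by (simp only: distrib_left distrib_right right_diff_distrib left_diff_distrib of_real_diff sum.distrib sum_subtractf)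
  then show ?thesis unfolding G H by (simp add: algebra_simps)
qed

text \<open>Since \<open>A\<close> is symmetric, row \<open>i\<close> and column \<open>i\<close> of
  the resolvent solve the same linear system, so their difference lies in the trivial kernel of
  \<open>A - z\<close>.\<close>

lemma resolvent_sym:
  assumes A: "symmetric_upto n A" and z: "Im z \<noteq> 0" and ik: "i < n" "k < n"
  shows "resolvent n A z i k = resolvent n A z k i"
proof -
  let ?G = "resolvent n A z"
  have R: "(\<Sum>j<n. of_real (A l j) * ?G i j) - z * ?G i l = (if i = l then 1 else 0)" if "l < n" for l
    using resolvent_left[OF A z ik(1) that] that
    by (subst sum.cong[OF refl, where h="\<lambda>j. ?G i j * of_real (A j l)"]) (auto simp: symmetric_uptoD[OF A that] mult.commute)
  define v where "v l = ?G i l - ?G l i" for l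
  have "v k = 0"
  proof (rule symmetric_eigenvector_zero[OF A z _ ik(2)])
    fix l assume l: "l < n"
    show "(\<Sum>j<n. of_real (A l j) * v j) = z * v l"
      using R[OF l] resolvent_right[OF A z l ik(1)]
      by (simp add: v_def algebra_simps sum_subtractf split: if_splits)
  qed
  then show ?thesis by (simp add: v_def)
qed

lemma resolvent_cnj:
  assumes A: "symmetric_upto n A" and z: "Im z \<noteq> 0" and ik: "i < n" "k < n"
  shows "resolvent n A (cnj z) i k = cnj (resolvent n A z i k)"
proof -
  define v where "v l = resolvent n A (cnj z) l k - cnj (resolvent n A z l k)" for l
  have z': "Im (cnj z) \<noteq> 0" using z by simp
  have "v i = 0"
  proof (rule symmetric_eigenvector_zero[OF A z' _ ik(1)])
    fix l assume l: "l < n"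
    show "(\<Sum>j<n. of_real (A l j) * v j) = cnj z * v l"
      using arg_cong[OF resolvent_right[OF A z l ik(2)], of cnj] resolvent_right[OF A z' l ik(2)]
      by (simp add: v_def algebra_simps sum_subtractf split: if_splits)
  qed
  then show ?thesis by (simp add: v_def)
qed

text \<open>Diagonal entry of \<open>G - G^* = (z - cnj z) G G^*\<close>, where the adjoint is the
  resolvent at \<open>cnj z\<close>.\<close>

lemma resolvent_ward:
  assumes A: "symmetric_upto n A" and z: "Im z \<noteq> 0" and i: "i < n"
  shows "Im z * (\<Sum>j<n. (cmod (resolvent n A z i j))\<^sup>2) = Im (resolvent n A z i i)"
proof -
  let ?G = "resolvent n A z"
  have "?G i i - cnj (?G i i) = (\<Sum>j<n. \<Sum>l<n. ?G i j * (if j = l then z - cnj z else 0) * cnj (?G l i))"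
    using resolvent_identity[OF A A z, of "cnj z" i i] z i by (simp add: resolvent_cnj[OF A z])
  also have "\<dots> = (\<Sum>j<n. ?G i j * (z - cnj z) * cnj (?G i j))"
    by (intro sum.cong refl) (simp add: if_distrib[of "\<lambda>a. a * _"] if_distrib[of "\<lambda>a. _ * a"] resolvent_sym[OF A z i] cong: if_cong)
  also have "\<dots> = (z - cnj z) * of_real (\<Sum>j<n. (cmod (?G i j))\<^sup>2)"
    by (simp add: sum_distrib_left complex_norm_square mult_ac del: of_real_power)
  finally show ?thesis by (simp add: complex_eq_iff)
qed

text \<open>Keep only the term \<open>j = i\<close> of the Ward identity:
  \<open>Im z * |G_ii|^2 <= Im G_ii <= |G_ii|\<close>.\<close>

lemma resolvent_diag_bound:
  assumes A: "symmetric_upto n A" and z: "Im z > 0" and i: "i < n"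
  shows "cmod (resolvent n A z i i) \<le> 1 / Im z"
proof -
  let ?G = "resolvent n A z"
  have "(cmod (?G i i))\<^sup>2 \<le> (\<Sum>j<n. (cmod (?G i j))\<^sup>2)"
    using i by (intro member_le_sum) auto
  then have "Im z * (cmod (?G i i))\<^sup>2 \<le> Im z * (\<Sum>j<n. (cmod (?G i j))\<^sup>2)" using z by simp
  also have "\<dots> \<le> cmod (?G i i)" using resolvent_ward[OF A _ i] z abs_Im_le_cmod[of "?G i i"] by simp
  finally have "Im z * cmod (?G i i) * cmod (?G i i) \<le> 1 * cmod (?G i i)" by (simp add: power2_eq_square mult_ac)
  then have "cmod (?G i i) = 0 \<or> Im z * cmod (?G i i) \<le> 1"
    by (metis mult_le_cancel_right norm_ge_zero order_less_le)
  then show ?thesis using z by (auto simp: field_simps)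
qed

lemma resolvent_row_bound:
  assumes A: "symmetric_upto n A" and z: "Im z > 0" and i: "i < n"
  shows "(\<Sum>j<n. (cmod (resolvent n A z i j))\<^sup>2) \<le> (1 / Im z)\<^sup>2"
proof -
  have "Im z * (\<Sum>j<n. (cmod (resolvent n A z i j))\<^sup>2) \<le> 1 / Im z"
    using resolvent_ward[OF A _ i] z abs_Im_le_cmod[of "resolvent n A z i i"] resolvent_diag_bound[OF A z i] by simp
  then show ?thesis using z by (simp add: field_simps power2_eq_square)
qed

lemma resolvent_bound:
  assumes A: "symmetric_upto n A" and z: "Im z > 0" and i: "i < n" "j < n"
  shows "cmod (resolvent n A z i j) \<le> 1 / Im z"
proof -
  have "(cmod (resolvent n A z i j))\<^sup>2 \<le> (\<Sum>j<n. (cmod (resolvent n A z i j))\<^sup>2)"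
    using i by (intro member_le_sum) auto
  also note resolvent_row_bound[OF A z i(1)]
  finally show ?thesis using power2_le_imp_le z by simp
qed

section \<open>Removing one row and column\<close>

text \<open>Setting the row and column to zero, instead of deleting them, keeps all resolvents on
  the same index range; index \<open>i\<close> then decouples from the others, as
  \<open>zero_row_resolvent_row\<close> records.\<close>

definition zero_row :: "nat \<Rightarrow> (nat \<Rightarrow> nat \<Rightarrow> real) \<Rightarrow> nat \<Rightarrow> nat \<Rightarrow> real" where
  "zero_row i A k l = (if k = i \<or> l = i then 0 else A k l)"

lemma symmetric_zero_row: "symmetric_upto n A \<Longrightarrow> symmetric_upto n (zero_row i A)"
  by (auto simp: symmetric_upto_def zero_row_def)

context
  fixes n :: nat and A :: "nat \<Rightarrow> nat \<Rightarrow> real" and z :: complex and i :: nat and G G' :: "nat \<Rightarrow> nat \<Rightarrow> complex"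
  assumes A: "symmetric_upto n A" and z: "Im z > 0" and i: "i < n"
  defines "G \<equiv> resolvent n A z" and "G' \<equiv> resolvent n (zero_row i A) z"
begin

lemma zero_row_resolvent_row: "k < n \<Longrightarrow> k \<noteq> i \<Longrightarrow> G' i k = 0"
  using resolvent_right[OF symmetric_zero_row[OF A, of i], of z i k] z i
  by (auto simp: zero_row_def G'_def)

text \<open>The perturbation is supported on row and column \<open>i\<close>. Its entries in column
  \<open>i\<close> meet \<open>G' i k = 0\<close>, so only the row \<open>a = i\<close>
  survives.\<close>

lemma resolvent_minus_zero_row:
  assumes jk: "j < n" "k < n" "k \<noteq> i"
  shows "G j k - G' j k = - (G j i * (\<Sum>m\<in>{..<n}-{i}. of_real (A i m) * G' m k))"
proof -
  have "G j k - G' j k = (\<Sum>a<n. \<Sum>b<n. G j a * of_real (zero_row i A a b - A a b) * G' b k)"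
    using resolvent_identity[OF A symmetric_zero_row[OF A, of i], of z z j k] z jk
    by (simp add: G_def G'_def cong: if_cong)
  also have "\<dots> = (\<Sum>a<n. if a = i then - (G j i * (\<Sum>m\<in>{..<n}-{i}. of_real (A i m) * G' m k)) else 0)"
  proof (intro sum.cong refl)
    fix a assume a: "a \<in> {..<n}"
    have "(\<Sum>b<n. G j a * of_real (zero_row i A a b - A a b) * G' b k)
        = (\<Sum>b\<in>{..<n}-{i}. G j a * of_real (zero_row i A a b - A a b) * G' b k)"
      using zero_row_resolvent_row[OF jk(2,3)] by (intro sum.mono_neutral_right) auto
    also have "\<dots> = (if a = i then - (G j i * (\<Sum>m\<in>{..<n}-{i}. of_real (A i m) * G' m k)) else 0)"
      by (auto simp: zero_row_def sum_distrib_left sum_negf[symmetric] mult_ac intro!: sum.cong sum.neutral)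
    finally show "(\<Sum>b<n. G j a * of_real (zero_row i A a b - A a b) * G' b k) = \<dots>" .
  qed
  also have "\<dots> = - (G j i * (\<Sum>m\<in>{..<n}-{i}. of_real (A i m) * G' m k))"
    using i by simp
  finally show ?thesis .
qed

text \<open>Take the \<open>(i, i)\<close> entry of \<open>G (A - z) = 1\<close> and express each
  off-diagonal \<open>G i k\<close> as a multiple of \<open>G i i\<close> by the preceding
  lemma.\<close>

lemma schur_complement:
  "G i i * (of_real (A i i) - z -
     (\<Sum>k\<in>{..<n}-{i}. \<Sum>m\<in>{..<n}-{i}. of_real (A i k) * of_real (A i m) * G' m k)) = 1"
proof -
  have "1 = (\<Sum>j<n. G i j * of_real (A j i)) - z * G i i"
    using resolvent_left[OF A, of z i i] z i by (simp add: G_def)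
  also have "(\<Sum>j<n. G i j * of_real (A j i)) = G i i * of_real (A i i) + (\<Sum>j\<in>{..<n}-{i}. G i j * of_real (A j i))"
    using i by (subst sum.remove[of _ i]) auto
  also have "(\<Sum>j\<in>{..<n}-{i}. G i j * of_real (A j i)) =
      (\<Sum>k\<in>{..<n}-{i}. - (G i i * (\<Sum>m\<in>{..<n}-{i}. of_real (A i k) * of_real (A i m) * G' m k)))"
  proof (intro sum.cong refl)
    fix k assume k: "k \<in> {..<n}-{i}"
    have "G i k = - (G i i * (\<Sum>m\<in>{..<n}-{i}. of_real (A i m) * G' m k))"
      using resolvent_minus_zero_row[of i k] zero_row_resolvent_row[of k] k i by simp
    then show "G i k * of_real (A k i) = - (G i i * (\<Sum>m\<in>{..<n}-{i}. of_real (A i k) * of_real (A i m) * G' m k))"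
      using symmetric_uptoD[OF A, of k i] k i by (simp add: sum_distrib_left sum_distrib_right mult_ac)
  qed
  finally show ?thesis by (simp add: algebra_simps sum_negf sum_distrib_left)
qed

lemma resolvent_diag_nonzero: "G i i \<noteq> 0"
  using schur_complement by auto

text \<open>Both \<open>G j j - G' j j = - G j i * S\<close> and \<open>G i j = - G i i * S\<close>
  contain the same coupling \<open>S\<close>; multiplying the first by \<open>G i i\<close>
  eliminates it.\<close>

lemma resolvent_diag_minus_zero_row:
  assumes j: "j < n" "j \<noteq> i"
  shows "cmod (G i i) * cmod (G j j - G' j j) = (cmod (G i j))\<^sup>2"
proof -
  define S where "S = (\<Sum>m\<in>{..<n}-{i}. of_real (A i m) * G' m j)"
  have "G j j - G' j j = - (G j i * S)" "G i j = - (G i i * S)"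
    using resolvent_minus_zero_row[of j j] resolvent_minus_zero_row[of i j] zero_row_resolvent_row[of j] j i
    by (simp_all add: S_def)
  moreover have "G j i = G i j"
    using resolvent_sym[OF A, of z j i] z i j by (simp add: G_def)
  ultimately show ?thesis by (simp add: norm_mult power2_eq_square)
qed

text \<open>By the Ward identity the squares \<open>|G_ij|^2\<close> sum to at most
  \<open>|G_ii| / Im z\<close>. The factor \<open>|G_ii|\<close> cancels, which leaves a bound
  independent of \<open>n\<close>.\<close>

lemma resolvent_diag_diff_sum:
  "(\<Sum>j\<in>{..<n}-{i}. cmod (G j j - G' j j)) \<le> 1 / Im z"
proof -
  have "cmod (G i i) * (\<Sum>j\<in>{..<n}-{i}. cmod (G j j - G' j j)) = (\<Sum>j\<in>{..<n}-{i}. (cmod (G i j))\<^sup>2)"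
    unfolding sum_distrib_left by (intro sum.cong refl resolvent_diag_minus_zero_row) auto
  also have "\<dots> \<le> (\<Sum>j<n. (cmod (G i j))\<^sup>2)"
    by (intro sum_mono2) auto
  also have "\<dots> = Im (G i i) / Im z"
    using resolvent_ward[OF A _ i, of z] z by (simp add: G_def field_simps)
  also have "\<dots> \<le> cmod (G i i) * (1 / Im z)"
    using z abs_Im_le_cmod[of "G i i"] by (simp add: divide_right_mono)
  finally show ?thesis using resolvent_diag_nonzero by (subst (asm) mult_le_cancel_left_pos) auto
qed

text \<open>Index \<open>i\<close> costs \<open>1 / Im z\<close> for each of the two matrices, and
  all other indices together cost one more.\<close>

lemma resolvent_trace_zero_row:
  "cmod ((\<Sum>j<n. G j j) - (\<Sum>j<n. G' j j)) \<le> 3 / Im z"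
proof -
  have "(\<Sum>j<n. G j j) - (\<Sum>j<n. G' j j) = (G i i - G' i i) + (\<Sum>j\<in>{..<n}-{i}. G j j - G' j j)"
    unfolding sum_subtractf[symmetric] using i by (subst sum.remove[of _ i]) auto
  also have "cmod \<dots> \<le> (cmod (G i i) + cmod (G' i i)) + (\<Sum>j\<in>{..<n}-{i}. cmod (G j j - G' j j))"
    by (intro norm_triangle_le add_mono norm_triangle_ineq4 norm_sum)
  also have "\<dots> \<le> (1 / Im z + 1 / Im z) + 1 / Im z"
    using resolvent_diag_bound[OF A z i] resolvent_diag_bound[OF symmetric_zero_row[OF A] z i, of i]
    by (intro add_mono resolvent_diag_diff_sum) (auto simp: G_def G'_def)
  finally show ?thesis by simp
qed

end

section \<open>Eigenvalues and the trace of the resolvent\<close>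

lemma poly_char_poly_det:
  fixes B S :: "complex mat"
  assumes B: "B \<in> carrier_mat m m" and S: "S \<in> carrier_mat m m"
    and eq: "\<And>i j. i < m \<Longrightarrow> j < m \<Longrightarrow> S $$ (i, j) = B $$ (i, j) - (if i = j then z else 0)"
  shows "poly (char_poly B) z = (-1) ^ m * Determinant.det S"
proof -
  have "poly (char_poly B) z = Determinant.det ((-1) \<cdot>\<^sub>m S)"
    unfolding char_poly_def
    by (rule poly_det_cong[of _ m]) (use B S eq in \<open>auto simp: char_poly_matrix_def\<close>)
  also have "\<dots> = (-1) ^ m * Determinant.det S"
    using S by simp
  finally show ?thesis .
qed

lemma poly_pderiv_prod_list_linear:
  fixes z :: complex
  assumes "z \<notin> set as"
  shows "poly (pderiv (\<Prod>a\<leftarrow>as. [:- a, 1:])) z = poly (\<Prod>a\<leftarrow>as. [:- a, 1:]) z * (\<Sum>a\<leftarrow>as. 1 / (z - a))"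
  using assms
proof (induction as)
  case (Cons a as)
  define P where "P = (\<Prod>a\<leftarrow>as. [:- a, 1:])"
  have "poly (pderiv ([:- a, 1:] * P)) z = (z - a) * poly (pderiv P) z + poly P z"
    unfolding pderiv_mult by (simp add: pderiv_pCons del: mult_pCons_left)
  also have "\<dots> = poly ([:- a, 1:] * P) z * (1 / (z - a) + (\<Sum>a\<leftarrow>as. 1 / (z - a)))"
  proof -
    have e: "poly ([:- a, 1:] * P) z = (z - a) * poly P z" by (simp add: algebra_simps)
    show ?thesis unfolding e using Cons by (simp add: P_def[symmetric] distrib_left)
  qed
  finally show ?case by (simp add: P_def del: mult_pCons_left)
qed simp

text \<open>The characteristic polynomial is split over the complex numbers; its roots are real
  because a non-real one would make a shifted matrix singular, so the factorization descends to the
  reals. For the trace, the derivative at \<open>z\<close> is computed twice: as a sum of principal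
  minors, which is the determinant times the trace of the resolvent up to sign, and as a logarithmic
  derivative over the roots.\<close>

lemma symmetric_eigvals:
  assumes A: "symmetric_upto n A"
  shows "size (eigvals_mset (mat n n (\<lambda>(i, j). A i j))) = n"
    and "Im z > 0 \<Longrightarrow> (\<Sum>j<n. resolvent n A z j j) =
           (\<Sum>x\<in>#eigvals_mset (mat n n (\<lambda>(i, j). A i j)). 1 / (complex_of_real x - z))"
proof -
  define R where "R = mat n n (\<lambda>(i, j). A i j)"
  define B where "B = map_mat complex_of_real R"
  have R: "R \<in> carrier_mat n n" and B: "B \<in> carrier_mat n n" by (simp_all add: R_def B_def)
  have det: "poly (char_poly B) w = (-1) ^ n * Determinant.det (shifted_mat n A w)" for w
    by (rule poly_char_poly_det[OF B]) (auto simp: shifted_mat_def B_def R_def)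
  obtain as where as: "char_poly B = (\<Prod>a\<leftarrow>as. [:- a, 1:])" "length as = n"
    using char_poly_factorized[OF B] by blast
  have real: "Im a = 0" if "a \<in> set as" for a
  proof (rule ccontr)
    assume "Im a \<noteq> 0"
    then have "poly (char_poly B) a \<noteq> 0"
      using det_shifted_mat_nonzero[OF A] by (simp add: det)
    moreover have "poly (char_poly B) a = 0"
      using that unfolding as(1) by (induction as) auto
    ultimately show False by simp
  qed
  define bs where "bs = map Re as"
  have as_bs: "as = map complex_of_real bs"
    unfolding bs_def map_map comp_def using real by (intro map_idI[symmetric]) (auto simp: complex_eq_iff)
  interpret h: map_poly_inj_idom_hom complex_of_real ..
  have "map_poly complex_of_real (char_poly R) = char_poly B"
    unfolding B_def by (rule of_real_hom.char_poly_hom[OF R, symmetric])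
  also have "\<dots> = map_poly complex_of_real (\<Prod>b\<leftarrow>bs. [:- b, 1:])"
    unfolding as(1) as_bs h.hom_prod_list map_map comp_def by (simp add: of_real_hom.map_poly_pCons_hom)
  finally have R_bs: "char_poly R = (\<Prod>b\<leftarrow>bs. [:- b, 1:])" by simp
  have ev: "eigvals_mset R = mset bs"
    unfolding eigvals_mset_def R_bs
  proof (induction bs)
    case (Cons b bs)
    have "(\<Prod>b\<leftarrow>bs. [:- b, 1:]) \<noteq> (0 :: real poly)" by (auto simp: prod_list_zero_iff)
    then show ?case using Cons by (simp add: proots_mult del: mult_pCons_left)
  qed simp
  show "size (eigvals_mset (mat n n (\<lambda>(i, j). A i j))) = n"
    using ev as(2) by (simp add: R_def[symmetric] bs_def)
  assume z: "Im z > 0"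
  let ?S = "shifted_mat n A z"
  have d: "Determinant.det ?S \<noteq> 0" using det_shifted_mat_nonzero[OF A, of z] z by simp
  have "poly (pderiv (char_poly B)) z = (\<Sum>i<n. poly (char_poly (mat_delete B i i)) z)"
    unfolding pderiv_char_poly[OF B] by (simp add: poly_sum)
  also have "\<dots> = (\<Sum>i<n. (-1) ^ (n - 1) * Determinant.det (mat_delete ?S i i))"
  proof (intro sum.cong refl poly_char_poly_det)
    fix i assume "i \<in> {..<n}"
    then have n: "n > 0" "i < n" by auto
    show "mat_delete B i i \<in> carrier_mat (n - 1) (n - 1)" "mat_delete ?S i i \<in> carrier_mat (n - 1) (n - 1)"
      using mat_delete_carrier[OF B] mat_delete_carrier[OF shifted_mat_carrier] by auto
    fix k l assume "k < n - 1" "l < n - 1"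
    then show "mat_delete ?S i i $$ (k, l) = mat_delete B i i $$ (k, l) - (if k = l then z else 0)"
      using n by (auto simp: mat_delete_def shifted_mat_def B_def R_def)
  qed
  also have "\<dots> = (-1) ^ (n - 1) * Determinant.det ?S * (\<Sum>j<n. resolvent n A z j j)"
    using d by (simp add: resolvent_def cofactor_def sum_distrib_left power_add[symmetric] mult_2[symmetric])
  finally have 1: "poly (pderiv (char_poly B)) z = (-1) ^ (n - 1) * Determinant.det ?S * (\<Sum>j<n. resolvent n A z j j)" .
  have "z \<notin> set as" using real z by force
  from poly_pderiv_prod_list_linear[OF this]
  have 2: "poly (pderiv (char_poly B)) z = (-1) ^ n * Determinant.det ?S * (\<Sum>a\<leftarrow>as. 1 / (z - a))"
    unfolding as(1)[symmetric] det .
  have "(\<Sum>j<n. resolvent n A z j j) = - (\<Sum>a\<leftarrow>as. 1 / (z - a))"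
  \<comment> \<open>For \<open>n = 0\<close> the exponent \<open>n - 1\<close> is truncated and the
    two signs agree instead of being opposite; both sums are empty there.\<close>
  proof (cases n)
    case 0 then show ?thesis using as(2) by simp
  next
    case (Suc m)
    have "(-1) ^ m * Determinant.det ?S * (\<Sum>j<n. resolvent n A z j j) = (-1) ^ m * Determinant.det ?S * (- (\<Sum>a\<leftarrow>as. 1 / (z - a)))"
      using 1 2 Suc by simp
    moreover have "(-1) ^ m * Determinant.det ?S \<noteq> 0" using d by simp
    ultimately show ?thesis using mult_left_cancel by blast
  qed
  also have "\<dots> = (\<Sum>b\<leftarrow>bs. 1 / (complex_of_real b - z))"
    unfolding as_bs by (induction bs) (simp_all add: minus_divide_right add.commute)
  also have "\<dots> = (\<Sum>x\<in>#eigvals_mset R. 1 / (complex_of_real x - z))"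
    unfolding ev by (simp flip: sum_mset_sum_list)
  finally show "(\<Sum>j<n. resolvent n A z j j) =
           (\<Sum>x\<in>#eigvals_mset (mat n n (\<lambda>(i, j). A i j)). 1 / (complex_of_real x - z))"
    by (simp add: R_def)
qed

section \<open>Measurability of resolvent entries\<close>

lemma borel_measurable_det:
  fixes X :: "nat \<Rightarrow> nat \<Rightarrow> 'a \<Rightarrow> complex"
  assumes [measurable]: "\<And>i j. i < n \<Longrightarrow> j < n \<Longrightarrow> X i j \<in> borel_measurable M"
  shows "(\<lambda>x. Determinant.det (mat n n (\<lambda>(i, j). X i j x))) \<in> borel_measurable M"
proof -
  have "Determinant.det (mat n n (\<lambda>(i, j). X i j x)) = (\<Sum> p \<in> {p. p permutes {0 ..< n}}. signof p * (\<Prod> i = 0 ..< n. X i (p i) x))" for x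
    unfolding Determinant.det_def
    by (auto intro!: sum.cong prod.cong arg_cong2[where f="(*)"] simp: permutes_in_image)
  moreover have "(\<lambda>x. \<Sum> p \<in> {p. p permutes {0 ..< n}}. signof p * (\<Prod> i = 0 ..< n. X i (p i) x)) \<in> borel_measurable M"
    by (intro borel_measurable_sum borel_measurable_times borel_measurable_prod borel_measurable_const assms)
       (auto dest: permutes_in_image)
  ultimately show ?thesis by simp
qed

lemma borel_measurable_resolvent:
  fixes X :: "'a \<Rightarrow> nat \<Rightarrow> nat \<Rightarrow> real"
  assumes X: "\<And>i j. i < n \<Longrightarrow> j < n \<Longrightarrow> (\<lambda>x. X x i j) \<in> borel_measurable M" and ij: "i < n" "j < n"
  shows "(\<lambda>x. resolvent n (X x) z i j) \<in> borel_measurable M"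
proof -
  have X': "(\<lambda>x. complex_of_real (X x i j)) \<in> borel_measurable M" if "i < n" "j < n" for i j
    using X[OF that] by measurable
  have "(\<lambda>x. Determinant.det (shifted_mat n (X x) z)) \<in> borel_measurable M"
    unfolding shifted_mat_def
    by (rule borel_measurable_det) (auto intro!: borel_measurable_diff borel_measurable_const X')
  moreover have "(\<lambda>x. cofactor (shifted_mat n (X x) z) j i) \<in> borel_measurable M"
  proof -
    \<comment> \<open>The minor is rewritten as a \<open>mat\<close> whose indices skip
      \<open>j\<close> and \<open>i\<close>, the shape to which \<open>borel_measurable_det\<close>
      applies.\<close>
    have "mat_delete (shifted_mat n (X x) z) j i = mat (n - 1) (n - 1) (\<lambda>(k, l).
       complex_of_real (X x (if k < j then k else Suc k) (if l < i then l else Suc l)) - (if (if k < j then k else Suc k) = (if l < i then l else Suc l) then z else 0))" for x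
      unfolding mat_delete_def using ij by (intro eq_matI) (auto simp: shifted_mat_def)
    then show ?thesis unfolding cofactor_def using ij
      by (auto intro!: borel_measurable_times borel_measurable_const borel_measurable_det borel_measurable_diff X')
  qed
  ultimately show ?thesis unfolding resolvent_def by (intro borel_measurable_divide)
qed

section \<open>The Stieltjes transform\<close>

text \<open>Orthogonality of the sines, which leaves a single term of
  \<open>chebyshev_series\<close> after integration against \<open>sin x\<close>.\<close>

lemma sin_sin_Suc_has_integral:
  "((\<lambda>x. sin x * sin (real (Suc k) * x)) has_integral (if k = 0 then pi / 2 else 0)) {0..pi}"
proof (cases "k = 0")
  case True
  have "((\<lambda>x. sin x * sin x) has_integral ((pi / 2 - sin pi * cos pi / 2) - (0 / 2 - sin 0 * cos 0 / 2))) {0..pi}"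
  proof (rule fundamental_theorem_of_calculus)
    fix x :: real
    have "1 / 2 - (cos x * cos x - sin x * sin x) / 2 = sin x * sin x"
      using sin_cos_squared_add3[of x] by (simp add: field_simps)
    moreover have "((\<lambda>x. x / 2 - sin x * cos x / 2) has_real_derivative 1 / 2 - (cos x * cos x - sin x * sin x) / 2) (at x within {0..pi})"
      by (auto intro!: derivative_eq_intros)
    ultimately show "((\<lambda>x. x / 2 - sin x * cos x / 2) has_vector_derivative sin x * sin x) (at x within {0..pi})"
      unfolding has_real_derivative_iff_has_vector_derivative[symmetric] by simp
  qed simp
  then show ?thesis using True by simp
next
  case False
  \<comment> \<open>Antiderivative read off from the product-to-sum formula; the division by
    \<open>k\<close> is why \<open>k = 0\<close> is treated apart.\<close>
  let ?F = "\<lambda>x. sin (real k * x) / (2 * real k) - sin (real (k + 2) * x) / (2 * real (k + 2))"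
  have "((\<lambda>x. sin x * sin (real (Suc k) * x)) has_integral (?F pi - ?F 0)) {0..pi}"
  proof (rule fundamental_theorem_of_calculus)
    fix x :: real
    have "sin (real (Suc k) * x) * sin x = (cos (real (Suc k) * x - x) - cos (real (Suc k) * x + x)) / 2"
      by (rule sin_times_sin)
    also have "real (Suc k) * x - x = real k * x" by (simp add: algebra_simps)
    also have "real (Suc k) * x + x = real (k + 2) * x" by (simp add: algebra_simps)
    finally have e: "sin x * sin (real (Suc k) * x) = cos (real k * x) / 2 - cos (real (k + 2) * x) / 2"
      by (simp add: mult.commute diff_divide_distrib)
    have "((\<lambda>x. sin (c * x) / (2 * c)) has_real_derivative cos (c * x) / 2) (at x within {0..pi})" if "c \<noteq> 0" for c :: real
      using that by (auto intro!: derivative_eq_intros)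
    then show "(?F has_vector_derivative sin x * sin (real (Suc k) * x)) (at x within {0..pi})"
      unfolding has_real_derivative_iff_has_vector_derivative[symmetric] e
      using False by (intro DERIV_diff) (simp_all only: of_nat_eq_0_iff, simp_all)
  qed simp
  moreover have "sin (real j * pi) = 0" for j by (simp add: sin_npi)
  ultimately show ?thesis using False by (simp only: mult_zero_right sin_zero) simp
qed

text \<open>Generating function of the Chebyshev polynomials of the second kind, multiplied by
  \<open>sin x\<close>: the difference of two geometric series with ratios \<open>m * cis x\<close>
  and \<open>m * cis (- x)\<close>.\<close>

lemma chebyshev_series:
  fixes m :: complex
  assumes m: "cmod m < 1"
  shows "(\<lambda>k. m ^ k * complex_of_real (sin (real (Suc k) * x))) sums
           (complex_of_real (sin x) / (1 - 2 * m * complex_of_real (cos x) + m\<^sup>2))"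
proof -
  define u v where "u = cis x" and "v = cis (- x)"
  have uv: "u * v = 1" by (simp add: u_def v_def cis_mult)
  have s: "u + v = 2 * complex_of_real (cos x)" "u - v = 2 * \<i> * complex_of_real (sin x)"
    by (simp_all add: u_def v_def complex_eq_iff)
  have nz: "1 - m * u \<noteq> 0" "1 - m * v \<noteq> 0"
    using m by (auto simp: u_def v_def norm_mult dest: arg_cong[of _ _ cmod])
  have "(\<lambda>k. (u * (m * u) ^ k - v * (m * v) ^ k) / (2 * \<i>)) sums ((u * (1 / (1 - m * u)) - v * (1 / (1 - m * v))) / (2 * \<i>))"
    using m by (intro sums_divide sums_diff sums_mult geometric_sums) (auto simp: u_def v_def norm_mult)
  also have "(\<lambda>k. (u * (m * u) ^ k - v * (m * v) ^ k) / (2 * \<i>)) = (\<lambda>k. m ^ k * complex_of_real (sin (real (Suc k) * x)))"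
  proof
    fix k
    have "u ^ Suc k - v ^ Suc k = 2 * \<i> * complex_of_real (sin (real (Suc k) * x))"
      unfolding u_def v_def by (simp only: Complex.DeMoivre) (simp add: complex_eq_iff)
    moreover have "u * (m * u) ^ k - v * (m * v) ^ k = m ^ k * (u ^ Suc k - v ^ Suc k)"
      by (simp add: power_mult_distrib algebra_simps)
    ultimately show "(u * (m * u) ^ k - v * (m * v) ^ k) / (2 * \<i>) = m ^ k * complex_of_real (sin (real (Suc k) * x))"
      by (simp only: times_divide_eq_right[symmetric]) simp
  qed
  also have "(u * (1 / (1 - m * u)) - v * (1 / (1 - m * v))) / (2 * \<i>) = ((u - v) / (2 * \<i>)) / ((1 - m * u) * (1 - m * v))"
    using nz by (simp add: field_simps)
  also have "(1 - m * u) * (1 - m * v) = 1 - m * (u + v) + m\<^sup>2 * (u * v)"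
    by (simp add: algebra_simps power2_eq_square)
  finally show ?thesis unfolding uv s by (simp add: mult_ac)
qed

text \<open>Multiply \<open>chebyshev_series\<close> by \<open>sin x\<close> and integrate term by
  term, which the Weierstrass test permits. Only \<open>k = 0\<close> contributes, and its
  coefficient \<open>m ^ 0\<close> makes the value independent of \<open>m\<close>.\<close>

lemma sin_squared_poisson_has_integral:
  fixes m :: complex
  assumes m: "cmod m < 1"
  shows "((\<lambda>x. of_real ((sin x)\<^sup>2) / (1 - 2 * m * of_real (cos x) + m\<^sup>2)) has_integral (pi / 2)) {0..pi}"
proof -
  let ?f = "\<lambda>k x. m ^ k * of_real (sin x * sin (real (Suc k) * x))"
  let ?g = "\<lambda>x. of_real ((sin x)\<^sup>2) / (1 - 2 * m * of_real (cos x) + m\<^sup>2)"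
  have g: "(\<lambda>k. ?f k x) sums ?g x" for x
    using sums_mult[OF chebyshev_series[OF m, of x], of "of_real (sin x)"]
    by (simp add: mult_ac power2_eq_square)
  have "uniform_limit {0..pi} (\<lambda>n x. \<Sum>k<n. ?f k x) (\<lambda>x. suminf (\<lambda>k. ?f k x)) sequentially"
  proof (rule Weierstrass_m_test)
    show "norm (?f k x) \<le> cmod m ^ k" for k x
      by (auto simp: norm_mult norm_power abs_mult intro!: mult_left_le mult_le_one simp del: of_nat_Suc)
    show "summable (\<lambda>k. cmod m ^ k)" using m by (intro summable_geometric) auto
  qed
  moreover have "(\<lambda>x. suminf (\<lambda>k. ?f k x)) = ?g"
    using g by (simp add: sums_iff fun_eq_iff)
  ultimately have u: "uniform_limit {0..pi} (\<lambda>n x. \<Sum>k<n. ?f k x) ?g sequentially" by simp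
  obtain I J where IJ: "\<And>n. ((\<lambda>x. \<Sum>k<n. ?f k x) has_integral I n) {0..pi}" "(?g has_integral J) {0..pi}" "I \<longlonglongrightarrow> J"
    by (rule uniform_limit_integral[OF u]) (auto intro!: continuous_intros)
  have "I n = of_real (pi / 2)" if "n > 0" for n
  proof -
    have "((\<lambda>x. \<Sum>k<n. ?f k x) has_integral (\<Sum>k<n. m ^ k * of_real (if k = 0 then pi / 2 else 0))) {0..pi}"
      by (intro has_integral_sum has_integral_mult_right has_integral_of_real sin_sin_Suc_has_integral) auto
    also have "(\<Sum>k<n. m ^ k * of_real (if k = 0 then pi / 2 else 0)) = (\<Sum>k<n. if k = 0 then of_real (pi / 2) else 0)"
      by (intro sum.cong) auto
    also have "\<dots> = of_real (pi / 2)" using that by simp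
    finally show ?thesis using IJ(1)[of n] has_integral_unique by blast
  qed
  then have "I \<longlonglongrightarrow> of_real (pi / 2)"
    by (intro tendsto_eventually) (auto simp: eventually_sequentially intro!: exI[of _ 1])
  with IJ show ?thesis using LIMSEQ_unique by auto
qed

text \<open>Substitution \<open>x = - 2 * cos \<theta>\<close>, with the minus sign so that the map
  increases on \<open>[0, pi]\<close>. The square root and the derivative each contribute a factor
  \<open>2 * sin \<theta>\<close>.\<close>

lemma integral_semicircle:
  fixes f :: "real \<Rightarrow> complex"
  assumes f: "continuous_on UNIV f"
  shows "integral\<^sup>L semicircle_distribution f = integral {0..pi} (\<lambda>x. (2 / pi * (sin x)\<^sup>2) *\<^sub>R f (- 2 * cos x))"
proof -
  let ?d = "\<lambda>x::real. sqrt (max 0 (4 - x\<^sup>2)) / (2 * pi)"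
  have c: "continuous_on A f" for A using f continuous_on_subset by blast
  have d: "continuous_on A ?d" for A by (intro continuous_intros) auto
  have [measurable]: "f \<in> borel_measurable borel" using f by (rule borel_measurable_continuous_onI)
  have [measurable]: "?d \<in> borel_measurable borel" using d by (rule borel_measurable_continuous_onI)
  have z: "?d x = 0" if "x \<notin> {-2..2}" for x
  proof -
    have "\<bar>x\<bar>\<^sup>2 > 2\<^sup>2" using that by (intro power_strict_mono) auto
    then show ?thesis by simp
  qed
  have si: "set_integrable lborel {-2..2} (\<lambda>x. ?d x *\<^sub>R f x)"
    by (intro borel_integrable_atLeastAtMost' continuous_on_scaleR d c)
  have "integral\<^sup>L semicircle_distribution f = integral\<^sup>L lborel (\<lambda>x. ?d x *\<^sub>R f x)"
    unfolding semicircle_distribution_def by (subst integral_density) auto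
  also have "\<dots> = (LINT x : {-2..2} | lborel. ?d x *\<^sub>R f x)"
    unfolding set_lebesgue_integral_def
    by (intro Bochner_Integration.integral_cong refl) (use z in \<open>auto simp: indicator_def\<close>)
  also have "\<dots> = integral {-2..2} (\<lambda>x. ?d x *\<^sub>R f x)"
    by (rule set_borel_integral_eq_integral(2)[OF si])
  also have "\<dots> = integral {0..pi} (\<lambda>x. (2 * sin x) *\<^sub>R (?d (- 2 * cos x) *\<^sub>R f (- 2 * cos x)))"
  proof (rule integral_unique[symmetric])
    have "((\<lambda>x. (2 * sin x) *\<^sub>R (?d (- 2 * cos x) *\<^sub>R f (- 2 * cos x))) has_integral
        integral {- 2 * cos 0..- 2 * cos pi} (\<lambda>x. ?d x *\<^sub>R f x)) {0..pi}"
    proof (rule has_integral_substitution[where c="-2" and d=2])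
      show "(\<lambda>x. - 2 * cos x) ` {0..pi} \<subseteq> {- 2..2}"
      proof -
        have "- 2 * cos x \<le> 2 \<and> - 2 \<le> - 2 * cos x" for x :: real
          using cos_ge_minus_one[of x] cos_le_one[of x] by linarith
        then show ?thesis by auto
      qed
      show "continuous_on {- 2..2} (\<lambda>x. ?d x *\<^sub>R f x)" by (intro continuous_on_scaleR d c)
    qed (auto intro!: derivative_eq_intros)
    then show "((\<lambda>x. (2 * sin x) *\<^sub>R (?d (- 2 * cos x) *\<^sub>R f (- 2 * cos x))) has_integral
        integral {- 2..2} (\<lambda>x. ?d x *\<^sub>R f x)) {0..pi}" by simp
  qed
  also have "\<dots> = integral {0..pi} (\<lambda>x. (2 / pi * (sin x)\<^sup>2) *\<^sub>R f (- 2 * cos x))"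
  proof (rule Henstock_Kurzweil_Integration.integral_cong)
    fix x assume x: "x \<in> {0..pi}"
    then have s: "sin x \<ge> 0" by (auto intro: sin_ge_zero)
    have "4 - (- 2 * cos x)\<^sup>2 = (2 * sin x)\<^sup>2" by (simp add: power_mult_distrib cos_squared_eq algebra_simps)
    then have "sqrt (max 0 (4 - (- 2 * cos x)\<^sup>2)) = 2 * sin x" using s by (simp only: max_absorb2 zero_le_power2 real_sqrt_abs)
    then show "(2 * sin x) *\<^sub>R (?d (- 2 * cos x) *\<^sub>R f (- 2 * cos x)) = (2 / pi * (sin x)\<^sup>2) *\<^sub>R f (- 2 * cos x)"
      by (simp add: power2_eq_square)
  qed
  finally show ?thesis .
qed

lemma real_distribution_semicircle: "real_distribution semicircle_distribution"
proof -
  have "((\<lambda>x. complex_of_real (2 / pi) * complex_of_real (sin x * sin (real (Suc 0) * x))) has_integral complex_of_real (2 / pi) * complex_of_real (pi / 2)) {0..pi}"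
    using sin_sin_Suc_has_integral[of 0] by (intro has_integral_mult_right has_integral_of_real) simp
  then have "((\<lambda>x. (2 / pi * (sin x)\<^sup>2) *\<^sub>R (1::complex)) has_integral 1) {0..pi}"
    by (simp add: scaleR_conv_of_real power2_eq_square)
  then have "integral\<^sup>L semicircle_distribution (\<lambda>x. 1 :: complex) = 1"
    by (subst integral_semicircle) (auto intro: integral_unique)
  then have "measure semicircle_distribution (space semicircle_distribution) = 1"
    by (simp add: scaleR_conv_of_real)
  \<comment> \<open>Infinite mass is excluded because \<open>measure\<close> would then be
    0.\<close>
  then have "emeasure semicircle_distribution (space semicircle_distribution) = 1"
    by (metis emeasure_eq_ennreal_measure measure_zero_top ennreal_1 zero_neq_one)
  then have "prob_space semicircle_distribution" by (rule prob_spaceI)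
  then show ?thesis by (auto simp: real_distribution_def real_distribution_axioms_def semicircle_distribution_def)
qed

text \<open>The two roots of \<open>m^2 + z * m + 1\<close> have product 1, so one lies in the open
  unit disc unless both lie on the circle. In that case they are conjugate and their sum
  \<open>- z\<close> is real.\<close>

lemma semicircle_equation_root:
  assumes z: "Im z > 0"
  obtains m where "cmod m < 1" "m \<noteq> 0" "z = - (m + 1 / m)"
proof -
  define r s where "r = (- z + csqrt (z\<^sup>2 - 4)) / 2" and "s = (- z - csqrt (z\<^sup>2 - 4)) / 2"
  have "r * s = ((- z)\<^sup>2 - (csqrt (z\<^sup>2 - 4))\<^sup>2) / 4"
    by (simp add: r_def s_def power2_eq_square algebra_simps)
  then have rs: "r * s = 1" by simp
  have sum: "r + s = - z" by (simp add: r_def s_def field_simps)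
  have nz: "r \<noteq> 0" "s \<noteq> 0" using rs by auto
  have n1: "cmod r \<noteq> 1"
  proof
    assume "cmod r = 1"
    then have "r * cnj r = 1" by (simp add: complex_norm_square[symmetric])
    then have "s = cnj r" using rs nz by (metis mult_left_cancel)
    then have "Im (r + s) = 0" by simp
    with sum z show False by simp
  qed
  have s: "s = 1 / r" using rs nz by (simp add: field_simps)
  show ?thesis
  proof (cases "cmod r < 1")
    case True
    moreover have "z = - (r + 1 / r)" using sum s by (metis minus_minus)
    ultimately show ?thesis using that nz by blast
  next
    case False
    then have "cmod s < 1" using n1 s by (simp add: norm_divide divide_less_eq)
    moreover have "r = 1 / s" using rs nz by (simp add: field_simps)
    then have "z = - (s + 1 / s)" using sum by (metis minus_minus add.commute)
    ultimately show ?thesis using that nz by blast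
  qed
qed

text \<open>The sign convention matches the resolvent of \<open>A - z\<close> and gives positive
  imaginary part in the upper half-plane.\<close>

definition stieltjes :: "real measure \<Rightarrow> complex \<Rightarrow> complex" where
  "stieltjes \<mu> z = integral\<^sup>L \<mu> (\<lambda>x. 1 / (complex_of_real x - z))"

text \<open>For \<open>z = - (m + 1 / m)\<close> the kernel at \<open>- 2 * cos \<theta>\<close>
  becomes \<open>m / (1 - 2 * m * cos \<theta> + m^2)\<close>, so
  \<open>sin_squared_poisson_has_integral\<close> evaluates the transform to \<open>m\<close>
  itself.\<close>

lemma stieltjes_semicircle:
  assumes z: "Im z > 0"
  shows "stieltjes semicircle_distribution z * (- z - stieltjes semicircle_distribution z) = 1"
proof -
  obtain m where m: "cmod m < 1" "m \<noteq> 0" "z = - (m + 1 / m)" by (rule semicircle_equation_root[OF z])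
  have nz: "complex_of_real x - z \<noteq> 0" for x using z by (auto simp: complex_eq_iff)
  have "stieltjes semicircle_distribution z =
      integral {0..pi} (\<lambda>x. (2 / pi * (sin x)\<^sup>2) *\<^sub>R (1 / (of_real (- 2 * cos x) - z)))"
    unfolding stieltjes_def by (intro integral_semicircle continuous_intros) (use nz in auto)
  also have "\<dots> = m"
  proof (rule integral_unique)
    have "((\<lambda>x. of_real (2 / pi) * m * (of_real ((sin x)\<^sup>2) / (1 - 2 * m * of_real (cos x) + m\<^sup>2)))
       has_integral (of_real (2 / pi) * m * of_real (pi / 2))) {0..pi}"
      by (intro has_integral_mult_right sin_squared_poisson_has_integral m)
    also have "of_real (2 / pi) * m * of_real (pi / 2) = m" by simp
    also have "(\<lambda>x. of_real (2 / pi) * m * (of_real ((sin x)\<^sup>2) / (1 - 2 * m * of_real (cos x) + m\<^sup>2)))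
       = (\<lambda>x. (2 / pi * (sin x)\<^sup>2) *\<^sub>R (1 / (of_real (- 2 * cos x) - z)))"
    proof
      fix x
      have "(1 - 2 * m * of_real (cos x) + m\<^sup>2) = m * (of_real (- 2 * cos x) - z)"
        using m(2) unfolding m(3) by (simp add: field_simps power2_eq_square)
      then show "of_real (2 / pi) * m * (of_real ((sin x)\<^sup>2) / (1 - 2 * m * of_real (cos x) + m\<^sup>2))
         = (2 / pi * (sin x)\<^sup>2) *\<^sub>R (1 / (of_real (- 2 * cos x) - z))"
        using m(2) by (simp add: scaleR_conv_of_real)
    qed
    finally show "((\<lambda>x. (2 / pi * (sin x)\<^sup>2) *\<^sub>R (1 / (of_real (- 2 * cos x) - z))) has_integral m) {0..pi}" .
  qed
  finally have "stieltjes semicircle_distribution z = m" .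
  moreover have "m * (- z - m) = 1" using m(2) unfolding m(3) by (simp add: field_simps)
  ultimately show ?thesis by simp
qed

section \<open>The Poisson kernel and its Fourier transform\<close>

text \<open>Normalised to total mass pi, not 1, so that it is exactly the imaginary part of the
  Cauchy kernel.\<close>

definition poisson_kernel :: "real \<Rightarrow> real \<Rightarrow> real" where
  "poisson_kernel \<eta> x = \<eta> / (x\<^sup>2 + \<eta>\<^sup>2)"

lemma poisson_kernel_nonneg: "\<eta> > 0 \<Longrightarrow> 0 \<le> poisson_kernel \<eta> x"
  by (simp add: poisson_kernel_def)

lemma poisson_kernel_minus: "poisson_kernel \<eta> (- x) = poisson_kernel \<eta> x"
  by (simp add: poisson_kernel_def)

lemma poisson_kernel_measurable [measurable]: "poisson_kernel \<eta> \<in> borel_measurable borel"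
  unfolding poisson_kernel_def by measurable

lemma Im_cauchy_kernel: "Im (1 / (complex_of_real x - Complex a \<eta>)) = poisson_kernel \<eta> (x - a)"
  by (simp add: poisson_kernel_def Im_divide power2_eq_square)

lemma integrable_poisson_kernel:
  assumes \<eta>: "\<eta> > 0"
  shows "integrable lborel (poisson_kernel \<eta>)"
proof -
  have "integrable lborel (\<lambda>x::real. inverse (1 + x\<^sup>2))"
    using integrable_inverse_1_plus_square by (simp add: set_integrable_def)
  from lborel_integrable_real_affine[OF this, of "1 / \<eta>" 0]
  have "integrable lborel (\<lambda>x. 1 / \<eta> * inverse (1 + (1 / \<eta> * x)\<^sup>2))" using \<eta> by simp
  also have "(\<lambda>x. 1 / \<eta> * inverse (1 + (1 / \<eta> * x)\<^sup>2)) = poisson_kernel \<eta>"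
  proof
    fix x
    have "x\<^sup>2 + \<eta>\<^sup>2 > 0" using \<eta> by (simp add: add_nonneg_pos)
    then show "1 / \<eta> * inverse (1 + (1 / \<eta> * x)\<^sup>2) = poisson_kernel \<eta> x"
      using \<eta> by (simp add: poisson_kernel_def field_simps power2_eq_square)
  qed
  finally show ?thesis .
qed

lemma gaussian_fourier:
  assumes u: "u > 0"
  shows "integral\<^sup>L lborel (\<lambda>x. exp (- (u * x\<^sup>2)) *\<^sub>R iexp (t * x)) = complex_of_real (sqrt (pi / u) * exp (- (t\<^sup>2) / (4 * u)))"
proof -
  \<comment> \<open>This scale turns \<open>u * (c * x)^2\<close> into \<open>x^2 / 2\<close>, the
    exponent of the standard normal density.\<close>
  define c where "c = 1 / sqrt (2 * u)"
  have c: "c > 0" using u by (simp add: c_def)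
  have cc: "c\<^sup>2 = 1 / (2 * u)" using u by (simp add: c_def power_divide)
  have "complex_of_real (exp (- ((t * c)\<^sup>2) / 2)) = char std_normal_distribution (t * c)"
    by (simp add: char_std_normal_distribution)
  also have "\<dots> = integral\<^sup>L lborel (\<lambda>x. std_normal_density x *\<^sub>R iexp (t * c * x))"
    unfolding char_def by (subst integral_density) auto
  finally have 1: "integral\<^sup>L lborel (\<lambda>x. std_normal_density x *\<^sub>R iexp (t * c * x)) = complex_of_real (exp (- ((t * c)\<^sup>2) / 2))" by simp
  have "integral\<^sup>L lborel (\<lambda>x. exp (- (u * x\<^sup>2)) *\<^sub>R iexp (t * x)) =
      \<bar>c\<bar> *\<^sub>R integral\<^sup>L lborel (\<lambda>x. exp (- (u * (0 + c * x)\<^sup>2)) *\<^sub>R iexp (t * (0 + c * x)))"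
    using c by (intro lborel_integral_real_affine) auto
  also have "(\<lambda>x. exp (- (u * (0 + c * x)\<^sup>2)) *\<^sub>R iexp (t * (0 + c * x))) = (\<lambda>x. complex_of_real (sqrt (2 * pi)) * (std_normal_density x *\<^sub>R iexp (t * c * x)))"
  proof
    fix x
    have "u * (0 + c * x)\<^sup>2 = x\<^sup>2 / 2" using u by (simp add: power_mult_distrib cc)
    then show "exp (- (u * (0 + c * x)\<^sup>2)) *\<^sub>R iexp (t * (0 + c * x)) = complex_of_real (sqrt (2 * pi)) * (std_normal_density x *\<^sub>R iexp (t * c * x))"
      by (simp add: std_normal_density_def scaleR_conv_of_real mult_ac)
  qed
  also have "integral\<^sup>L lborel (\<lambda>x. complex_of_real (sqrt (2 * pi)) * (std_normal_density x *\<^sub>R iexp (t * c * x)))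
      = complex_of_real (sqrt (2 * pi)) * complex_of_real (exp (- ((t * c)\<^sup>2) / 2))"
    by (subst 1[symmetric]) (rule integral_mult_right_zero)
  also have "\<bar>c\<bar> *\<^sub>R \<dots> = complex_of_real ((c * sqrt (2 * pi)) * exp (- ((t * c)\<^sup>2) / 2))"
    using c by (simp add: scaleR_conv_of_real)
  also have "c * sqrt (2 * pi) = sqrt (pi / u)"
    using u by (simp add: c_def real_sqrt_divide real_sqrt_mult)
  also have "- ((t * c)\<^sup>2) / 2 = - (t\<^sup>2) / (4 * u)"
    by (simp add: power_mult_distrib cc)
  finally show ?thesis .
qed

text \<open>Writing the kernel as a mixture of Gaussians exhibits its Fourier transform as an integral
  of a positive function; the exact value \<open>\<pi> exp (- \<eta> \<bar>t\<bar>)\<close> is not needed.\<close>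

lemma poisson_kernel_fourier_nonzero:
  assumes \<eta>: "\<eta> > 0"
  shows "integral\<^sup>L lborel (\<lambda>x. poisson_kernel \<eta> x *\<^sub>R iexp (t * x)) \<noteq> 0"
proof -
  \<comment> \<open>Integrating first over \<open>u > 0\<close> gives the Poisson kernel;
    integrating first over \<open>x\<close> gives Gaussian Fourier transforms, which are
    positive.\<close>
  define F :: "real \<times> real \<Rightarrow> complex" where
    "F = (\<lambda>(x, u). (indicator {0<..} u * \<eta> * exp (- (u * (x\<^sup>2 + \<eta>\<^sup>2)))) *\<^sub>R iexp (t * x))"
  have F_meas [measurable]: "F \<in> borel_measurable (lborel \<Otimes>\<^sub>M lborel)"
    unfolding F_def by measurable
  have pos: "x\<^sup>2 + \<eta>\<^sup>2 > 0" for x using \<eta> by (simp add: add_nonneg_pos)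
  have ex: "integrable lborel (\<lambda>u. indicator {0<..} u * \<eta> * exp (- (u * (x\<^sup>2 + \<eta>\<^sup>2))))"
    "integral\<^sup>L lborel (\<lambda>u. indicator {0<..} u * \<eta> * exp (- (u * (x\<^sup>2 + \<eta>\<^sup>2)))) = poisson_kernel \<eta> x" for x
  proof -
    have "set_integrable lborel {0<..} (\<lambda>u. exp (- (u * (x\<^sup>2 + \<eta>\<^sup>2))))"
      using integrable_I0i_exp_mscale[OF pos[of x]] interval_integrable_to_infinity_eq[of lborel 0]
      by (simp add: zero_ereal_def)
    then have 1: "integrable lborel (\<lambda>u. indicator {0<..} u * exp (- (u * (x\<^sup>2 + \<eta>\<^sup>2))))"
      by (simp add: set_integrable_def)
    from integrable_mult_right[OF this, of \<eta>]
    show "integrable lborel (\<lambda>u. indicator {0<..} u * \<eta> * exp (- (u * (x\<^sup>2 + \<eta>\<^sup>2))))"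
      by (simp add: mult_ac)
    have "integral\<^sup>L lborel (\<lambda>u. indicator {0<..} u * exp (- (u * (x\<^sup>2 + \<eta>\<^sup>2)))) = 1 / (x\<^sup>2 + \<eta>\<^sup>2)"
      using LBINT_I0i_exp_mscale[OF pos[of x]]
        interval_integral_to_infinity_eq[of lborel 0 "\<lambda>u. exp (- (u * (x\<^sup>2 + \<eta>\<^sup>2)))"]
      by (simp add: zero_ereal_def set_lebesgue_integral_def)
    then have "integral\<^sup>L lborel (\<lambda>u. \<eta> * (indicator {0<..} u * exp (- (u * (x\<^sup>2 + \<eta>\<^sup>2))))) = \<eta> * (1 / (x\<^sup>2 + \<eta>\<^sup>2))"
      by simp
    then show "integral\<^sup>L lborel (\<lambda>u. indicator {0<..} u * \<eta> * exp (- (u * (x\<^sup>2 + \<eta>\<^sup>2)))) = poisson_kernel \<eta> x"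
      by (simp add: poisson_kernel_def mult_ac)
  qed
  have nF: "norm (F (x, u)) = indicator {0<..} u * \<eta> * exp (- (u * (x\<^sup>2 + \<eta>\<^sup>2)))" for x u
    using \<eta> by (simp add: F_def)
  have F_int: "integrable (lborel \<Otimes>\<^sub>M lborel) F"
  proof (rule lborel_pair.Fubini_integrable)
    show "integrable lborel (\<lambda>x. \<integral>u. norm (F (x, u)) \<partial>lborel)"
      unfolding nF ex(2) by (rule integrable_poisson_kernel[OF \<eta>])
    have "integrable lborel (\<lambda>u. F (x, u))" for x
      using ex(1)[of x] unfolding F_def prod.case by (rule integrable_scaleR_left)
    then show "AE x in lborel. integrable lborel (\<lambda>u. F (x, u))" by simp
  qed fact
  define h where "h u = indicator {0<..} u * \<eta> * exp (- (u * \<eta>\<^sup>2)) * (sqrt (pi / u) * exp (- (t\<^sup>2) / (4 * u)))" for u :: real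
  have Fu: "(\<integral>x. F (x, u) \<partial>lborel) = complex_of_real (h u)" for u
  proof (cases "u > 0")
    case True
    have "(\<integral>x. F (x, u) \<partial>lborel) = (\<integral>x. (\<eta> * exp (- (u * \<eta>\<^sup>2))) *\<^sub>R (exp (- (u * x\<^sup>2)) *\<^sub>R iexp (t * x)) \<partial>lborel)"
      using True by (intro Bochner_Integration.integral_cong refl) (simp add: F_def distrib_left exp_add[symmetric] mult.assoc)
    also have "\<dots> = (\<eta> * exp (- (u * \<eta>\<^sup>2))) *\<^sub>R (\<integral>x. exp (- (u * x\<^sup>2)) *\<^sub>R iexp (t * x) \<partial>lborel)"
      by (rule integral_scaleR_right)
    also note gaussian_fourier[OF True]
    finally show ?thesis using True by (simp add: h_def scaleR_conv_of_real)
  qed (simp add: F_def h_def)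
  have "(\<integral>x. poisson_kernel \<eta> x *\<^sub>R iexp (t * x) \<partial>lborel) = (\<integral>x. (\<integral>u. F (x, u) \<partial>lborel) \<partial>lborel)"
    by (intro Bochner_Integration.integral_cong refl, unfold F_def prod.case)
       (subst integral_scaleR_left, use ex in auto)
  also have "\<dots> = (\<integral>u. (\<integral>x. F (x, u) \<partial>lborel) \<partial>lborel)"
    using lborel_pair.Fubini_integral[of "\<lambda>x u. F (x, u)"] F_int by simp
  also have "\<dots> = complex_of_real (\<integral>u. h u \<partial>lborel)"
    unfolding Fu by simp
  finally have K: "(\<integral>x. poisson_kernel \<eta> x *\<^sub>R iexp (t * x) \<partial>lborel) = complex_of_real (\<integral>u. h u \<partial>lborel)" .
  have "integrable lborel (\<lambda>u. \<integral>x. F (x, u) \<partial>lborel)"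
    using lborel_pair.integrable_snd[of "\<lambda>x u. F (x, u)"] F_int by simp
  then have h_int: "integrable lborel h" unfolding Fu using integrable_Re by fastforce
  \<comment> \<open>\<open>h\<close> is strictly positive for \<open>u > 0\<close>, so a vanishing
    integral would make the interval \<open>(0, 1)\<close> a null set.\<close>
  have "(\<integral>u. h u \<partial>lborel) \<noteq> 0"
  proof
    assume "(\<integral>u. h u \<partial>lborel) = 0"
    moreover have "AE u in lborel. 0 \<le> h u" using \<eta> by (intro AE_I2) (auto simp: h_def indicator_def)
    ultimately have "AE u in lborel. h u = 0"
      using integral_nonneg_eq_0_iff_AE[OF h_int] by simp
    then have "AE u in lborel. u \<notin> {0<..<1::real}"
      by eventually_elim (use \<eta> in \<open>auto simp: h_def indicator_def\<close>)
    then have "emeasure lborel {0<..<1::real} = 0" by (subst AE_iff_measurable[symmetric, where P="\<lambda>u. u \<notin> {0<..<1::real}" and N="{0<..<1}"]) auto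
    then show False by simp
  qed
  then show ?thesis unfolding K by simp
qed

section \<open>Smoothed measures and weak convergence\<close>

lemma cauchy_kernel_bound:
  assumes "Im z \<noteq> 0"
  shows "cmod (1 / (complex_of_real x - z)) \<le> 1 / \<bar>Im z\<bar>"
  using abs_Im_le_cmod[of "complex_of_real x - z"] assms by (simp add: norm_divide frac_le)

context real_distribution
begin

lemma cauchy_kernel_integrable:
  assumes "Im z \<noteq> 0"
  shows "integrable M (\<lambda>x. 1 / (complex_of_real x - z))"
  using cauchy_kernel_bound[OF assms] by (intro integrable_const_bound[of _ "1 / \<bar>Im z\<bar>"] AE_I2) auto

lemma stieltjes_bound:
  assumes "Im z \<noteq> 0"
  shows "cmod (stieltjes M z) \<le> 1 / \<bar>Im z\<bar>"
  unfolding stieltjes_def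
  by (rule order_trans[OF integral_norm_bound integral_le_const])
     (intro integrable_norm AE_I2 cauchy_kernel_integrable cauchy_kernel_bound assms)+

text \<open>The difference of two Cauchy kernels is \<open>(z - w) / ((x - z) * (x - w))\<close>.
  The constant is the same for all probability measures, which is what the passage from rational to
  real points relies on.\<close>

lemma stieltjes_lipschitz:
  assumes z: "Im z = \<eta>" "Im w = \<eta>" "\<eta> > 0"
  shows "cmod (stieltjes M z - stieltjes M w) \<le> cmod (z - w) / \<eta>\<^sup>2"
proof -
  have "stieltjes M z - stieltjes M w = (\<integral>x. 1 / (complex_of_real x - z) - 1 / (complex_of_real x - w) \<partial>M)"
    unfolding stieltjes_def using z by (intro Bochner_Integration.integral_diff[symmetric] cauchy_kernel_integrable) auto
  also have "cmod \<dots> \<le> (\<integral>x. cmod (1 / (complex_of_real x - z) - 1 / (complex_of_real x - w)) \<partial>M)"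
    by (rule integral_norm_bound)
  also have "\<dots> \<le> (\<integral>x. cmod (z - w) / \<eta>\<^sup>2 \<partial>M)"
  proof (rule integral_mono)
    show "integrable M (\<lambda>x. cmod (1 / (complex_of_real x - z) - 1 / (complex_of_real x - w)))"
      using z by (intro integrable_norm Bochner_Integration.integrable_diff cauchy_kernel_integrable) auto
    fix x
    have b: "\<eta> \<le> cmod (complex_of_real x - z)" "\<eta> \<le> cmod (complex_of_real x - w)"
      using abs_Im_le_cmod[of "complex_of_real x - z"] abs_Im_le_cmod[of "complex_of_real x - w"] z by auto
    have nz: "complex_of_real x - z \<noteq> 0" "complex_of_real x - w \<noteq> 0" using b z by auto
    have "1 / (complex_of_real x - z) - 1 / (complex_of_real x - w) = (z - w) / ((complex_of_real x - z) * (complex_of_real x - w))"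
      using nz by (simp add: field_simps)
    moreover have "\<eta>\<^sup>2 \<le> cmod (complex_of_real x - z) * cmod (complex_of_real x - w)"
      unfolding power2_eq_square using b z by (intro mult_mono) auto
    ultimately show "cmod (1 / (complex_of_real x - z) - 1 / (complex_of_real x - w)) \<le> cmod (z - w) / \<eta>\<^sup>2"
      using z by (simp add: norm_divide norm_mult frac_le)
  qed auto
  finally show ?thesis using prob_space by simp
qed

text \<open>Along a horizontal line the imaginary part is the convolution of \<open>M\<close> with
  the Poisson kernel. Fubini and the shift \<open>a = x + y\<close> split its Fourier transform into
  a factor for the kernel and one for \<open>M\<close>.\<close>

lemma poisson_smoothing:
  assumes \<eta>: "\<eta> > 0"
  shows "integrable lborel (\<lambda>a. Im (stieltjes M (Complex a \<eta>)))"
    and "(\<integral>a. Im (stieltjes M (Complex a \<eta>)) *\<^sub>R iexp (t * a) \<partial>lborel) =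
           (\<integral>x. poisson_kernel \<eta> x *\<^sub>R iexp (t * x) \<partial>lborel) * char M t"
    and "0 \<le> Im (stieltjes M (Complex a \<eta>))"
proof -
  interpret P: pair_sigma_finite lborel M ..
  have S: "Im (stieltjes M (Complex a \<eta>)) = (\<integral>x. poisson_kernel \<eta> (x - a) \<partial>M)" for a
    unfolding stieltjes_def using cauchy_kernel_integrable[of "Complex a \<eta>"] \<eta>
    by (subst integral_Im[symmetric]) (auto simp: Im_cauchy_kernel)
  show "0 \<le> Im (stieltjes M (Complex a \<eta>))"
    unfolding S by (intro integral_nonneg_AE AE_I2 poisson_kernel_nonneg \<eta>)
  have I: "integrable M (\<lambda>x. poisson_kernel \<eta> (x - a))" for a
    using integrable_Im[OF cauchy_kernel_integrable[of "Complex a \<eta>"]] \<eta> by (simp add: Im_cauchy_kernel)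
  define F :: "real \<Rightarrow> real \<times> real \<Rightarrow> complex" where "F t = (\<lambda>(a, x). poisson_kernel \<eta> (x - a) *\<^sub>R iexp (t * a))" for t
  have [measurable]: "F t \<in> borel_measurable (lborel \<Otimes>\<^sub>M M)" for t
    unfolding F_def by measurable
  have shift: "integrable lborel (\<lambda>a. poisson_kernel \<eta> (x - a))" "(\<integral>a. F t (a, x) \<partial>lborel) = iexp (t * x) * (\<integral>y. poisson_kernel \<eta> y *\<^sub>R iexp (t * y) \<partial>lborel)" for t x
  proof -
    show "integrable lborel (\<lambda>a. poisson_kernel \<eta> (x - a))"
      using lborel_integrable_real_affine[OF integrable_poisson_kernel[OF \<eta>], of "-1" x] by simp
    have "(\<integral>a. F t (a, x) \<partial>lborel) = \<bar>1\<bar> *\<^sub>R (\<integral>y. F t (x + 1 * y, x) \<partial>lborel)"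
      by (rule lborel_integral_real_affine) simp
    also have "\<dots> = (\<integral>y. iexp (t * x) * (poisson_kernel \<eta> y *\<^sub>R iexp (t * y)) \<partial>lborel)"
      by (simp add: F_def poisson_kernel_minus distrib_left exp_add)
    also have "\<dots> = iexp (t * x) * (\<integral>y. poisson_kernel \<eta> y *\<^sub>R iexp (t * y) \<partial>lborel)"
      by (rule integral_mult_right_zero)
    finally show "(\<integral>a. F t (a, x) \<partial>lborel) = iexp (t * x) * (\<integral>y. poisson_kernel \<eta> y *\<^sub>R iexp (t * y) \<partial>lborel)" .
  qed
  have int: "integrable (lborel \<Otimes>\<^sub>M M) (F t)" for t
  proof -
    have "(\<integral>\<^sup>+p. ennreal (norm (F t p)) \<partial>(lborel \<Otimes>\<^sub>M M)) = (\<integral>\<^sup>+x. (\<integral>\<^sup>+a. ennreal (norm (F t (a, x))) \<partial>lborel) \<partial>M)"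
      by (rule P.nn_integral_snd[symmetric]) measurable
    also have "\<dots> = (\<integral>\<^sup>+x. (\<integral>\<^sup>+a. ennreal (poisson_kernel \<eta> (x - a)) \<partial>lborel) \<partial>M)"
      using poisson_kernel_nonneg[OF \<eta>] by (simp add: F_def)
    also have "\<dots> = (\<integral>\<^sup>+x. ennreal (\<integral>y. poisson_kernel \<eta> y \<partial>lborel) \<partial>M)"
    proof (rule nn_integral_cong)
      fix x
      have "(\<integral>\<^sup>+a. ennreal (poisson_kernel \<eta> (x - a)) \<partial>lborel) = ennreal (\<integral>a. poisson_kernel \<eta> (x - a) \<partial>lborel)"
        using shift(1) poisson_kernel_nonneg[OF \<eta>] by (intro nn_integral_eq_integral) auto
      also have "(\<integral>a. poisson_kernel \<eta> (x - a) \<partial>lborel) = (\<integral>y. poisson_kernel \<eta> y \<partial>lborel)"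
        by (subst lborel_integral_real_affine[of "-1" "poisson_kernel \<eta>" x]) auto
      finally show "(\<integral>\<^sup>+a. ennreal (poisson_kernel \<eta> (x - a)) \<partial>lborel) = ennreal (\<integral>y. poisson_kernel \<eta> y \<partial>lborel)" .
    qed
    also have "\<dots> < \<infinity>" by (simp add: emeasure_space_1[simplified])
    finally show ?thesis by (intro integrableI_bounded) auto
  qed
  have Fa: "(\<integral>x. F t (a, x) \<partial>M) = Im (stieltjes M (Complex a \<eta>)) *\<^sub>R iexp (t * a)" for a t
    unfolding S F_def prod.case by (rule integral_scaleR_left) (use I in auto)
  show "integrable lborel (\<lambda>a. Im (stieltjes M (Complex a \<eta>)))"
    using integrable_Re[OF P.integrable_fst'[OF int[of 0]]] unfolding Fa by simp
  have "(\<integral>a. Im (stieltjes M (Complex a \<eta>)) *\<^sub>R iexp (t * a) \<partial>lborel) = (\<integral>x. (\<integral>a. F t (a, x) \<partial>lborel) \<partial>M)"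
    unfolding Fa[symmetric] using P.Fubini_integral[of "\<lambda>a x. F t (a, x)"] int[of t] by simp
  also have "\<dots> = (\<integral>x. iexp (t * x) \<partial>M) * (\<integral>y. poisson_kernel \<eta> y *\<^sub>R iexp (t * y) \<partial>lborel)"
    unfolding shift(2) by (rule integral_mult_left_zero)
  finally show "(\<integral>a. Im (stieltjes M (Complex a \<eta>)) *\<^sub>R iexp (t * a) \<partial>lborel) =
           (\<integral>x. poisson_kernel \<eta> x *\<^sub>R iexp (t * x) \<partial>lborel) * char M t"
    by (simp add: char_def)
qed

end

text \<open>All smoothed densities carry the same Fourier factor \<open>K t\<close>. As it never
  vanishes it can be divided out, after which Levy's continuity theorem applies.\<close>

lemma weak_conv_stieltjes:
  assumes \<mu>: "\<And>n. real_distribution (\<mu> n)" and \<nu>: "real_distribution \<nu>" and \<eta>: "\<eta> > 0"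
    and lim: "\<And>a. (\<lambda>n. stieltjes (\<mu> n) (Complex a \<eta>)) \<longlonglongrightarrow> stieltjes \<nu> (Complex a \<eta>)"
  shows "weak_conv_m \<mu> \<nu>"
proof (rule levy_continuity[OF \<mu> \<nu>])
  fix t
  define p where "p n a = Im (stieltjes (\<mu> n) (Complex a \<eta>))" for n a
  define q where "q a = Im (stieltjes \<nu> (Complex a \<eta>))" for a
  define K where "K t = (\<integral>x. poisson_kernel \<eta> x *\<^sub>R iexp (t * x) \<partial>lborel)" for t
  have p: "integrable lborel (p n)" "(\<integral>a. p n a *\<^sub>R iexp (t * a) \<partial>lborel) = K t * char (\<mu> n) t" "0 \<le> p n a" for n t a
    using real_distribution.poisson_smoothing[OF \<mu> \<eta>] unfolding p_def K_def by auto
  have q: "integrable lborel q" "(\<integral>a. q a *\<^sub>R iexp (t * a) \<partial>lborel) = K t * char \<nu> t" "0 \<le> q a" for t a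
    using real_distribution.poisson_smoothing[OF \<nu> \<eta>] unfolding q_def K_def by auto
  \<comment> \<open>At \<open>t = 0\<close> every characteristic function is 1, so both masses equal
    \<open>K 0\<close>; this supplies the mass condition of Scheffe's lemma.\<close>
  have mass: "(\<integral>a. p n a \<partial>lborel) = (\<integral>a. q a \<partial>lborel)" for n
  proof -
    have "complex_of_real (\<integral>a. p n a \<partial>lborel) = complex_of_real (\<integral>a. q a \<partial>lborel)"
      using p(2)[of n 0] q(2)[of 0] real_distribution.char_zero[OF \<mu>] real_distribution.char_zero[OF \<nu>]
      by (simp add: scaleR_conv_of_real)
    then show ?thesis by simp
  qed
  have sch: "(\<lambda>n. \<integral>\<^sup>+ a. norm (p n a - q a) \<partial>lborel) \<longlonglongrightarrow> 0"
  proof (rule Scheffe_lemma2)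
    show "AE x in lborel. (\<lambda>n. p n x) \<longlonglongrightarrow> q x"
      using lim by (auto simp: p_def q_def intro!: AE_I2 tendsto_Im)
    show "(\<integral>\<^sup>+ x. norm (p n x) \<partial>lborel) \<le> (\<integral>\<^sup>+ x. norm (q x) \<partial>lborel)" for n
      using p(1,3) q(1,3) mass by (simp add: nn_integral_eq_integral)
  qed (use p(1) q(1) in auto)
  have L1: "(\<lambda>n. \<integral>a. \<bar>p n a - q a\<bar> \<partial>lborel) \<longlonglongrightarrow> 0"
  proof -
    have "(\<integral>\<^sup>+ a. norm (p n a - q a) \<partial>lborel) = ennreal (\<integral>a. \<bar>p n a - q a\<bar> \<partial>lborel)" for n
      using p(1) q(1) by (subst nn_integral_eq_integral) auto
    with sch show ?thesis
      using tendsto_ennreal_iff[of "\<lambda>n. \<integral>a. \<bar>p n a - q a\<bar> \<partial>lborel" sequentially 0] by (simp add: ennreal_0[symmetric] del: ennreal_0)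
  qed
  have "(\<lambda>n. K t * char (\<mu> n) t - K t * char \<nu> t) \<longlonglongrightarrow> 0"
  proof (rule Lim_null_comparison[OF _ L1], rule always_eventually, rule allI)
    fix n
    have ip: "integrable lborel (\<lambda>a. p n a *\<^sub>R iexp (t * a))" "integrable lborel (\<lambda>a. q a *\<^sub>R iexp (t * a))"
      using p(1)[of n] q(1) by (auto intro: Bochner_Integration.integrable_bound)
    have "K t * char (\<mu> n) t - K t * char \<nu> t = (\<integral>a. (p n a - q a) *\<^sub>R iexp (t * a) \<partial>lborel)"
      unfolding p(2)[symmetric] q(2)[symmetric] Bochner_Integration.integral_diff[OF ip, symmetric] by (simp add: scaleR_diff_left)
    also have "norm \<dots> \<le> (\<integral>a. norm ((p n a - q a) *\<^sub>R iexp (t * a)) \<partial>lborel)"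
      by (rule integral_norm_bound)
    finally show "norm (K t * char (\<mu> n) t - K t * char \<nu> t) \<le> (\<integral>a. \<bar>p n a - q a\<bar> \<partial>lborel)" by simp
  qed
  then have "(\<lambda>n. K t * char (\<mu> n) t) \<longlonglongrightarrow> K t * char \<nu> t"
    by (simp add: LIM_zero_iff)
  then have "(\<lambda>n. K t * char (\<mu> n) t / K t) \<longlonglongrightarrow> K t * char \<nu> t / K t"
    using poisson_kernel_fourier_nonzero[OF \<eta>, of t] by (intro tendsto_divide) (auto simp: K_def)
  then show "(\<lambda>n. char (\<mu> n) t) \<longlonglongrightarrow> char \<nu> t"
    using poisson_kernel_fourier_nonzero[OF \<eta>, of t] by (simp add: K_def)
qed

text \<open>Almost sure convergence can be arranged at countably many points simultaneously;
  equicontinuity along the line extends it to all others.\<close>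

lemma stieltjes_tendsto_rational_points:
  assumes \<mu>: "\<And>n. real_distribution (\<mu> n)" and \<nu>: "real_distribution \<nu>" and \<eta>: "\<eta> > 0"
    and lim: "\<And>r. r \<in> \<rat> \<Longrightarrow> (\<lambda>n. stieltjes (\<mu> n) (Complex r \<eta>)) \<longlonglongrightarrow> stieltjes \<nu> (Complex r \<eta>)"
  shows "(\<lambda>n. stieltjes (\<mu> n) (Complex a \<eta>)) \<longlonglongrightarrow> stieltjes \<nu> (Complex a \<eta>)"
proof (rule tendstoI)
  fix e :: real assume e: "e > 0"
  \<comment> \<open>Moving by less than \<open>d\<close> changes either transform by at most
    \<open>e / 3\<close>.\<close>
  define d where "d = e * \<eta>\<^sup>2 / 3"
  have d: "d > 0" using e \<eta> by (simp add: d_def)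
  obtain r where r: "r \<in> \<rat>" "a < r" "r < a + d" using Rats_dense_in_real[of a "a + d"] d by auto
  have "cmod (Complex a \<eta> - Complex r \<eta>) = \<bar>a - r\<bar>" by (simp add: cmod_def)
  then have "cmod (Complex a \<eta> - Complex r \<eta>) / \<eta>\<^sup>2 \<le> d / \<eta>\<^sup>2"
    using r \<eta> by (intro divide_right_mono) auto
  also have "d / \<eta>\<^sup>2 = e / 3" using \<eta> by (simp add: d_def)
  finally have c: "cmod (Complex a \<eta> - Complex r \<eta>) / \<eta>\<^sup>2 \<le> e / 3" .
  have l: "cmod (stieltjes m (Complex a \<eta>) - stieltjes m (Complex r \<eta>)) \<le> e / 3" if "real_distribution m" for m
    using real_distribution.stieltjes_lipschitz[OF that, of "Complex a \<eta>" \<eta> "Complex r \<eta>"] order_trans[OF _ c] \<eta> by simp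
  have "\<forall>\<^sub>F n in sequentially. dist (stieltjes (\<mu> n) (Complex r \<eta>)) (stieltjes \<nu> (Complex r \<eta>)) < e / 3"
    using lim[OF r(1)] e by (intro tendstoD) auto
  then show "\<forall>\<^sub>F n in sequentially. dist (stieltjes (\<mu> n) (Complex a \<eta>)) (stieltjes \<nu> (Complex a \<eta>)) < e"
  proof eventually_elim
    case (elim n)
    have "dist (stieltjes (\<mu> n) (Complex a \<eta>)) (stieltjes \<nu> (Complex a \<eta>)) \<le>
       dist (stieltjes (\<mu> n) (Complex a \<eta>)) (stieltjes (\<mu> n) (Complex r \<eta>)) +
       dist (stieltjes (\<mu> n) (Complex r \<eta>)) (stieltjes \<nu> (Complex r \<eta>)) +
       dist (stieltjes \<nu> (Complex a \<eta>)) (stieltjes \<nu> (Complex r \<eta>))"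
      by metric
    with l[OF \<mu>[of n]] l[OF \<nu>] elim show ?case by (simp add: dist_norm)
  qed
qed

section \<open>Bounded differences and quadratic forms\<close>

text \<open>Measurable and bounded at every point of the space, not only almost everywhere. The
  class is closed under the algebra used below, under composition and under partial integration, so
  integrability conditions follow from the shape of a term.\<close>

definition bdd_meas :: "'a measure \<Rightarrow> ('a \<Rightarrow> 'b::real_normed_field) \<Rightarrow> bool" where
  "bdd_meas M f \<longleftrightarrow> f \<in> borel_measurable M \<and> (\<exists>C. \<forall>x\<in>space M. norm (f x) \<le> C)"

lemma bdd_measI:
  "f \<in> borel_measurable M \<Longrightarrow> (\<And>x. x \<in> space M \<Longrightarrow> norm (f x) \<le> C) \<Longrightarrow> bdd_meas M f"
  by (auto simp: bdd_meas_def)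

lemma bdd_meas_integrable:
  fixes f :: "'a \<Rightarrow> 'b::{real_normed_field, banach, second_countable_topology}"
  assumes "prob_space M" "bdd_meas M f"
  shows "integrable M f"
proof -
  interpret prob_space M by fact
  show ?thesis using assms(2) by (auto simp: bdd_meas_def intro: integrable_const_bound)
qed

lemma bdd_meas_const: "bdd_meas M (\<lambda>_. c)"
  by (auto simp: bdd_meas_def)

lemma bdd_meas_add:
  fixes f g :: "'a \<Rightarrow> 'b::{real_normed_field, second_countable_topology}"
  assumes "bdd_meas M f" "bdd_meas M g"
  shows "bdd_meas M (\<lambda>x. f x + g x)"
proof -
  from assms obtain C D where "\<forall>x\<in>space M. norm (f x) \<le> C" "\<forall>x\<in>space M. norm (g x) \<le> D"
    by (auto simp: bdd_meas_def)
  then have "norm (f x + g x) \<le> C + D" if "x \<in> space M" for x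
    using that by (intro norm_triangle_le add_mono) auto
  with assms show ?thesis by (intro bdd_measI) (auto simp: bdd_meas_def)
qed

lemma bdd_meas_diff:
  fixes f g :: "'a \<Rightarrow> 'b::{real_normed_field, second_countable_topology}"
  assumes "bdd_meas M f" "bdd_meas M g"
  shows "bdd_meas M (\<lambda>x. f x - g x)"
proof -
  have "bdd_meas M (\<lambda>x. - g x)" using assms(2) by (auto simp: bdd_meas_def)
  from bdd_meas_add[OF assms(1) this] show ?thesis by simp
qed

lemma bdd_meas_mult:
  fixes f g :: "'a \<Rightarrow> 'b::{real_normed_field, second_countable_topology}"
  assumes "bdd_meas M f" "bdd_meas M g"
  shows "bdd_meas M (\<lambda>x. f x * g x)"
proof -
  from assms obtain C D where CD: "\<forall>x\<in>space M. norm (f x) \<le> C" "\<forall>x\<in>space M. norm (g x) \<le> D"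
    by (auto simp: bdd_meas_def)
  have "norm (f x * g x) \<le> C * D" if "x \<in> space M" for x
    using that CD by (auto simp: norm_mult intro!: mult_mono' intro: order_trans[OF norm_ge_zero])
  with assms show ?thesis by (intro bdd_measI) (auto simp: bdd_meas_def)
qed

lemma bdd_meas_power2:
  fixes f :: "'a \<Rightarrow> 'b::{real_normed_field, second_countable_topology}"
  shows "bdd_meas M f \<Longrightarrow> bdd_meas M (\<lambda>x. (f x)\<^sup>2)"
  unfolding power2_eq_square by (rule bdd_meas_mult)

lemma bdd_meas_sum:
  fixes f :: "'i \<Rightarrow> 'a \<Rightarrow> 'b::{real_normed_field, second_countable_topology}"
  assumes "\<And>i. i \<in> I \<Longrightarrow> bdd_meas M (f i)"
  shows "bdd_meas M (\<lambda>x. \<Sum>i\<in>I. f i x)"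
  using assms
  by (induction I rule: infinite_finite_induct) (auto intro: bdd_meas_const bdd_meas_add)

lemma bdd_meas_norm: "bdd_meas M f \<Longrightarrow> bdd_meas M (\<lambda>x. norm (f x))"
  by (auto simp: bdd_meas_def)

lemma bdd_meas_compose:
  assumes "bdd_meas N f" "g \<in> measurable M N"
  shows "bdd_meas M (\<lambda>x. f (g x))"
  using assms by (auto simp: bdd_meas_def dest: measurable_space)

lemma bdd_meas_exp:
  fixes f :: "'a \<Rightarrow> real"
  assumes "bdd_meas M f"
  shows "bdd_meas M (\<lambda>x. exp (f x))"
proof -
  from assms obtain C where C: "\<forall>x\<in>space M. \<bar>f x\<bar> \<le> C" by (auto simp: bdd_meas_def)
  then show ?thesis using assms
    by (intro bdd_measI[where C="exp C"]) (auto simp: bdd_meas_def dest!: bspec[OF C])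
qed

lemma bdd_meas_integral:
  fixes f :: "'a \<times> 'c \<Rightarrow> real"
  assumes N: "prob_space N" and f: "bdd_meas (M \<Otimes>\<^sub>M N) f"
  shows "bdd_meas M (\<lambda>x. \<integral>y. f (x, y) \<partial>N)"
proof -
  interpret N: prob_space N by fact
  from f obtain C where C: "\<And>p. p \<in> space (M \<Otimes>\<^sub>M N) \<Longrightarrow> \<bar>f p\<bar> \<le> C" by (auto simp: bdd_meas_def)
  have fm [measurable]: "f \<in> borel_measurable (M \<Otimes>\<^sub>M N)" using f by (auto simp: bdd_meas_def)
  show ?thesis
  proof (rule bdd_measI)
    show "(\<lambda>x. \<integral>y. f (x, y) \<partial>N) \<in> borel_measurable M"
      by (rule N.borel_measurable_lebesgue_integral) simp
    fix x assume x: "x \<in> space M"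
    have "AE y in N. \<bar>f (x, y)\<bar> \<le> C" using C x by (intro AE_I2) (auto simp: space_pair_measure)
    then show "norm (\<integral>y. f (x, y) \<partial>N) \<le> C"
      using x integral_norm_bound[of N "\<lambda>y. f (x, y)"]
      by (intro order_trans[OF integral_norm_bound] N.integral_le_const N.integrable_const_bound[where B=C]) auto
  qed
qed

text \<open>Induction on the blocks. Averaging over the last block gives a function \<open>g\<close>
  of the others with the same bounded differences; conditionally on the others, the deviation from
  \<open>g\<close> is centred and bounded, so Hoeffding's lemma contributes one factor. The
  variables come in blocks so that a matrix row can count as one.\<close>

lemma mcdiarmid_exponential:
  fixes \<mu> :: "'i \<Rightarrow> 'b measure" and B :: "nat \<Rightarrow> 'i set" and f :: "('i \<Rightarrow> 'b) \<Rightarrow> real"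
  assumes \<mu>: "\<And>i. prob_space (\<mu> i)" and fin: "\<And>k. finite (B k)"
    and disj: "\<And>k l. k \<noteq> l \<Longrightarrow> B k \<inter> B l = {}" and l: "l > 0"
    and f: "bdd_meas (Pi\<^sub>M (\<Union>k<n. B k) \<mu>) f"
    and diff: "\<And>k x y. k < n \<Longrightarrow> x \<in> space (Pi\<^sub>M (\<Union>k<n. B k) \<mu>) \<Longrightarrow> y \<in> space (Pi\<^sub>M (\<Union>k<n. B k) \<mu>) \<Longrightarrow>
       (\<And>i. i \<in> (\<Union>k<n. B k) - B k \<Longrightarrow> x i = y i) \<Longrightarrow> \<bar>f x - f y\<bar> \<le> c"
  shows "(\<integral>x. exp (l * (f x - integral\<^sup>L (Pi\<^sub>M (\<Union>k<n. B k) \<mu>) f)) \<partial>Pi\<^sub>M (\<Union>k<n. B k) \<mu>) \<le> exp (real n * (l\<^sup>2 * c\<^sup>2 / 2))"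
  using f diff
proof (induction n arbitrary: f)
  case 0
  interpret P: prob_space "Pi\<^sub>M {} \<mu>" by (intro prob_space_PiM \<mu>)
  \<comment> \<open>The product over the empty index set has a single point.\<close>
  have e: "f x = f (\<lambda>_. undefined)" if "x \<in> space (Pi\<^sub>M {} \<mu>)" for x
    using that by (simp add: space_PiM)
  have "integral\<^sup>L (Pi\<^sub>M {} \<mu>) f = (\<integral>x. f (\<lambda>_. undefined) \<partial>Pi\<^sub>M {} \<mu>)"
    by (intro Bochner_Integration.integral_cong refl e)
  also have "\<dots> = f (\<lambda>_. undefined)" by (simp add: P.prob_space)
  finally have E: "integral\<^sup>L (Pi\<^sub>M {} \<mu>) f = f (\<lambda>_. undefined)" .
  have "(\<integral>x. exp (l * (f x - integral\<^sup>L (Pi\<^sub>M {} \<mu>) f)) \<partial>Pi\<^sub>M {} \<mu>) = (\<integral>x. 1 \<partial>Pi\<^sub>M {} \<mu>)"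
  proof (intro Bochner_Integration.integral_cong refl)
    fix x assume "x \<in> space (Pi\<^sub>M {} \<mu>)"
    from e[OF this] E show "exp (l * (f x - integral\<^sup>L (Pi\<^sub>M {} \<mu>) f)) = 1" by simp
  qed
  then show ?case by (simp add: P.prob_space)
next
  case (Suc n)
  define I where "I = (\<Union>k<n. B k)"
  define J where "J = B n"
  let ?I = "Pi\<^sub>M I \<mu>" and ?J = "Pi\<^sub>M J \<mu>"
  have IJ: "(\<Union>k<Suc n. B k) = I \<union> J" by (auto simp: I_def J_def lessThan_Suc)
  have "B k \<inter> B n = {}" if "k < n" for k using disj[of k n] that by auto
  then have d: "I \<inter> J = {}" "finite I" "finite J" using fin by (auto simp: I_def J_def)
  interpret product_sigma_finite \<mu>
    by (intro product_sigma_finite.intro prob_space_imp_sigma_finite \<mu>)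
  have pI: "prob_space (Pi\<^sub>M A \<mu>)" for A by (intro prob_space_PiM \<mu>)
  interpret PJ: prob_space "?J" by (rule pI)
  note f = Suc.prems(1)[unfolded IJ]
  define h where "h = (\<lambda>p. f (merge I J p))"
  have h: "bdd_meas (?I \<Otimes>\<^sub>M ?J) h"
    unfolding h_def by (rule bdd_meas_compose[OF f measurable_merge])
  have hx: "bdd_meas (?J) (\<lambda>y. h (x, y))" if "x \<in> space (?I)" for x
    by (rule bdd_meas_compose[OF h]) (use that in measurable)
  define g where "g x = (\<integral>y. h (x, y) \<partial>?J)" for x
  have g: "bdd_meas (?I) g"
    unfolding g_def by (rule bdd_meas_integral[OF pI h])
  define m where "m = integral\<^sup>L (Pi\<^sub>M (I \<union> J) \<mu>) f"
  have m: "m = integral\<^sup>L (?I) g"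
    unfolding m_def g_def h_def by (rule product_integral_fold[OF d bdd_meas_integrable[OF pI f]])
  have sp: "merge I J (x, y) \<in> space (Pi\<^sub>M (I \<union> J) \<mu>)" if "x \<in> space (?I)" "y \<in> space (?J)" for x y
    using measurable_space[OF measurable_merge[of I J \<mu>], of "(x, y)"] that by (simp add: space_pair_measure)
  have IH: "(\<integral>x. exp (l * (g x - m)) \<partial>?I) \<le> exp (real n * (l\<^sup>2 * c\<^sup>2 / 2))"
    unfolding m I_def
  proof (rule Suc.IH)
    show "bdd_meas (Pi\<^sub>M (\<Union>k<n. B k) \<mu>) g" using g by (simp add: I_def)
    fix k x y assume k: "k < n" and xy: "x \<in> space (Pi\<^sub>M (\<Union>k<n. B k) \<mu>)" "y \<in> space (Pi\<^sub>M (\<Union>k<n. B k) \<mu>)"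
      and eq: "\<And>i. i \<in> (\<Union>k<n. B k) - B k \<Longrightarrow> x i = y i"
    note xy' = xy[folded I_def]
    have b: "\<bar>h (x, w) - h (y, w)\<bar> \<le> c" if w: "w \<in> space (?J)" for w
      unfolding h_def
    proof (rule Suc.prems(2)[of k, unfolded IJ])
      fix i assume "i \<in> I \<union> J - B k"
      then show "merge I J (x, w) i = merge I J (y, w) i"
        using eq[folded I_def] by (auto simp: merge_def)
    qed (use k sp xy' w in auto)
    have "g x - g y = (\<integral>w. h (x, w) - h (y, w) \<partial>?J)"
      unfolding g_def by (intro Bochner_Integration.integral_diff[symmetric] bdd_meas_integrable[OF pI] hx xy')
    also have "\<bar>\<dots>\<bar> \<le> (\<integral>w. \<bar>h (x, w) - h (y, w)\<bar> \<partial>?J)"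
      using integral_norm_bound[of "?J" "\<lambda>w. h (x, w) - h (y, w)"] by simp
    also have "\<dots> \<le> c"
      using b by (intro PJ.integral_le_const integrable_abs bdd_meas_integrable[OF pI] bdd_meas_diff hx xy') auto
    finally show "\<bar>g x - g y\<bar> \<le> c" .
  qed
  have inner: "(\<integral>y. exp (l * (h (x, y) - g x)) \<partial>?J) \<le> exp (l\<^sup>2 * c\<^sup>2 / 2)" if x: "x \<in> space (?I)" for x
  proof -
    have b: "\<bar>h (x, y) - g x\<bar> \<le> c" if y: "y \<in> space (?J)" for y
    proof -
      have bb: "\<bar>h (x, y) - h (x, w)\<bar> \<le> c" if w: "w \<in> space (?J)" for w
        unfolding h_def
      proof (rule Suc.prems(2)[of n, unfolded IJ])
        fix i assume "i \<in> I \<union> J - B n"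
        then show "merge I J (x, y) i = merge I J (x, w) i"
          using d by (auto simp: merge_def J_def)
      qed (use sp x y w in auto)
      have "h (x, y) - g x = (\<integral>w. h (x, y) - h (x, w) \<partial>?J)"
        unfolding g_def using bdd_meas_integrable[OF pI hx[OF x]] by (simp add: PJ.prob_space)
      also have "\<bar>\<dots>\<bar> \<le> (\<integral>w. \<bar>h (x, y) - h (x, w)\<bar> \<partial>?J)"
        using integral_norm_bound[of "?J" "\<lambda>w. h (x, y) - h (x, w)"] by simp
      also have "\<dots> \<le> c"
        using bb by (intro PJ.integral_le_const integrable_abs bdd_meas_integrable[OF pI] bdd_meas_diff bdd_meas_const hx x) auto
      finally show ?thesis .
    qed
    \<comment> \<open>The interval has length \<open>2 * c\<close>, which turns Hoeffding's exponent
      \<open>l^2 * (2 * c)^2 / 8\<close> into \<open>l^2 * c^2 / 2\<close>.\<close>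
    interpret V: interval_bounded_random_variable "?J" "\<lambda>y. h (x, y) - g x" "- c" c
    proof
      show "(\<lambda>y. h (x, y) - g x) \<in> borel_measurable (?J)"
        using bdd_meas_diff[OF hx[OF x] bdd_meas_const] by (auto simp: bdd_meas_def)
      show "AE y in ?J. h (x, y) - g x \<in> {- c..c}"
      proof (intro AE_I2)
        fix y assume "y \<in> space (?J)"
        from b[OF this] show "h (x, y) - g x \<in> {- c..c}" by (auto simp: abs_le_iff)
      qed
    qed
    have "(\<integral>y. h (x, y) - g x \<partial>?J) = 0"
      using bdd_meas_integrable[OF pI hx[OF x]] by (simp add: g_def PJ.prob_space)
    from V.Hoeffdings_lemma_nn_integral_0[OF l this]
    have "(\<integral>\<^sup>+y. ennreal (exp (l * (h (x, y) - g x))) \<partial>?J) \<le> ennreal (exp (l\<^sup>2 * c\<^sup>2 / 2))"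
      by (simp add: power_mult_distrib mult.commute)
    also have "(\<integral>\<^sup>+y. ennreal (exp (l * (h (x, y) - g x))) \<partial>?J) = ennreal (\<integral>y. exp (l * (h (x, y) - g x)) \<partial>?J)"
      by (intro nn_integral_eq_integral bdd_meas_integrable[OF pI] bdd_meas_exp bdd_meas_mult
            bdd_meas_diff bdd_meas_const hx x) auto
    finally show ?thesis by simp
  qed
  have "(\<integral>x. exp (l * (f x - m)) \<partial>Pi\<^sub>M (I \<union> J) \<mu>) = (\<integral>x. (\<integral>y. exp (l * (h (x, y) - m)) \<partial>?J) \<partial>?I)"
    unfolding h_def
    by (intro product_integral_fold[OF d] bdd_meas_integrable[OF pI] bdd_meas_exp bdd_meas_mult
            bdd_meas_diff bdd_meas_const f)
  also have "\<dots> = (\<integral>x. exp (l * (g x - m)) * (\<integral>y. exp (l * (h (x, y) - g x)) \<partial>?J) \<partial>?I)"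
    by (subst integral_mult_right_zero[symmetric]) (simp add: exp_add[symmetric] algebra_simps)
  also have "\<dots> \<le> (\<integral>x. exp (l * (g x - m)) * exp (l\<^sup>2 * c\<^sup>2 / 2) \<partial>?I)"
  proof (rule integral_mono)
    have "bdd_meas (?I \<Otimes>\<^sub>M ?J) (\<lambda>p. exp (l * (h p - g (fst p))))"
      by (intro bdd_meas_exp bdd_meas_mult bdd_meas_diff bdd_meas_const h
          bdd_meas_compose[OF g]) measurable
    from bdd_meas_integral[OF pI this]
    have "bdd_meas (?I) (\<lambda>x. \<integral>y. exp (l * (h (x, y) - g x)) \<partial>?J)" by simp
    then show "integrable (?I) (\<lambda>x. exp (l * (g x - m)) * (\<integral>y. exp (l * (h (x, y) - g x)) \<partial>?J))"
      by (intro bdd_meas_integrable[OF pI] bdd_meas_mult[OF bdd_meas_exp] bdd_meas_mult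
            bdd_meas_diff bdd_meas_const g)
    show "integrable (?I) (\<lambda>x. exp (l * (g x - m)) * exp (l\<^sup>2 * c\<^sup>2 / 2))"
      by (intro bdd_meas_integrable[OF pI] bdd_meas_mult[OF bdd_meas_exp] bdd_meas_mult
            bdd_meas_diff bdd_meas_const g)
  qed (use inner in \<open>auto intro: mult_left_mono\<close>)
  also have "\<dots> = (\<integral>x. exp (l * (g x - m)) \<partial>?I) * exp (l\<^sup>2 * c\<^sup>2 / 2)"
    by (rule integral_mult_left_zero)
  also have "\<dots> \<le> exp (real n * (l\<^sup>2 * c\<^sup>2 / 2)) * exp (l\<^sup>2 * c\<^sup>2 / 2)"
    using IH by (intro mult_right_mono) auto
  also have "\<dots> = exp (real (Suc n) * (l\<^sup>2 * c\<^sup>2 / 2))"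
    by (simp add: exp_add[symmetric] distrib_right)
  finally show ?case unfolding IJ m_def .
qed

lemma mcdiarmid:
  fixes \<mu> :: "'i \<Rightarrow> 'b measure" and B :: "nat \<Rightarrow> 'i set" and f :: "('i \<Rightarrow> 'b) \<Rightarrow> real"
  defines "P n \<equiv> Pi\<^sub>M (\<Union>k<n. B k) \<mu>"
  assumes \<mu>: "\<And>i. prob_space (\<mu> i)" and fin: "\<And>k. finite (B k)"
    and disj: "\<And>k l. k \<noteq> l \<Longrightarrow> B k \<inter> B l = {}"
    and f: "bdd_meas (P n) f"
    and diff: "\<And>k x y. k < n \<Longrightarrow> x \<in> space (P n) \<Longrightarrow> y \<in> space (P n) \<Longrightarrow>
       (\<And>i. i \<in> (\<Union>k<n. B k) - B k \<Longrightarrow> x i = y i) \<Longrightarrow> \<bar>f x - f y\<bar> \<le> c"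
    and pos: "n > 0" "c > 0" "\<epsilon> > 0"
  shows "measure (P n) {x\<in>space (P n). \<bar>f x - integral\<^sup>L (P n) f\<bar> \<ge> \<epsilon>} \<le> 2 * exp (- (\<epsilon>\<^sup>2 / (2 * real n * c\<^sup>2)))"
proof -
  interpret P: prob_space "P n" unfolding P_def by (intro prob_space_PiM \<mu>)
  \<comment> \<open>The minimiser of \<open>n * l^2 * c^2 / 2 - l * \<epsilon>\<close>.\<close>
  define l where "l = \<epsilon> / (real n * c\<^sup>2)"
  have l: "l > 0" using pos by (simp add: l_def)
  have one: "measure (P n) {x\<in>space (P n). g x - integral\<^sup>L (P n) g \<ge> \<epsilon>} \<le> exp (- (\<epsilon>\<^sup>2 / (2 * real n * c\<^sup>2)))"
    if g: "bdd_meas (P n) g"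
      and diff: "\<And>k x y. k < n \<Longrightarrow> x \<in> space (P n) \<Longrightarrow> y \<in> space (P n) \<Longrightarrow>
       (\<And>i. i \<in> (\<Union>k<n. B k) - B k \<Longrightarrow> x i = y i) \<Longrightarrow> \<bar>g x - g y\<bar> \<le> c" for g
  proof -
    let ?u = "\<lambda>x. exp (l * (g x - integral\<^sup>L (P n) g))"
    have "{x\<in>space (P n). g x - integral\<^sup>L (P n) g \<ge> \<epsilon>} = {x\<in>space (P n). ?u x \<ge> exp (l * \<epsilon>)}"
      using l by simp
    moreover have "measure (P n) {x\<in>space (P n). ?u x \<ge> exp (l * \<epsilon>)} \<le> integral\<^sup>L (P n) ?u / exp (l * \<epsilon>)"
      by (rule integral_Markov_inequality_measure[where A="{}"])
         (auto intro!: bdd_meas_integrable[OF P.prob_space_axioms] bdd_meas_exp bdd_meas_mult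
            bdd_meas_diff bdd_meas_const g)
    moreover have "integral\<^sup>L (P n) ?u \<le> exp (real n * (l\<^sup>2 * c\<^sup>2 / 2))"
      unfolding P_def
      by (rule mcdiarmid_exponential[where B=B and \<mu>=\<mu> and c=c]; fact \<mu> fin disj l g[unfolded P_def] diff[unfolded P_def])
    ultimately have "measure (P n) {x\<in>space (P n). g x - integral\<^sup>L (P n) g \<ge> \<epsilon>} \<le> exp (real n * (l\<^sup>2 * c\<^sup>2 / 2)) / exp (l * \<epsilon>)"
      by (smt (verit) divide_right_mono exp_ge_zero)
    also have "\<dots> = exp (real n * (l\<^sup>2 * c\<^sup>2 / 2) - l * \<epsilon>)" by (simp add: exp_diff)
    also have "real n * (l\<^sup>2 * c\<^sup>2 / 2) - l * \<epsilon> = - (\<epsilon>\<^sup>2 / (2 * real n * c\<^sup>2))"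
      using pos by (simp add: l_def field_simps power2_eq_square)
    finally show ?thesis .
  qed
  have f': "bdd_meas (P n) (\<lambda>x. - f x)"
    using bdd_meas_diff[OF bdd_meas_const f, of 0] by simp
  have [measurable]: "f \<in> borel_measurable (P n)" using f by (auto simp: bdd_meas_def)
  have "{x\<in>space (P n). \<bar>f x - integral\<^sup>L (P n) f\<bar> \<ge> \<epsilon>} =
     {x\<in>space (P n). f x - integral\<^sup>L (P n) f \<ge> \<epsilon>} \<union> {x\<in>space (P n). - f x - integral\<^sup>L (P n) (\<lambda>x. - f x) \<ge> \<epsilon>}"
    by auto
  also have "measure (P n) \<dots> \<le> measure (P n) {x\<in>space (P n). f x - integral\<^sup>L (P n) f \<ge> \<epsilon>}
      + measure (P n) {x\<in>space (P n). - f x - integral\<^sup>L (P n) (\<lambda>x. - f x) \<ge> \<epsilon>}"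
    by (intro measure_Un_le) measurable
  also have "\<dots> \<le> exp (- (\<epsilon>\<^sup>2 / (2 * real n * c\<^sup>2))) + exp (- (\<epsilon>\<^sup>2 / (2 * real n * c\<^sup>2)))"
    by (intro add_mono one f f') (use diff in \<open>force simp: abs_minus_commute\<close>)+
  finally show ?thesis by simp
qed

section \<open>Second moments of linear and quadratic forms in independent variables\<close>

context
  fixes \<mu> :: "'i \<Rightarrow> real measure" and h :: "real \<Rightarrow> real" and \<epsilon> :: real and J :: "'i set" and v :: "'i \<Rightarrow> real"
  assumes \<mu>: "\<And>i. prob_space (\<mu> i)" and sets_\<mu>: "\<And>i. sets (\<mu> i) = sets borel"
    and J: "finite J"
    and h [measurable]: "h \<in> borel_measurable borel" and hb: "\<And>x. \<bar>h x\<bar> \<le> \<epsilon>"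
    and centred: "\<And>k. k \<in> J \<Longrightarrow> integral\<^sup>L (\<mu> k) h = 0"
  defines "v \<equiv> \<lambda>k. \<integral>x. (h x)\<^sup>2 \<partial>\<mu> k"
begin

lemma bdd_meas_truncation: "bdd_meas (\<mu> k) h"
  using hb h measurable_cong_sets[OF sets_\<mu>[of k] refl, of borel] by (intro bdd_measI[where C=\<epsilon>]) auto

lemma bdd_meas_truncation_PiM: "k \<in> A \<Longrightarrow> bdd_meas (Pi\<^sub>M A \<mu>) (\<lambda>x. h (x k))"
  by (rule bdd_meas_compose[OF bdd_meas_truncation]) measurable

lemmas bm_intros = bdd_meas_sum bdd_meas_diff bdd_meas_add bdd_meas_mult
  bdd_meas_power2 bdd_meas_const bdd_meas_truncation_PiM bdd_meas_truncation

text \<open>Integrating out one coordinate at a time, the cross term vanishes because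
  \<open>h\<close> is centred.\<close>

lemma variance_linear_form:
  assumes "A \<subseteq> J"
  shows "(\<integral>x. (\<Sum>k\<in>A. h (x k) * b k)\<^sup>2 \<partial>Pi\<^sub>M A \<mu>) = (\<Sum>k\<in>A. v k * (b k)\<^sup>2)"
  using finite_subset[OF assms J] assms
proof (induction A rule: finite_induct)
  case empty
  interpret P: prob_space "Pi\<^sub>M {} \<mu>" by (intro prob_space_PiM \<mu>)
  show ?case by simp
next
  case (insert l A)
  interpret product_sigma_finite \<mu> by (intro product_sigma_finite.intro prob_space_imp_sigma_finite \<mu>)
  have pA: "prob_space (Pi\<^sub>M A \<mu>)" for A by (intro prob_space_PiM \<mu>)
  interpret PA: prob_space "Pi\<^sub>M A \<mu>" by (rule pA)
  interpret m: prob_space "\<mu> l" by (rule \<mu>)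
  note int = bdd_meas_integrable[OF pA] bdd_meas_integrable[OF \<mu>]
  let ?L = "\<lambda>x. \<Sum>k\<in>A. h (x k) * b k"
  have "(\<integral>x. (\<Sum>k\<in>insert l A. h (x k) * b k)\<^sup>2 \<partial>Pi\<^sub>M (insert l A) \<mu>)
      = (\<integral>x. (\<integral>y. (\<Sum>k\<in>insert l A. h ((x(l := y)) k) * b k)\<^sup>2 \<partial>\<mu> l) \<partial>Pi\<^sub>M A \<mu>)"
    using insert by (intro product_integral_insert int bm_intros) auto
  also have "\<dots> = (\<integral>x. (\<integral>y. (?L x)\<^sup>2 + 2 * b l * ?L x * h y + (b l)\<^sup>2 * (h y)\<^sup>2 \<partial>\<mu> l) \<partial>Pi\<^sub>M A \<mu>)"
  proof (intro Bochner_Integration.integral_cong refl)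
    fix x y
    have "(\<Sum>k\<in>insert l A. h ((x(l := y)) k) * b k) = h y * b l + ?L x"
      using insert by (auto intro!: sum.cong)
    then show "(\<Sum>k\<in>insert l A. h ((x(l := y)) k) * b k)\<^sup>2 = (?L x)\<^sup>2 + 2 * b l * ?L x * h y + (b l)\<^sup>2 * (h y)\<^sup>2"
      by (simp add: power2_eq_square algebra_simps)
  qed
  also have "\<dots> = (\<integral>x. (?L x)\<^sup>2 + (b l)\<^sup>2 * v l \<partial>Pi\<^sub>M A \<mu>)"
  proof (intro Bochner_Integration.integral_cong refl)
    fix x
    have "(\<integral>y. (?L x)\<^sup>2 + 2 * b l * ?L x * h y + (b l)\<^sup>2 * (h y)\<^sup>2 \<partial>\<mu> l) =
       (\<integral>y. (?L x)\<^sup>2 \<partial>\<mu> l) + (\<integral>y. 2 * b l * ?L x * h y \<partial>\<mu> l) + (\<integral>y. (b l)\<^sup>2 * (h y)\<^sup>2 \<partial>\<mu> l)"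
      by (simp add: int bm_intros)
    also have "\<dots> = (?L x)\<^sup>2 + (b l)\<^sup>2 * v l"
      using centred[of l] insert by (simp add: m.prob_space v_def)
    finally show "(\<integral>y. (?L x)\<^sup>2 + 2 * b l * ?L x * h y + (b l)\<^sup>2 * (h y)\<^sup>2 \<partial>\<mu> l) = (?L x)\<^sup>2 + (b l)\<^sup>2 * v l" .
  qed
  also have "\<dots> = (\<integral>x. (?L x)\<^sup>2 \<partial>Pi\<^sub>M A \<mu>) + (b l)\<^sup>2 * v l"
    by (subst Bochner_Integration.integral_add) (auto simp: PA.prob_space intro!: int bm_intros)
  finally show ?case using insert by (simp add: mult.commute)
qed

lemma truncated_variance_nonneg: "0 \<le> v k"
  unfolding v_def by (intro integral_nonneg_AE AE_I2) auto

text \<open>Drop the negative term \<open>- (v k)^2\<close> and bound the fourth moment by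
  \<open>h^4 <= \<epsilon>^2 * h^2\<close>; no moment beyond the second enters.\<close>

lemma variance_truncation_sq: "(\<integral>x. ((h x)\<^sup>2 - v k)\<^sup>2 \<partial>\<mu> k) \<le> \<epsilon>\<^sup>2 * v k"
proof -
  interpret m: prob_space "\<mu> k" by (rule \<mu>)
  note int = bdd_meas_integrable[OF \<mu>]
  have "(\<integral>x. ((h x)\<^sup>2 - v k)\<^sup>2 \<partial>\<mu> k) = (\<integral>x. (h x)\<^sup>2 * (h x)\<^sup>2 - 2 * v k * (h x)\<^sup>2 + (v k)\<^sup>2 \<partial>\<mu> k)"
    by (intro Bochner_Integration.integral_cong refl) (simp add: power2_eq_square algebra_simps)
  also have "\<dots> = (\<integral>x. (h x)\<^sup>2 * (h x)\<^sup>2 \<partial>\<mu> k) - (\<integral>x. 2 * v k * (h x)\<^sup>2 \<partial>\<mu> k) + (\<integral>x. (v k)\<^sup>2 \<partial>\<mu> k)"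
    by (subst Bochner_Integration.integral_add, intro int bm_intros, intro int bm_intros,
        subst Bochner_Integration.integral_diff, intro int bm_intros, intro int bm_intros, rule refl)
  also have "\<dots> = (\<integral>x. (h x)\<^sup>2 * (h x)\<^sup>2 \<partial>\<mu> k) - 2 * v k * v k + (v k)\<^sup>2"
    by (simp add: m.prob_space v_def)
  also have "\<dots> \<le> (\<integral>x. (h x)\<^sup>2 * (h x)\<^sup>2 \<partial>\<mu> k)"
    using truncated_variance_nonneg[of k] by (simp add: power2_eq_square)
  also have "\<dots> \<le> (\<integral>x. \<epsilon>\<^sup>2 * (h x)\<^sup>2 \<partial>\<mu> k)"
  proof (intro integral_mono int bm_intros)
    show "(h x)\<^sup>2 * (h x)\<^sup>2 \<le> \<epsilon>\<^sup>2 * (h x)\<^sup>2" for x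
      using power_mono[OF hb[of x], of 2] by (intro mult_right_mono) auto
  qed
  finally show ?thesis by (simp add: v_def)
qed

text \<open>Adding the indices one by one produces martingale differences, so the second moments of
  the increments add up. The constants come from \<open>(p + q)^2 <= 2 * p^2 + 2 * q^2\<close>,
  where \<open>p\<close> already carries the factor 2 of the cross terms: \<open>2 * 4 = 8\<close>
  for \<open>p\<close> and 2 for \<open>q\<close>.\<close>

lemma variance_quadratic_form:
  assumes "A \<subseteq> J" and a: "\<And>k m. k \<in> A \<Longrightarrow> m \<in> A \<Longrightarrow> a k m = a m k"
  shows "(\<integral>x. ((\<Sum>k\<in>A. \<Sum>m\<in>A. h (x k) * h (x m) * a k m) - (\<Sum>k\<in>A. v k * a k k))\<^sup>2 \<partial>Pi\<^sub>M A \<mu>)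
     \<le> 8 * (\<Sum>l\<in>A. \<Sum>k\<in>A. v l * v k * (a k l)\<^sup>2) + 2 * \<epsilon>\<^sup>2 * (\<Sum>l\<in>A. v l * (a l l)\<^sup>2)"
  using finite_subset[OF assms(1) J] assms
proof (induction A rule: finite_induct)
  case empty
  interpret P: prob_space "Pi\<^sub>M {} \<mu>" by (intro prob_space_PiM \<mu>)
  show ?case by simp
next
  case (insert l A)
  interpret product_sigma_finite \<mu> by (intro product_sigma_finite.intro prob_space_imp_sigma_finite \<mu>)
  have pA: "prob_space (Pi\<^sub>M A \<mu>)" for A by (intro prob_space_PiM \<mu>)
  interpret PA: prob_space "Pi\<^sub>M A \<mu>" by (rule pA)
  interpret m: prob_space "\<mu> l" by (rule \<mu>)
  note int = bdd_meas_integrable[OF pA] bdd_meas_integrable[OF \<mu>]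
  let ?P = "Pi\<^sub>M A \<mu>"
  let ?Q = "\<lambda>x. (\<Sum>k\<in>A. \<Sum>m\<in>A. h (x k) * h (x m) * a k m) - (\<Sum>k\<in>A. v k * a k k)"
  let ?L = "\<lambda>x. \<Sum>k\<in>A. h (x k) * a k l"
  let ?R = "\<lambda>x. (\<Sum>k\<in>insert l A. \<Sum>m\<in>insert l A. h (x k) * h (x m) * a k m) - (\<Sum>k\<in>insert l A. v k * a k k)"
  \<comment> \<open>The increment, separated into a part linear in the new variable and a centred
    square; symmetry of \<open>a\<close> merges the two cross sums.\<close>
  have R: "?R (x(l := y)) = ?Q x + (2 * ?L x * h y + a l l * ((h y)\<^sup>2 - v l))" for x y
  proof -
    have 1: "(\<Sum>m\<in>A. h y * h ((x(l := y)) m) * a l m) = h y * ?L x"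
      using insert by (auto simp: sum_distrib_left mult_ac intro!: sum.cong)
    have 2: "(\<Sum>k\<in>A. \<Sum>m\<in>insert l A. h ((x(l := y)) k) * h ((x(l := y)) m) * a k m)
       = (\<Sum>k\<in>A. h y * (h (x k) * a k l) + (\<Sum>m\<in>A. h (x k) * h (x m) * a k m))"
      using insert by (intro sum.cong refl) (auto intro!: sum.cong)
    show ?thesis using insert 1 2
      by (simp add: sum.distrib sum_distrib_left[symmetric] power2_eq_square algebra_simps)
  qed
  have "(\<integral>x. (?R x)\<^sup>2 \<partial>Pi\<^sub>M (insert l A) \<mu>) = (\<integral>x. (\<integral>y. (?R (x(l := y)))\<^sup>2 \<partial>\<mu> l) \<partial>?P)"
    using insert by (intro product_integral_insert int bm_intros) auto
  also have "\<dots> \<le> (\<integral>x. (?Q x)\<^sup>2 + (8 * v l * (?L x)\<^sup>2 + 2 * (a l l)\<^sup>2 * (\<epsilon>\<^sup>2 * v l)) \<partial>?P)"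
  proof (rule integral_mono)
    have "bdd_meas (?P \<Otimes>\<^sub>M \<mu> l) (\<lambda>p. (?Q (fst p) + (2 * ?L (fst p) * h (snd p) + a l l * ((h (snd p))\<^sup>2 - v l)))\<^sup>2)"
      by (intro bdd_meas_power2 bdd_meas_add bdd_meas_mult bdd_meas_diff bdd_meas_const
         bdd_meas_compose[OF _ measurable_fst, where f="?Q"] bdd_meas_compose[OF _ measurable_fst, where f="?L"]
         bdd_meas_compose[OF bdd_meas_truncation measurable_snd])
         (intro bm_intros; assumption)+
    from bdd_meas_integral[OF \<mu> this]
    show "integrable (?P) (\<lambda>x. \<integral>y. (?R (x(l := y)))\<^sup>2 \<partial>\<mu> l)"
      unfolding R by (intro int) simp
    show "integrable (?P) (\<lambda>x. (?Q x)\<^sup>2 + (8 * v l * (?L x)\<^sup>2 + 2 * (a l l)\<^sup>2 * (\<epsilon>\<^sup>2 * v l)))"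
      by (intro int bm_intros)
    fix x
    let ?D = "\<lambda>y. 2 * ?L x * h y + a l l * ((h y)\<^sup>2 - v l)"
    have D: "(\<integral>y. ?D y \<partial>\<mu> l) = 0"
      using centred[of l] insert by (simp add: int bm_intros m.prob_space v_def)
    have "(\<integral>y. (?R (x(l := y)))\<^sup>2 \<partial>\<mu> l) = (\<integral>y. (?Q x)\<^sup>2 + 2 * ?Q x * ?D y + (?D y)\<^sup>2 \<partial>\<mu> l)"
      unfolding R by (intro Bochner_Integration.integral_cong refl) (simp add: power2_sum)
    also have "\<dots> = (\<integral>y. (?Q x)\<^sup>2 \<partial>\<mu> l) + (\<integral>y. 2 * ?Q x * ?D y \<partial>\<mu> l) + (\<integral>y. (?D y)\<^sup>2 \<partial>\<mu> l)"
      by (subst Bochner_Integration.integral_add, intro int bm_intros, intro int bm_intros,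
          subst Bochner_Integration.integral_add, intro int bm_intros, intro int bm_intros, rule refl)
    also have "\<dots> = (?Q x)\<^sup>2 + (\<integral>y. (?D y)\<^sup>2 \<partial>\<mu> l)"
      unfolding integral_mult_right_zero D by (simp add: m.prob_space)
    finally have e: "(\<integral>y. (?R (x(l := y)))\<^sup>2 \<partial>\<mu> l) = (?Q x)\<^sup>2 + (\<integral>y. (?D y)\<^sup>2 \<partial>\<mu> l)" .
    have "(\<integral>y. (?D y)\<^sup>2 \<partial>\<mu> l) \<le> (\<integral>y. 8 * (?L x)\<^sup>2 * (h y)\<^sup>2 + 2 * (a l l)\<^sup>2 * ((h y)\<^sup>2 - v l)\<^sup>2 \<partial>\<mu> l)"
    proof (intro integral_mono int bm_intros)
      fix y
      have "(p + q)\<^sup>2 \<le> 2 * p\<^sup>2 + 2 * q\<^sup>2" for p q :: real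
        using sum_squares_bound[of p q] by (simp add: power2_sum)
      from this[of "2 * ?L x * h y" "a l l * ((h y)\<^sup>2 - v l)"]
      show "(?D y)\<^sup>2 \<le> 8 * (?L x)\<^sup>2 * (h y)\<^sup>2 + 2 * (a l l)\<^sup>2 * ((h y)\<^sup>2 - v l)\<^sup>2"
        by (simp add: power_mult_distrib)
    qed
    also have "\<dots> = (\<integral>y. 8 * (?L x)\<^sup>2 * (h y)\<^sup>2 \<partial>\<mu> l) + (\<integral>y. 2 * (a l l)\<^sup>2 * ((h y)\<^sup>2 - v l)\<^sup>2 \<partial>\<mu> l)"
      by (intro Bochner_Integration.integral_add int bm_intros)
    also have "\<dots> = 8 * (?L x)\<^sup>2 * v l + 2 * (a l l)\<^sup>2 * (\<integral>y. ((h y)\<^sup>2 - v l)\<^sup>2 \<partial>\<mu> l)"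
      unfolding integral_mult_right_zero by (simp only: v_def)
    also have "\<dots> \<le> 8 * (?L x)\<^sup>2 * v l + 2 * (a l l)\<^sup>2 * (\<epsilon>\<^sup>2 * v l)"
      by (intro add_left_mono mult_left_mono variance_truncation_sq) auto
    finally show "(\<integral>y. (?R (x(l := y)))\<^sup>2 \<partial>\<mu> l) \<le> (?Q x)\<^sup>2 + (8 * v l * (?L x)\<^sup>2 + 2 * (a l l)\<^sup>2 * (\<epsilon>\<^sup>2 * v l))"
      unfolding e by (simp add: mult_ac)
  qed
  also have "\<dots> = (\<integral>x. (?Q x)\<^sup>2 \<partial>?P) + (8 * v l * (\<integral>x. (?L x)\<^sup>2 \<partial>?P) + 2 * (a l l)\<^sup>2 * (\<epsilon>\<^sup>2 * v l))"
  proof -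
    have i: "integrable (?P) (\<lambda>x. (?Q x)\<^sup>2)" "integrable (?P) (\<lambda>x. 8 * v l * (?L x)\<^sup>2)"
      by (intro int bm_intros; assumption)+
    show ?thesis
      using i by (simp add: PA.prob_space del: mult_eq_0_iff)
  qed
  finally have 1: "(\<integral>x. (?R x)\<^sup>2 \<partial>Pi\<^sub>M (insert l A) \<mu>) \<le> (\<integral>x. (?Q x)\<^sup>2 \<partial>?P) + (8 * v l * (\<integral>x. (?L x)\<^sup>2 \<partial>?P) + 2 * (a l l)\<^sup>2 * (\<epsilon>\<^sup>2 * v l))" .
  have 2: "(\<integral>x. (?L x)\<^sup>2 \<partial>?P) = (\<Sum>k\<in>A. v k * (a k l)\<^sup>2)"
    using insert by (intro variance_linear_form) auto
  have 3: "(\<integral>x. (?Q x)\<^sup>2 \<partial>?P) \<le> 8 * (\<Sum>l\<in>A. \<Sum>k\<in>A. v l * v k * (a k l)\<^sup>2) + 2 * \<epsilon>\<^sup>2 * (\<Sum>l\<in>A. v l * (a l l)\<^sup>2)"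
    using insert by (intro insert.IH) auto
  have "(8 * (\<Sum>l\<in>A. \<Sum>k\<in>A. v l * v k * (a k l)\<^sup>2) + 2 * \<epsilon>\<^sup>2 * (\<Sum>l\<in>A. v l * (a l l)\<^sup>2))
        + (8 * v l * (\<Sum>k\<in>A. v k * (a k l)\<^sup>2) + 2 * (a l l)\<^sup>2 * (\<epsilon>\<^sup>2 * v l))
     = 8 * ((\<Sum>k\<in>A. v l * v k * (a k l)\<^sup>2) + (\<Sum>l\<in>A. \<Sum>k\<in>A. v l * v k * (a k l)\<^sup>2)) + 2 * \<epsilon>\<^sup>2 * (\<Sum>l\<in>insert l A. v l * (a l l)\<^sup>2)"
    using insert(1,2) by (simp add: algebra_simps sum_distrib_left)
  \<comment> \<open>The induction yields each unordered pair once, whereas the full double sum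
    counts it twice and also includes diagonal terms; nonnegativity allows this enlargement.\<close>
  also have "\<dots> \<le> 8 * (\<Sum>j\<in>insert l A. \<Sum>k\<in>insert l A. v j * v k * (a k j)\<^sup>2) + 2 * \<epsilon>\<^sup>2 * (\<Sum>l\<in>insert l A. v l * (a l l)\<^sup>2)"
  proof -
    have "(\<Sum>k\<in>A. v l * v k * (a k l)\<^sup>2) \<le> (\<Sum>k\<in>insert l A. v l * v k * (a k l)\<^sup>2)"
      using insert truncated_variance_nonneg by (intro sum_mono2) auto
    moreover have "(\<Sum>l\<in>A. \<Sum>k\<in>A. v l * v k * (a k l)\<^sup>2) \<le> (\<Sum>l'\<in>A. \<Sum>k\<in>insert l A. v l' * v k * (a k l')\<^sup>2)"
      using insert truncated_variance_nonneg by (intro sum_mono sum_mono2) auto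
    ultimately show ?thesis using insert(1,2) by (simp add: truncated_variance_nonneg add_increasing)
  qed
  finally show ?case by (rule order_trans[OF 1[unfolded 2] order_trans[OF add_right_mono[OF 3]]])
qed

end

section \<open>Triangular arrays with normal row sums\<close>

text \<open>If the property failed for some index at infinitely many \<open>n\<close>, choosing a
  bad index at each such \<open>n\<close> would give one sequence violating the assumption. This
  turns hypotheses about arbitrary sequences \<open>i_n\<close> into uniformity over the row. The
  default value 0 is a legal index exactly when \<open>n > 0\<close>.\<close>

lemma eventually_all_indices:
  assumes "\<And>I :: nat \<Rightarrow> nat. (\<forall>n>0. I n < n) \<Longrightarrow> \<forall>\<^sub>F n in sequentially. Q n (I n)"
  shows "\<forall>\<^sub>F n in sequentially. \<forall>i<n. Q n i"
proof -
  define I where "I n = (if \<exists>i<n. \<not> Q n i then SOME i. i < n \<and> \<not> Q n i else 0)" for n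
  have I: "I n < n \<and> \<not> Q n (I n)" if "\<exists>i<n. \<not> Q n i" for n
    using someI_ex[of "\<lambda>i. i < n \<and> \<not> Q n i"] that by (auto simp: I_def)
  then have "\<forall>n>0. I n < n" by (metis I_def)
  from assms[OF this] show ?thesis by eventually_elim (use I in blast)
qed

text \<open>Take logarithms and use \<open>p <= - ln (1 - p) <= (1 + 2 * e) * p\<close> for
  \<open>0 <= p < e <= 1/2\<close>. The lower inequality bounds the sum of the \<open>p\<close> by
  the convergent quantity \<open>L n\<close>, so the relative error becomes an absolute one.\<close>

lemma tendsto_sum_of_prod:
  fixes p :: "nat \<Rightarrow> nat \<Rightarrow> real"
  assumes nonneg: "\<And>n j. j < n \<Longrightarrow> 0 \<le> p n j"
    and small: "\<And>e. e > 0 \<Longrightarrow> \<forall>\<^sub>F n in sequentially. \<forall>j<n. p n j < e"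
    and lim: "(\<lambda>n. \<Prod>j<n. 1 - p n j) \<longlonglongrightarrow> exp (- a)"
  shows "(\<lambda>n. \<Sum>j<n. p n j) \<longlonglongrightarrow> a"
proof -
  define L where "L n = - ln (\<Prod>j<n. 1 - p n j)" for n
  have "(\<lambda>n. - ln (\<Prod>j<n. 1 - p n j)) \<longlonglongrightarrow> - ln (exp (- a))"
    by (intro tendsto_minus tendsto_ln lim) simp
  then have L: "L \<longlonglongrightarrow> a" by (simp add: L_def[abs_def])
  have bounds: "\<forall>\<^sub>F n in sequentially. (\<Sum>j<n. p n j) \<le> L n \<and> L n \<le> (1 + 2 * e) * (\<Sum>j<n. p n j)" if "0 < e" "e \<le> 1/2" for e
    using small[OF that(1)]
  proof eventually_elim
    case (elim n)
    have L_eq: "L n = (\<Sum>j<n. - ln (1 - p n j))"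
      unfolding L_def using elim that by (subst ln_prod) (auto simp: sum_negf intro: less_le_trans)
    have "p n j \<le> - ln (1 - p n j)" "- ln (1 - p n j) \<le> (1 + 2 * e) * p n j" if j: "j < n" for j
    proof -
      have p: "0 \<le> p n j" "p n j < e" "p n j \<le> 1/2" using nonneg elim j \<open>e \<le> 1/2\<close> by (auto intro: order_trans less_imp_le)
      show "p n j \<le> - ln (1 - p n j)" using ln_le_minus_one[of "1 - p n j"] p by simp
      have "- ln (1 - p n j) \<le> p n j + 2 * (p n j)\<^sup>2"
        using ln_one_minus_pos_lower_bound[of "p n j"] p by simp
      also have "\<dots> \<le> (1 + 2 * e) * p n j"
        using p mult_right_mono[of "p n j" e "p n j"] by (simp add: power2_eq_square algebra_simps)
      finally show "- ln (1 - p n j) \<le> (1 + 2 * e) * p n j" .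
    qed
    then show ?case unfolding L_eq sum_distrib_left by (auto intro!: sum_mono)
  qed
  have "(\<lambda>n. L n - (\<Sum>j<n. p n j)) \<longlonglongrightarrow> 0"
  proof (rule tendstoI)
    fix r :: real assume r: "r > 0"
    \<comment> \<open>Chosen so that \<open>2 * e * (\<bar>a\<bar> + 1)\<close> is at most
      \<open>r / 2\<close>, and \<open>e\<close> stays in the range of the logarithm bound.\<close>
    define e where "e = min (1/2) (r / (4 * (\<bar>a\<bar> + 1)))"
    have e: "0 < e" "e \<le> 1/2" using r unfolding e_def by (simp add: add_nonneg_pos, intro min.cobounded1)
    have "e * (4 * (\<bar>a\<bar> + 1)) \<le> r / (4 * (\<bar>a\<bar> + 1)) * (4 * (\<bar>a\<bar> + 1))"
      by (intro mult_right_mono) (auto simp: e_def)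
    then have er: "e * (4 * (\<bar>a\<bar> + 1)) \<le> r" by simp
    have "\<forall>\<^sub>F n in sequentially. L n < \<bar>a\<bar> + 1"
      using order_tendstoD(2)[OF L, of "\<bar>a\<bar> + 1"] by simp
    with bounds[OF e] show "\<forall>\<^sub>F n in sequentially. dist (L n - (\<Sum>j<n. p n j)) 0 < r"
    proof eventually_elim
      case (elim n)
      have "L n - (\<Sum>j<n. p n j) \<le> 2 * e * (\<Sum>j<n. p n j)" using elim by (simp add: algebra_simps)
      also have "\<dots> \<le> 2 * e * (\<bar>a\<bar> + 1)" using elim e by (intro mult_left_mono) auto
      also have "\<dots> < r" using er r e by (auto simp: algebra_simps)
      finally show ?case using elim by (simp add: dist_real_def)
    qed
  qed
  from tendsto_diff[OF L this] show ?thesis by simp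
qed

lemma cos_approx:
  fixes x :: real
  shows "\<bar>cos x - 1 + x\<^sup>2 / 2\<bar> \<le> \<bar>x\<bar> ^ 3 / 6"
proof -
  have "cos x - 1 + x\<^sup>2 / 2 = Re (iexp x - (\<Sum>k\<le>2. (\<i> * x) ^ k / fact k))"
    by (simp add: Re_exp numeral_2_eq_2 power2_eq_square)
  then have "\<bar>cos x - 1 + x\<^sup>2 / 2\<bar> \<le> cmod (iexp x - (\<Sum>k\<le>2. (\<i> * x) ^ k / fact k))"
    by (metis abs_Re_le_cmod)
  also have "\<dots> \<le> \<bar>x\<bar> ^ 3 / 6"
    using iexp_approx1[of x 2] by (simp add: numeral_3_eq_3 fact_numeral)
  finally show ?thesis .
qed

section \<open>Tail probabilities by averaging over frequencies\<close>

context
  fixes \<epsilon> T :: real and N :: "real measure"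
  assumes \<epsilon>: "\<epsilon> > 0"
  defines "T \<equiv> 2 / \<epsilon>" and "N \<equiv> uniform_measure lborel {0..T}"
begin

lemma prob_space_averaging: "prob_space N"
  unfolding N_def using \<epsilon> by (intro prob_space_uniform_measure) (auto simp: T_def)

text \<open>The average of \<open>cos (t * x)\<close> over \<open>[0, T]\<close> is
  \<open>sin (T * x) / (T * x)\<close>, at most 1/2 because \<open>T = 2 / \<epsilon>\<close> forces
  \<open>\<bar>x\<bar> * T > 2\<close>. With \<open>s = 1 - cos (t * x)\<close>, the inequality
  \<open>s^2 >= s - 1/4\<close> then leaves \<open>1/2 - 1/4\<close>.\<close>

lemma average_cos_sq_ge:
  assumes x: "\<bar>x\<bar> > \<epsilon>"
  shows "1 / 4 \<le> (\<integral>t. (1 - cos (t * x))\<^sup>2 \<partial>N)"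
proof -
  interpret N: prob_space N by (rule prob_space_averaging)
  have T: "T > 0" using \<epsilon> by (simp add: T_def)
  have x0: "x \<noteq> 0" using x \<epsilon> by auto
  have bm: "bdd_meas N (\<lambda>t. cos (t * x))"
    by (intro bdd_measI[where C=1]) (auto simp: N_def)
  note int = bdd_meas_integrable[OF prob_space_averaging]
  note bmi = bdd_meas_diff bdd_meas_const bdd_meas_power2 bm
  have "(\<integral>t. cos (t * x) \<partial>N) = (\<integral>t. indicator {0..T} t *\<^sub>R cos (t * x) \<partial>lborel) / T"
  proof -
    have "N = density lborel (\<lambda>t. ennreal (indicator {0..T} t / T))"
      unfolding N_def uniform_measure_def using T
      by (intro density_cong AE_I2) (auto simp: divide_ennreal[symmetric] split: split_indicator)
    then show ?thesis using T by (simp add: integral_density)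
  qed
  also have "(\<integral>t. indicator {0..T} t *\<^sub>R cos (t * x) \<partial>lborel) = sin (T * x) / x - sin (0 * x) / x"
  proof (rule integral_FTC_atLeastAtMost)
    show "((\<lambda>t. sin (t * x) / x) has_vector_derivative cos (t * x)) (at t within {0..T})" for t
      unfolding has_real_derivative_iff_has_vector_derivative[symmetric]
      using x0 by (auto intro!: derivative_eq_intros)
  qed (use T in \<open>auto intro!: continuous_intros\<close>)
  finally have e: "(\<integral>t. cos (t * x) \<partial>N) = sin (T * x) / (x * T)" by simp
  have "\<bar>sin (T * x) / (x * T)\<bar> \<le> 1 / (\<bar>x\<bar> * T)"
    using T by (simp add: abs_mult divide_right_mono)
  also have "\<dots> \<le> 1 / 2"
  proof -
    have "2 = \<epsilon> * T" using \<epsilon> by (simp add: T_def)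
    also have "\<dots> \<le> \<bar>x\<bar> * T" using x T by (intro mult_right_mono) auto
    finally show ?thesis by (intro frac_le) auto
  qed
  finally have "(\<integral>t. cos (t * x) \<partial>N) \<le> 1 / 2" unfolding e by linarith
  then have "1 / 4 \<le> (\<integral>t. (1 - cos (t * x)) - 1 / 4 \<partial>N)"
    using int[OF bm] by (simp add: N.prob_space)
  also have "\<dots> \<le> (\<integral>t. (1 - cos (t * x))\<^sup>2 \<partial>N)"
  proof (intro integral_mono int bmi)
    show "(1 - cos (t * x)) - 1 / 4 \<le> (1 - cos (t * x))\<^sup>2" for t
      using zero_le_power2[of "1 - cos (t * x) - 1 / 2"] by (simp add: power2_diff power2_eq_square field_simps)
  qed
  finally show ?thesis .
qed

text \<open>Averaging over \<open>t\<close> must be restricted to those \<open>t\<close> at which the row sum is at most one,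
  because the convergence is only pointwise in \<open>t\<close> and no dominating function is known a priori.\<close>

lemma tail_sum_tendsto_0:
  fixes \<nu> :: "nat \<Rightarrow> nat \<Rightarrow> real measure"
  assumes \<nu>: "\<And>n j. j < n \<Longrightarrow> real_distribution (\<nu> n j)"
    and lim: "\<And>t. (\<lambda>n. \<Sum>j<n. \<integral>x. (1 - cos (t * x))\<^sup>2 \<partial>\<nu> n j) \<longlonglongrightarrow> 0"
  shows "(\<lambda>n. \<Sum>j<n. measure (\<nu> n j) {x. \<bar>x\<bar> > \<epsilon>}) \<longlonglongrightarrow> 0"
proof -
  note intN = bdd_meas_integrable[OF prob_space_averaging]
  let ?tail = "\<lambda>n. \<Sum>j<n. measure (\<nu> n j) {x. \<bar>x\<bar> > \<epsilon>}"
  interpret N: prob_space N by (rule prob_space_averaging)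
  have setsN [measurable_cong]: "sets N = sets borel" by (simp add: N_def)
  have pv: "prob_space (\<nu> n j)" and setsv: "sets (\<nu> n j) = sets borel" if "j < n" for n j
    using \<nu>[OF that] by (auto simp: real_distribution_def real_distribution_axioms_def)
  define f where "f = (\<lambda>(t, x). (1 - cos (t * x))\<^sup>2 :: real)"
  have f0: "0 \<le> f p" "f p \<le> 4" for p
  proof -
    obtain t x where p: "p = (t, x)" by (cases p)
    have "\<bar>1 - cos (t * x)\<bar> \<le> \<bar>2\<bar>" using cos_ge_minus_one[of "t * x"] cos_le_one[of "t * x"] by linarith
    then have "(1 - cos (t * x))\<^sup>2 \<le> 2\<^sup>2" using abs_le_square_iff by blast
    then show "0 \<le> f p" "f p \<le> 4" by (simp_all add: p f_def)
  qed
  have bmf: "bdd_meas (N \<Otimes>\<^sub>M \<nu> n j) f" if "j < n" for n j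
  proof (rule bdd_measI[where C=4])
    have [measurable_cong]: "sets (\<nu> n j) = sets borel" by (rule setsv[OF that])
    show "f \<in> borel_measurable (N \<Otimes>\<^sub>M \<nu> n j)" unfolding f_def by measurable
  qed (use f0 in auto)
  define u where "u n t = (\<Sum>j<n. \<integral>x. f (t, x) \<partial>\<nu> n j)" for n t
  have u: "bdd_meas N (u n)" for n
    unfolding u_def by (intro bdd_meas_sum bdd_meas_integral bmf pv) auto
  have [measurable]: "u n \<in> borel_measurable N" for n using u by (auto simp: bdd_meas_def)
  have u0: "0 \<le> u n t" for n t unfolding u_def by (intro sum_nonneg integral_nonneg_AE AE_I2 f0)
  have u_lim: "(\<lambda>n. u n t) \<longlonglongrightarrow> 0" for t using lim[of t] by (simp add: u_def f_def)
  define w where "w n t = (if u n t \<le> 1 then 1 else 0 :: real)" for n t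
  have [measurable]: "w n \<in> borel_measurable N" for n unfolding w_def by measurable
  have w: "bdd_meas N (w n)" for n
    by (intro bdd_measI[where C=1]) (auto simp: w_def)
  define \<alpha> where "\<alpha> n = (\<integral>t. w n t * u n t \<partial>N)" for n
  define \<beta> where "\<beta> n = (\<integral>t. 1 - w n t \<partial>N)" for n
  have w_lim: "(\<lambda>n. w n t) \<longlonglongrightarrow> 1" for t
  proof (rule tendsto_eventually)
    have "\<forall>\<^sub>F n in sequentially. u n t < 1" using order_tendstoD(2)[OF u_lim, of 1] by simp
    then show "\<forall>\<^sub>F n in sequentially. w n t = 1" by eventually_elim (simp add: w_def)
  qed
  have \<alpha>: "\<alpha> \<longlonglongrightarrow> 0"
  proof -
    have "(\<lambda>n. \<integral>t. w n t * u n t \<partial>N) \<longlonglongrightarrow> (\<integral>t. 0 \<partial>N)"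
    proof (rule integral_dominated_convergence[where w="\<lambda>_. 1"])
      show "AE t in N. (\<lambda>n. w n t * u n t) \<longlonglongrightarrow> 0"
        using tendsto_mult[OF w_lim u_lim] by simp
      show "AE t in N. norm (w n t * u n t) \<le> 1" for n
        using u0 by (intro AE_I2) (auto simp: w_def)
    qed auto
    then show ?thesis by (simp add: \<alpha>_def[abs_def])
  qed
  have \<beta>: "\<beta> \<longlonglongrightarrow> 0"
  proof -
    have "(\<lambda>n. \<integral>t. 1 - w n t \<partial>N) \<longlonglongrightarrow> (\<integral>t. 0 \<partial>N)"
    proof (rule integral_dominated_convergence[where w="\<lambda>_. 1"])
      show "AE t in N. (\<lambda>n. 1 - w n t) \<longlonglongrightarrow> 0"
        using tendsto_diff[OF tendsto_const w_lim, of 1] by simp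
      show "AE t in N. norm (1 - w n t) \<le> 1" for n
        by (intro AE_I2) (auto simp: w_def)
    qed auto
    then show ?thesis by (simp add: \<beta>_def[abs_def])
  qed
  \<comment> \<open>For fixed \<open>x\<close> beyond \<open>\<epsilon>\<close>, discarding the
    \<open>t\<close> with \<open>w n t = 0\<close> costs at most \<open>4 * \<beta> n\<close>,
    because \<open>f <= 4\<close>. Fubini then turns the sum over \<open>j\<close> into the average
    of \<open>w n t * u n t\<close>.\<close>
  have main: "(1 / 4 - 4 * \<beta> n) * ?tail n \<le> \<alpha> n" for n
  proof -
    have "(1 / 4 - 4 * \<beta> n) * measure (\<nu> n j) {x. \<bar>x\<bar> > \<epsilon>} \<le> (\<integral>t. w n t * (\<integral>x. f (t, x) \<partial>\<nu> n j) \<partial>N)" if j: "j < n" for j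
    proof -
      interpret V: prob_space "\<nu> n j" by (rule pv[OF j])
      interpret P: pair_prob_space N "\<nu> n j" ..
      have [measurable_cong]: "sets (\<nu> n j) = sets borel" by (rule setsv[OF j])
      have [measurable]: "f \<in> borel_measurable (N \<Otimes>\<^sub>M \<nu> n j)" using bmf[OF j] by (auto simp: bdd_meas_def)
      have wf: "bdd_meas (N \<Otimes>\<^sub>M \<nu> n j) (\<lambda>p. w n (fst p) * f p)"
        by (intro bdd_meas_mult bmf j bdd_meas_compose[OF w]) measurable
      have wf': "bdd_meas (\<nu> n j \<Otimes>\<^sub>M N) (\<lambda>p. w n (snd p) * f (snd p, fst p))"
        using bdd_meas_compose[OF wf measurable_pair_swap'] by (simp add: case_prod_beta')
      have ff: "bdd_meas N (\<lambda>t. f (t, x))" for x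
      proof (rule bdd_measI[where C=4])
        show "(\<lambda>t. f (t, x)) \<in> borel_measurable N" unfolding f_def by simp
      qed (use f0 in auto)
      have "(1 / 4 - 4 * \<beta> n) * measure (\<nu> n j) {x. \<bar>x\<bar> > \<epsilon>} = (\<integral>x. (1 / 4 - 4 * \<beta> n) * indicator {x. \<bar>x\<bar> > \<epsilon>} x \<partial>\<nu> n j)"
        using setsv[OF j] sets_eq_imp_space_eq[OF setsv[OF j]] by simp
      also have "\<dots> \<le> (\<integral>x. (\<integral>t. w n t * f (t, x) \<partial>N) \<partial>\<nu> n j)"
      proof (rule integral_mono)
        show "integrable (\<nu> n j) (\<lambda>x. (1 / 4 - 4 * \<beta> n) * indicator {x. \<bar>x\<bar> > \<epsilon>} x)"
          by (intro bdd_meas_integrable[OF pv[OF j]] bdd_meas_mult bdd_meas_const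
              bdd_measI[where C=1 and f="indicator {x. \<bar>x\<bar> > \<epsilon>}"]) (auto simp: indicator_def)
        show "integrable (\<nu> n j) (\<lambda>x. \<integral>t. w n t * f (t, x) \<partial>N)"
          using bdd_meas_integrable[OF pv[OF j] bdd_meas_integral[OF prob_space_averaging wf']] by simp
        fix x
        have pos: "0 \<le> (\<integral>t. w n t * f (t, x) \<partial>N)"
          by (intro integral_nonneg_AE AE_I2 mult_nonneg_nonneg f0) (auto simp: w_def)
        show "(1 / 4 - 4 * \<beta> n) * indicator {x. \<bar>x\<bar> > \<epsilon>} x \<le> (\<integral>t. w n t * f (t, x) \<partial>N)"
        proof (cases "\<bar>x\<bar> > \<epsilon>")
          case True
          have "1 / 4 - 4 * \<beta> n \<le> (\<integral>t. f (t, x) \<partial>N) - (\<integral>t. 4 * (1 - w n t) \<partial>N)"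
            using average_cos_sq_ge[OF True] unfolding f_def \<beta>_def integral_mult_right_zero by simp
          also have "\<dots> = (\<integral>t. f (t, x) - 4 * (1 - w n t) \<partial>N)"
            by (intro Bochner_Integration.integral_diff[symmetric] intN
               bdd_meas_mult bdd_meas_diff bdd_meas_const ff w)
          also have "\<dots> \<le> (\<integral>t. w n t * f (t, x) \<partial>N)"
            by (intro integral_mono intN
               bdd_meas_mult bdd_meas_diff bdd_meas_const ff w) (use f0 in \<open>auto simp: w_def\<close>)
          finally show ?thesis using True by simp
        qed (use pos in simp)
      qed
      also have "\<dots> = (\<integral>t. (\<integral>x. w n t * f (t, x) \<partial>\<nu> n j) \<partial>N)"
        using P.Fubini_integral[of "\<lambda>t x. w n t * f (t, x)"] bdd_meas_integrable[OF P.prob_space_axioms wf]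
        by (simp add: case_prod_beta')
      finally show ?thesis by simp
    qed
    then have "(1 / 4 - 4 * \<beta> n) * ?tail n \<le> (\<Sum>j<n. \<integral>t. w n t * (\<integral>x. f (t, x) \<partial>\<nu> n j) \<partial>N)"
      unfolding sum_distrib_left by (intro sum_mono) auto
    also have "\<dots> = (\<integral>t. (\<Sum>j<n. w n t * (\<integral>x. f (t, x) \<partial>\<nu> n j)) \<partial>N)"
      by (intro Bochner_Integration.integral_sum[symmetric] intN
         bdd_meas_mult w bdd_meas_integral bmf pv) auto
    also have "\<dots> = \<alpha> n" by (simp add: \<alpha>_def u_def sum_distrib_left)
    finally show ?thesis .
  qed
  \<comment> \<open>Once \<open>\<beta> n < 1/32\<close>, the prefactor
    \<open>1/4 - 4 * \<beta> n\<close> is at least 1/8, hence the bound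
    \<open>8 * \<alpha> n\<close>.\<close>
  show ?thesis
  proof (rule tendsto_sandwich[where f="\<lambda>_. 0" and h="\<lambda>n. 8 * \<alpha> n"])
    show "\<forall>\<^sub>F n in sequentially. 0 \<le> ?tail n" by (simp add: sum_nonneg)
    have "\<forall>\<^sub>F n in sequentially. \<beta> n < 1 / 32" using order_tendstoD(2)[OF \<beta>, of "1 / 32"] by simp
    then show "\<forall>\<^sub>F n in sequentially. ?tail n \<le> 8 * \<alpha> n"
    proof eventually_elim
      case (elim n)
      have "(1 / 8) * ?tail n \<le> (1 / 4 - 4 * \<beta> n) * ?tail n"
        using elim by (intro mult_right_mono sum_nonneg) auto
      with main[of n] show ?case by simp
    qed
  qed (use \<alpha> tendsto_mult[OF tendsto_const \<alpha>, of 8] in auto)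
qed

end

text \<open>Large values are sent to 0, not clamped to the endpoints; the map remains odd, so it has
  mean zero under a symmetric law.\<close>

definition trunc :: "real \<Rightarrow> real \<Rightarrow> real" where
  "trunc \<epsilon> x = (if \<bar>x\<bar> \<le> \<epsilon> then x else 0)"

lemma trunc_measurable [measurable]: "trunc \<epsilon> \<in> borel_measurable borel"
  unfolding trunc_def by measurable

lemma abs_trunc_le: "0 \<le> \<epsilon> \<Longrightarrow> \<bar>trunc \<epsilon> x\<bar> \<le> \<epsilon>"
  by (simp add: trunc_def)

text \<open>Real characteristic functions near 1 convert the limit of the product into one for the
  sums of \<open>p t n j = E (1 - cos (t * x))\<close>. Tails follow from all \<open>t\<close>
  together; the truncated variance is then read off at \<open>t = 1\<close>, where
  \<open>2 * (1 - cos x)\<close> agrees with the truncated square up to a relative error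
  \<open>\<epsilon> / 3\<close> and the tail indicator.\<close>

lemma triangular_array_normal_limit:
  fixes \<nu> :: "nat \<Rightarrow> nat \<Rightarrow> real measure"
  assumes \<nu>: "\<And>n j. j < n \<Longrightarrow> real_distribution (\<nu> n j)"
    and char_eq: "\<And>n j t. j < n \<Longrightarrow> char (\<nu> n j) t = of_real (\<integral>x. cos (t * x) \<partial>\<nu> n j)"
    and lim: "\<And>t. (\<lambda>n. \<Prod>j<n. char (\<nu> n j) t) \<longlonglongrightarrow> of_real (exp (- (t\<^sup>2) / 2))"
    and small: "\<And>J t. (\<forall>n>0. J n < n) \<Longrightarrow> (\<lambda>n. char (\<nu> n (J n)) t) \<longlonglongrightarrow> 1"
    and \<epsilon>: "0 < \<epsilon>" "\<epsilon> \<le> 1"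
  shows "\<forall>\<^sub>F n in sequentially. (\<Sum>j<n. measure (\<nu> n j) {x. \<bar>x\<bar> > \<epsilon>}) \<le> \<epsilon> \<and>
           \<bar>(\<Sum>j<n. \<integral>x. (trunc \<epsilon> x)\<^sup>2 \<partial>\<nu> n j) - 1\<bar> \<le> \<epsilon>"
proof -
  have pv: "prob_space (\<nu> n j)" and setsv: "sets (\<nu> n j) = sets borel" if "j < n" for n j
    using \<nu>[OF that] by (auto simp: real_distribution_def real_distribution_axioms_def)
  have cosb: "bdd_meas (\<nu> n j) (\<lambda>x. cos (t * x))" if "j < n" for n j t
  proof (rule bdd_measI[where C=1])
    have [measurable_cong]: "sets (\<nu> n j) = sets borel" by (rule setsv[OF that])
    show "(\<lambda>x. cos (t * x)) \<in> borel_measurable (\<nu> n j)" by measurable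
  qed auto
  note int = bdd_meas_integrable[OF pv]
  define p where "p t n j = 1 - (\<integral>x. cos (t * x) \<partial>\<nu> n j)" for t n j
  have p_eq: "(\<integral>x. 1 - cos (t * x) \<partial>\<nu> n j) = p t n j" if "j < n" for t n j
  proof -
    interpret prob_space "\<nu> n j" by (rule pv[OF that])
    show ?thesis using int[OF that cosb[OF that]] by (simp add: p_def prob_space)
  qed
  have p0: "0 \<le> p t n j" if "j < n" for t n j
    unfolding p_eq[OF that, symmetric] by (intro integral_nonneg_AE AE_I2) simp
  have sum_p: "(\<lambda>n. \<Sum>j<n. p t n j) \<longlonglongrightarrow> t\<^sup>2 / 2" for t
  proof (rule tendsto_sum_of_prod)
    show "\<And>n j. j < n \<Longrightarrow> 0 \<le> p t n j" by (rule p0)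
    show "\<forall>\<^sub>F n in sequentially. \<forall>j<n. p t n j < e" if e: "e > 0" for e
    proof (rule eventually_all_indices)
      fix J :: "nat \<Rightarrow> nat" assume J: "\<forall>n>0. J n < n"
      have "\<forall>\<^sub>F n in sequentially. dist (char (\<nu> n (J n)) t) 1 < e"
        using small[OF J] e by (rule tendstoD)
      then show "\<forall>\<^sub>F n in sequentially. p t n (J n) < e"
        using eventually_gt_at_top[of 0]
      proof eventually_elim
        case (elim n)
        have "char (\<nu> n (J n)) t - 1 = of_real (- p t n (J n))"
          using J elim by (simp add: char_eq p_def)
        then have "dist (char (\<nu> n (J n)) t) 1 = \<bar>p t n (J n)\<bar>"
          unfolding dist_norm by (simp del: of_real_minus)
        with elim show ?case by simp
      qed
    qed
    have "(\<lambda>n. \<Prod>j<n. char (\<nu> n j) t) = (\<lambda>n. of_real (\<Prod>j<n. 1 - p t n j))"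
      unfolding of_real_prod by (intro ext prod.cong refl) (simp add: char_eq p_def)
    with lim[of t] show "(\<lambda>n. \<Prod>j<n. 1 - p t n j) \<longlonglongrightarrow> exp (- (t\<^sup>2 / 2))"
      by (simp only: tendsto_of_real_iff minus_divide_left)
  qed
  \<comment> \<open>By \<open>(1 - cos s)^2 = 2 * (1 - cos s) - (1 - cos (2 * s)) / 2\<close>, the
    limit is \<open>t^2 - (2 * t)^2 / 4 = 0\<close>. The quadratic form of the Gaussian exponent is
    what makes it vanish.\<close>
  have sq: "(\<lambda>n. \<Sum>j<n. \<integral>x. (1 - cos (t * x))\<^sup>2 \<partial>\<nu> n j) \<longlonglongrightarrow> 0" for t
  proof -
    have "(\<integral>x. (1 - cos (t * x))\<^sup>2 \<partial>\<nu> n j) = 2 * p t n j - p (2 * t) n j / 2" if j: "j < n" for n j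
    proof -
      have "(1 - cos (t * x))\<^sup>2 = 2 * (1 - cos (t * x)) - (1 - cos (2 * t * x)) / 2" for x
      proof -
        have "cos (2 * t * x) = 2 * (cos (t * x) * cos (t * x)) - 1"
          using cos_double_cos[of "t * x"] by (simp add: power2_eq_square mult.assoc)
        then show ?thesis unfolding power2_eq_square by (simp only:) (simp add: algebra_simps diff_divide_distrib)
      qed
      then have "(\<integral>x. (1 - cos (t * x))\<^sup>2 \<partial>\<nu> n j) = (\<integral>x. 2 * (1 - cos (t * x)) - (1 - cos (2 * t * x)) / 2 \<partial>\<nu> n j)"
        by (simp only:)
      also have "\<dots> = (\<integral>x. 2 * (1 - cos (t * x)) \<partial>\<nu> n j) - (\<integral>x. (1 - cos (2 * t * x)) / 2 \<partial>\<nu> n j)"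
        using int[OF j cosb[OF j]] prob_space.finite_measure[OF pv[OF j]]
        by (intro Bochner_Integration.integral_diff) (auto simp: finite_measure.integrable_const)
      finally show ?thesis by (simp only: integral_mult_right_zero integral_divide_zero p_eq[OF j])
    qed
    then have "(\<lambda>n. \<Sum>j<n. \<integral>x. (1 - cos (t * x))\<^sup>2 \<partial>\<nu> n j) = (\<lambda>n. 2 * (\<Sum>j<n. p t n j) - (\<Sum>j<n. p (2 * t) n j) / 2)"
      by (simp add: sum_subtractf sum_distrib_left sum_divide_distrib)
    moreover have "(\<lambda>n. 2 * (\<Sum>j<n. p t n j) - (\<Sum>j<n. p (2 * t) n j) / 2) \<longlonglongrightarrow> 2 * (t\<^sup>2 / 2) - ((2 * t)\<^sup>2 / 2) / 2"
      by (intro tendsto_intros sum_p) auto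
    ultimately show ?thesis by (simp add: power_mult_distrib)
  qed
  have tail: "(\<lambda>n. \<Sum>j<n. measure (\<nu> n j) {x. \<bar>x\<bar> > \<epsilon>}) \<longlonglongrightarrow> 0"
    by (rule tail_sum_tendsto_0[OF \<epsilon>(1) \<nu> sq])
  define c where "c n = (\<Sum>j<n. p 1 n j)" for n
  have c: "c \<longlonglongrightarrow> 1 / 2" using sum_p[of 1] by (simp add: c_def[abs_def])
  have "\<forall>\<^sub>F n in sequentially. (\<Sum>j<n. measure (\<nu> n j) {x. \<bar>x\<bar> > \<epsilon>}) < \<epsilon> / 8"
    using tail \<epsilon> by (intro order_tendstoD) auto
  moreover have "\<forall>\<^sub>F n in sequentially. 2 * c n > 1 - \<epsilon> / 8"
    using order_tendstoD(1)[OF tendsto_mult[OF tendsto_const c, of 2], of "1 - \<epsilon> / 8"] \<epsilon> by simp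
  moreover have "\<forall>\<^sub>F n in sequentially. 2 * c n < 1 + \<epsilon> / 8"
    using order_tendstoD(2)[OF tendsto_mult[OF tendsto_const c, of 2], of "1 + \<epsilon> / 8"] \<epsilon> by simp
  ultimately show ?thesis
  proof eventually_elim
    case (elim n)
    let ?tl = "\<Sum>j<n. measure (\<nu> n j) {x. \<bar>x\<bar> > \<epsilon>}"
    let ?s = "\<Sum>j<n. \<integral>x. (trunc \<epsilon> x)\<^sup>2 \<partial>\<nu> n j"
    have trb: "bdd_meas (\<nu> n j) (\<lambda>x. (trunc \<epsilon> x)\<^sup>2)" "bdd_meas (\<nu> n j) (indicator {x. \<bar>x\<bar> > \<epsilon>} :: real \<Rightarrow> real)" if "j < n" for j
    proof -
      have [measurable_cong]: "sets (\<nu> n j) = sets borel" by (rule setsv[OF that])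
      show "bdd_meas (\<nu> n j) (\<lambda>x. (trunc \<epsilon> x)\<^sup>2)"
        by (intro bdd_meas_power2 bdd_measI[where C=\<epsilon>]) (use abs_trunc_le[of \<epsilon>] \<epsilon> in auto)
      show "bdd_meas (\<nu> n j) (indicator {x. \<bar>x\<bar> > \<epsilon>} :: real \<Rightarrow> real)"
        by (intro bdd_measI[where C=1]) (auto simp: indicator_def)
    qed
    \<comment> \<open>The first inequality uses the cubic Taylor error, at most
      \<open>\<epsilon> * x^2 / 6\<close> on the truncation range. The second uses
      \<open>2 * (1 - cos x) <= min 4 (x^2)\<close>.\<close>
    have ptw: "(1 - \<epsilon> / 3) * (trunc \<epsilon> x)\<^sup>2 \<le> 2 * (1 - cos x)"
      "2 * (1 - cos x) - 4 * indicator {x. \<bar>x\<bar> > \<epsilon>} x \<le> (trunc \<epsilon> x)\<^sup>2" for x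
    proof -
      have "1 - cos x = 2 * (sin (x / 2))\<^sup>2" using cos_double_sin[of "x / 2"] by simp
      also have "\<dots> \<le> 2 * (x / 2)\<^sup>2"
        using iffD1[OF abs_le_square_iff abs_sin_x_le_abs_x[of "x / 2"]] by simp
      finally have 1: "2 * (1 - cos x) \<le> x\<^sup>2" by (simp add: power_divide)
      have 2: "0 \<le> 1 - cos x" "1 - cos x \<le> 2" using cos_ge_minus_one[of x] cos_le_one[of x] by linarith+
      show "2 * (1 - cos x) - 4 * indicator {x. \<bar>x\<bar> > \<epsilon>} x \<le> (trunc \<epsilon> x)\<^sup>2"
        using 1 2 by (simp add: trunc_def indicator_def)
      show "(1 - \<epsilon> / 3) * (trunc \<epsilon> x)\<^sup>2 \<le> 2 * (1 - cos x)"
      proof (cases "\<bar>x\<bar> \<le> \<epsilon>")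
        case True
        have "\<bar>x\<bar> ^ 3 = \<bar>x\<bar> * x\<^sup>2" by (simp add: power3_eq_cube power2_eq_square)
        also have "\<dots> \<le> \<epsilon> * x\<^sup>2" using True by (intro mult_right_mono) auto
        finally have "\<bar>x\<bar> ^ 3 / 6 \<le> \<epsilon> * x\<^sup>2 / 6" by simp
        from order_trans[OF abs_le_D1[OF cos_approx[of x]] this]
        have "x\<^sup>2 - \<epsilon> * x\<^sup>2 / 3 \<le> 2 * (1 - cos x)" by (simp add: field_simps)
        then show ?thesis using True by (simp add: trunc_def left_diff_distrib)
      qed (use 2 in \<open>simp add: trunc_def\<close>)
    qed
    have b1: "(1 - \<epsilon> / 3) * ?s \<le> 2 * c n"
      unfolding c_def sum_distrib_left
    proof (rule sum_mono)
      fix j assume "j \<in> {..<n}"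
      then have j: "j < n" by simp
      have "(1 - \<epsilon> / 3) * (\<integral>x. (trunc \<epsilon> x)\<^sup>2 \<partial>\<nu> n j) = (\<integral>x. (1 - \<epsilon> / 3) * (trunc \<epsilon> x)\<^sup>2 \<partial>\<nu> n j)" by simp
      also have "\<dots> \<le> (\<integral>x. 2 * (1 - cos (1 * x)) \<partial>\<nu> n j)"
        by (intro integral_mono int[OF j] bdd_meas_mult bdd_meas_diff bdd_meas_const trb j cosb)
           (use ptw(1) in simp)
      also have "\<dots> = 2 * p 1 n j" unfolding integral_mult_right_zero p_eq[OF j] ..
      finally show "(1 - \<epsilon> / 3) * (\<integral>x. (trunc \<epsilon> x)\<^sup>2 \<partial>\<nu> n j) \<le> 2 * p 1 n j" .
    qed
    have b2: "2 * c n - 4 * ?tl \<le> ?s"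
      unfolding c_def sum_distrib_left sum_subtractf[symmetric]
    proof (rule sum_mono)
      fix j assume "j \<in> {..<n}"
      then have j: "j < n" by simp
      have m: "(\<integral>x. indicator {x. \<bar>x\<bar> > \<epsilon>} x \<partial>\<nu> n j) = measure (\<nu> n j) {x. \<bar>x\<bar> > \<epsilon>}"
        using setsv[OF j] sets_eq_imp_space_eq[OF setsv[OF j]] by simp
      have "2 * p 1 n j - 4 * measure (\<nu> n j) {x. \<bar>x\<bar> > \<epsilon>} = (\<integral>x. 2 * (1 - cos (1 * x)) \<partial>\<nu> n j) - (\<integral>x. 4 * indicator {x. \<bar>x\<bar> > \<epsilon>} x \<partial>\<nu> n j)"
        unfolding integral_mult_right_zero p_eq[OF j] m ..
      also have "\<dots> = (\<integral>x. 2 * (1 - cos (1 * x)) - 4 * indicator {x. \<bar>x\<bar> > \<epsilon>} x \<partial>\<nu> n j)"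
        by (intro Bochner_Integration.integral_diff[symmetric] int[OF j] bdd_meas_mult bdd_meas_diff bdd_meas_const trb j cosb)
      also have "\<dots> \<le> (\<integral>x. (trunc \<epsilon> x)\<^sup>2 \<partial>\<nu> n j)"
        by (intro integral_mono int[OF j] bdd_meas_mult bdd_meas_diff bdd_meas_const trb j cosb)
           (use ptw(2) in simp)
      finally show "2 * p 1 n j - 4 * measure (\<nu> n j) {x. \<bar>x\<bar> > \<epsilon>} \<le> (\<integral>x. (trunc \<epsilon> x)\<^sup>2 \<partial>\<nu> n j)" .
    qed
    \<comment> \<open>The margins fit since \<open>(1 - \<epsilon> / 3) * (1 + \<epsilon>) >= 1 +
      \<epsilon> / 3\<close> for \<open>\<epsilon> <= 1\<close>; on the other side
      \<open>\<epsilon> / 8 + 4 * \<epsilon> / 8\<close> stays below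
      \<open>\<epsilon>\<close>.\<close>
    have "?s \<le> 1 + \<epsilon>"
    proof (rule ccontr)
      assume "\<not> ?s \<le> 1 + \<epsilon>"
      then have "(1 - \<epsilon> / 3) * (1 + \<epsilon>) \<le> (1 - \<epsilon> / 3) * ?s" using \<epsilon> by (intro mult_left_mono) auto
      also have "\<dots> < 1 + \<epsilon> / 8" using b1 elim by linarith
      finally have "\<epsilon> * (2 / 3 - 1 / 8 - \<epsilon> / 3) < 0" by (simp add: field_simps)
      moreover have "0 < \<epsilon> * (2 / 3 - 1 / 8 - \<epsilon> / 3)" using \<epsilon> by (intro mult_pos_pos) auto
      ultimately show False by simp
    qed
    moreover have "1 - \<epsilon> \<le> ?s" using b2 elim by linarith
    ultimately show ?case using elim \<epsilon> by (auto simp: abs_le_iff)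
  qed
qed

section \<open>The self-consistent equation\<close>

text \<open>The independent coordinates are the positions on or above the diagonal, and this map
  finds the coordinate behind an arbitrary position. For fixed \<open>i\<close> it is injective in
  \<open>j\<close>, so a full row consists of distinct independent coordinates.\<close>

definition sorted_pair :: "nat \<Rightarrow> nat \<Rightarrow> nat \<times> nat" where
  "sorted_pair i j = (min i j, max i j)"

definition upper_index :: "nat \<Rightarrow> (nat \<times> nat) set" where
  "upper_index n = {(i, j). i \<le> j \<and> j < n}"

definition sym_of :: "(nat \<times> nat \<Rightarrow> real) \<Rightarrow> nat \<Rightarrow> nat \<Rightarrow> real" where
  "sym_of x i j = x (sorted_pair i j)"

lemma finite_upper_index [simp]: "finite (upper_index n)"
  by (rule finite_subset[of _ "{..<n} \<times> {..<n}"]) (auto simp: upper_index_def)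

lemma sorted_pair_in_upper_index: "i < n \<Longrightarrow> j < n \<Longrightarrow> sorted_pair i j \<in> upper_index n"
  by (auto simp: sorted_pair_def upper_index_def)

lemma sorted_pair_commute: "sorted_pair i j = sorted_pair j i"
  by (simp add: sorted_pair_def min.commute max.commute)

lemma sorted_pair_eq_iff: "sorted_pair i j = sorted_pair i k \<longleftrightarrow> j = k"
  by (auto simp: sorted_pair_def min_def max_def split: if_splits)

lemma symmetric_sym_of: "symmetric_upto n (sym_of x)"
  by (auto simp: symmetric_upto_def sym_of_def sorted_pair_commute)

lemma sym_of_measurable:
  assumes sets_\<mu>: "\<And>p. sets (\<mu> p) = sets borel" and ij: "i < n" "j < n"
  shows "(\<lambda>x. sym_of x i j) \<in> borel_measurable (Pi\<^sub>M (upper_index n) \<mu>)"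
  using measurable_component_singleton[OF sorted_pair_in_upper_index[OF ij], of \<mu>]
    measurable_cong_sets[OF refl sets_\<mu>[of "sorted_pair i j"], of "Pi\<^sub>M (upper_index n) \<mu>"]
  by (simp add: sym_of_def)

lemma bdd_meas_resolvent:
  assumes sets_\<mu>: "\<And>p. sets (\<mu> p) = sets borel" and z: "Im z > 0" and ij: "i < n" "j < n"
  shows "bdd_meas (Pi\<^sub>M (upper_index n) \<mu>) (\<lambda>x. resolvent n (sym_of x) z i j)"
    and "bdd_meas (Pi\<^sub>M (upper_index n) \<mu>) (\<lambda>x. resolvent n (zero_row l (sym_of x)) z i j)"
proof -
  show "bdd_meas (Pi\<^sub>M (upper_index n) \<mu>) (\<lambda>x. resolvent n (sym_of x) z i j)"
    using resolvent_bound[OF symmetric_sym_of z ij] ij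
    by (intro bdd_measI[where C="1 / Im z"] borel_measurable_resolvent sym_of_measurable[OF sets_\<mu>])
  have "(\<lambda>x. zero_row l (sym_of x) a b) \<in> borel_measurable (Pi\<^sub>M (upper_index n) \<mu>)" if "a < n" "b < n" for a b
    using sym_of_measurable[OF sets_\<mu> that] by (simp add: zero_row_def)
  then show "bdd_meas (Pi\<^sub>M (upper_index n) \<mu>) (\<lambda>x. resolvent n (zero_row l (sym_of x)) z i j)"
    using resolvent_bound[OF symmetric_zero_row[OF symmetric_sym_of] z ij] ij
    by (intro bdd_measI[where C="1 / Im z"] borel_measurable_resolvent)
qed

text \<open>Used to replace the resolvent of the matrix without row \<open>i\<close> by the full one
  in a variance-weighted sum: small weights against the summable error of
  \<open>resolvent_diag_diff_sum\<close>.\<close>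

lemma sum_offdiag_weights:
  fixes v :: "nat \<Rightarrow> real" and w :: "nat \<Rightarrow> complex"
  assumes "\<And>k. k \<in> K \<Longrightarrow> 0 \<le> v k" "\<And>k. k \<in> K \<Longrightarrow> v k \<le> c" "(\<Sum>k\<in>K. cmod (w k)) \<le> d" "0 \<le> c"
  shows "cmod (\<Sum>k\<in>K. of_real (v k) * w k) \<le> c * d"
proof -
  have "cmod (\<Sum>k\<in>K. of_real (v k) * w k) \<le> (\<Sum>k\<in>K. c * cmod (w k))"
    using assms by (intro sum_norm_le) (auto simp: norm_mult intro: mult_right_mono)
  also have "\<dots> \<le> c * d" using assms by (simp add: sum_distrib_left[symmetric] mult_left_mono)
  finally show ?thesis .
qed

section \<open>Expansion of one diagonal entry\<close>

context
  fixes n :: nat and \<mu> :: "nat \<times> nat \<Rightarrow> real measure" and \<epsilon> :: real and z m :: complex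
    and v :: "nat \<times> nat \<Rightarrow> real"
  assumes \<mu>: "\<And>p. prob_space (\<mu> p)" and sets_\<mu>: "\<And>p. sets (\<mu> p) = sets borel"
    and \<epsilon>: "0 < \<epsilon>" "\<epsilon> \<le> 1" and z: "Im z = 2"
    and m: "m * (- z - m) = 1" "cmod m \<le> 1 / 2"
    and centred: "\<And>p. p \<in> upper_index n \<Longrightarrow> (\<integral>x. trunc \<epsilon> x \<partial>\<mu> p) = 0"
    and tail: "\<And>i. i < n \<Longrightarrow> (\<Sum>j<n. measure (\<mu> (sorted_pair i j)) {x. \<bar>x\<bar> > \<epsilon>}) \<le> \<epsilon>"
  defines "v \<equiv> \<lambda>p. \<integral>x. (trunc \<epsilon> x)\<^sup>2 \<partial>\<mu> p"
  assumes var: "\<And>i. i < n \<Longrightarrow> \<bar>(\<Sum>j<n. v (sorted_pair i j)) - 1\<bar> \<le> \<epsilon>"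
begin

lemma trunc_bound: "\<bar>trunc \<epsilon> x\<bar> \<le> \<epsilon>"
  using \<epsilon> by (simp add: abs_trunc_le)

lemma row_variance_nonneg: "0 \<le> v p"
  unfolding v_def by (intro integral_nonneg_AE AE_I2) auto

lemma row_variance_le: "v p \<le> \<epsilon>\<^sup>2"
proof -
  interpret prob_space "\<mu> p" by (rule \<mu>)
  have [measurable_cong]: "sets (\<mu> p) = sets borel" by (rule sets_\<mu>)
  have b: "(trunc \<epsilon> x)\<^sup>2 \<le> \<epsilon>\<^sup>2" for x using power_mono[OF trunc_bound[of x], of 2] by simp
  show ?thesis unfolding v_def
    by (intro integral_le_const AE_I2 b integrable_const_bound[where B="\<epsilon>\<^sup>2"]) (use b in auto)
qed

text \<open>Here \<open>B\<close> plays the matrix with row \<open>i\<close> removed, frozen by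
  conditioning. Real and imaginary parts are real quadratic forms in the row, handled by
  \<open>variance_quadratic_form\<close> and recombined through \<open>cmod_power2\<close>.\<close>

lemma row_quadratic_form:
  fixes B :: "nat \<Rightarrow> nat \<Rightarrow> real" and i :: nat
  defines "K \<equiv> {..<n} - {i}" and "G \<equiv> resolvent n B z"
  assumes B: "symmetric_upto n B" and i: "i < n"
  shows "(\<integral>x. (cmod ((\<Sum>k\<in>K. \<Sum>l\<in>K. of_real (trunc \<epsilon> (x (sorted_pair i k))) * of_real (trunc \<epsilon> (x (sorted_pair i l))) * G l k)
       - (\<Sum>k\<in>K. of_real (v (sorted_pair i k)) * G k k)))\<^sup>2 \<partial>Pi\<^sub>M (sorted_pair i ` K) \<mu>) \<le> 5 * \<epsilon>\<^sup>2"
proof -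
  let ?e = "sorted_pair i" and ?h = "trunc \<epsilon>"
  define J where "J = ?e ` K"
  \<comment> \<open>Inverse of \<open>sorted_pair i\<close>: recovers the partner of
    \<open>i\<close> from the coordinate.\<close>
  define oth where "oth p = (if fst p = i then snd p else fst p)" for p :: "nat \<times> nat"
  have oth: "oth (?e k) = k" for k by (auto simp: oth_def sorted_pair_def min_def max_def)
  have inj: "inj_on ?e K" by (auto simp: inj_on_def sorted_pair_eq_iff)
  have J: "finite J" "J \<subseteq> upper_index n"
    using i by (auto simp: J_def K_def intro: sorted_pair_in_upper_index)
  have reidx: "(\<Sum>k\<in>K. F k (?e k)) = (\<Sum>p\<in>J. F (oth p) p)" for F :: "nat \<Rightarrow> nat \<times> nat \<Rightarrow> real"
    unfolding J_def by (subst sum.reindex[OF inj]) (simp add: oth)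
  define Q where "Q a x = (\<Sum>p\<in>J. \<Sum>q\<in>J. ?h (x p) * ?h (x q) * a p q) - (\<Sum>p\<in>J. v p * a p p)"
    for a :: "nat \<times> nat \<Rightarrow> nat \<times> nat \<Rightarrow> real" and x :: "nat \<times> nat \<Rightarrow> real"
  define ar where "ar p q = Re (G (oth q) (oth p))" for p q
  define ai where "ai p q = Im (G (oth q) (oth p))" for p q
  have sumv: "(\<Sum>p\<in>J. v p) \<le> 2"
  proof -
    have "(\<Sum>p\<in>J. v p) = (\<Sum>k\<in>K. v (?e k))" unfolding J_def by (rule sum.reindex[OF inj, unfolded comp_def])
    also have "\<dots> \<le> (\<Sum>j<n. v (?e j))" by (intro sum_mono2) (auto simp: K_def row_variance_nonneg)
    also have "\<dots> \<le> 2" using var[OF i] \<epsilon> by (simp add: abs_le_iff)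
    finally show ?thesis .
  qed
  have othK: "oth p < n" if "p \<in> J" for p using that by (auto simp: J_def oth K_def)
  have z': "Im z > 0" using z by simp
  have symG: "G (oth p) (oth q) = G (oth q) (oth p)" if "p \<in> J" "q \<in> J" for p q
    unfolding G_def using resolvent_sym[OF B, of z] z othK that by simp
  have cmodQ: "(cmod ((\<Sum>k\<in>K. \<Sum>l\<in>K. of_real (?h (x (?e k))) * of_real (?h (x (?e l))) * G l k)
       - (\<Sum>k\<in>K. of_real (v (?e k)) * G k k)))\<^sup>2 = (Q ar x)\<^sup>2 + (Q ai x)\<^sup>2" for x
  proof -
    have "(\<Sum>k\<in>K. \<Sum>l\<in>K. ?h (x (?e k)) * ?h (x (?e l)) * Re (G l k)) - (\<Sum>k\<in>K. v (?e k) * Re (G k k)) = Q ar x"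
      unfolding Q_def ar_def
      by (subst reidx[symmetric, of "\<lambda>k p. \<Sum>q\<in>J. ?h (x p) * ?h (x q) * Re (G (oth q) k)"],
          subst reidx[symmetric, of "\<lambda>k p. v p * Re (G k k)"],
          subst reidx[symmetric, of "\<lambda>l q. ?h (x (?e _)) * ?h (x q) * Re (G l _)"]) simp
    moreover have "(\<Sum>k\<in>K. \<Sum>l\<in>K. ?h (x (?e k)) * ?h (x (?e l)) * Im (G l k)) - (\<Sum>k\<in>K. v (?e k) * Im (G k k)) = Q ai x"
      unfolding Q_def ai_def
      by (subst reidx[symmetric, of "\<lambda>k p. \<Sum>q\<in>J. ?h (x p) * ?h (x q) * Im (G (oth q) k)"],
          subst reidx[symmetric, of "\<lambda>k p. v p * Im (G k k)"],
          subst reidx[symmetric, of "\<lambda>l q. ?h (x (?e _)) * ?h (x q) * Im (G l _)"]) simp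
    ultimately show ?thesis unfolding cmod_power2 by (simp add: of_real_mult[symmetric] del: of_real_mult)
  qed
  have pJ: "prob_space (Pi\<^sub>M J \<mu>)" by (intro prob_space_PiM \<mu>)
  have bmh: "bdd_meas (Pi\<^sub>M J \<mu>) (\<lambda>x. ?h (x p))" if "p \<in> J" for p
    by (rule bdd_meas_truncation_PiM[where J=J and \<epsilon>=\<epsilon>]) (use \<mu> sets_\<mu> J trunc_bound centred that in auto)
  have bmQ: "bdd_meas (Pi\<^sub>M J \<mu>) (Q a)" for a
    unfolding Q_def by (intro bdd_meas_diff bdd_meas_sum bdd_meas_mult bdd_meas_const bmh)
  have vq: "(\<integral>x. (Q a x)\<^sup>2 \<partial>Pi\<^sub>M J \<mu>) \<le> 8 * (\<Sum>p\<in>J. \<Sum>q\<in>J. v p * v q * (a q p)\<^sup>2) + 2 * \<epsilon>\<^sup>2 * (\<Sum>p\<in>J. v p * (a p p)\<^sup>2)"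
    if a: "\<And>p q. p \<in> J \<Longrightarrow> q \<in> J \<Longrightarrow> a p q = a q p" for a
    unfolding Q_def v_def
    by (rule variance_quadratic_form[where J=J]) (use \<mu> sets_\<mu> J trunc_bound centred a in auto)
  have "(\<integral>x. (Q ar x)\<^sup>2 + (Q ai x)\<^sup>2 \<partial>Pi\<^sub>M J \<mu>) = (\<integral>x. (Q ar x)\<^sup>2 \<partial>Pi\<^sub>M J \<mu>) + (\<integral>x. (Q ai x)\<^sup>2 \<partial>Pi\<^sub>M J \<mu>)"
    by (intro Bochner_Integration.integral_add bdd_meas_integrable[OF pJ] bdd_meas_power2 bmQ)
  also have "\<dots> \<le> (8 * (\<Sum>p\<in>J. \<Sum>q\<in>J. v p * v q * (ar q p)\<^sup>2) + 2 * \<epsilon>\<^sup>2 * (\<Sum>p\<in>J. v p * (ar p p)\<^sup>2))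
      + (8 * (\<Sum>p\<in>J. \<Sum>q\<in>J. v p * v q * (ai q p)\<^sup>2) + 2 * \<epsilon>\<^sup>2 * (\<Sum>p\<in>J. v p * (ai p p)\<^sup>2))"
    by (intro add_mono vq) (auto simp: ar_def ai_def symG)
  also have "\<dots> = 8 * (\<Sum>p\<in>J. \<Sum>q\<in>J. v p * v q * (cmod (G (oth p) (oth q)))\<^sup>2) + 2 * \<epsilon>\<^sup>2 * (\<Sum>p\<in>J. v p * (cmod (G (oth p) (oth p)))\<^sup>2)"
    unfolding cmod_power2 ar_def ai_def by (simp add: distrib_left sum.distrib)
  \<comment> \<open>In the double sum one weight is bounded by \<open>\<epsilon>^2\<close>, the
    squared moduli of a resolvent row sum to at most 1/4, and the other weight sums to at most 2. In
    the diagonal sum \<open>\<bar>G\<bar>^2 <= 1/4\<close> meets total weight 2.\<close>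
  also have "\<dots> \<le> 8 * (\<epsilon>\<^sup>2 / 2) + 2 * \<epsilon>\<^sup>2 * (1 / 2)"
  proof (intro add_mono mult_left_mono)
    have "(\<Sum>p\<in>J. \<Sum>q\<in>J. v p * v q * (cmod (G (oth p) (oth q)))\<^sup>2) \<le> (\<Sum>p\<in>J. v p * (\<epsilon>\<^sup>2 / 4))"
    proof (rule sum_mono)
      fix p assume p: "p \<in> J"
      have "(\<Sum>q\<in>J. v q * (cmod (G (oth p) (oth q)))\<^sup>2) \<le> (\<Sum>q\<in>J. \<epsilon>\<^sup>2 * (cmod (G (oth p) (oth q)))\<^sup>2)"
        by (intro sum_mono mult_right_mono row_variance_le) auto
      also have "\<dots> = (\<Sum>k\<in>K. \<epsilon>\<^sup>2 * (cmod (G (oth p) k))\<^sup>2)"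
        by (rule reidx[of "\<lambda>k q. \<epsilon>\<^sup>2 * (cmod (G (oth p) k))\<^sup>2", symmetric])
      also have "\<dots> = \<epsilon>\<^sup>2 * (\<Sum>k\<in>K. (cmod (G (oth p) k))\<^sup>2)" by (simp add: sum_distrib_left)
      also have "\<dots> \<le> \<epsilon>\<^sup>2 * (\<Sum>k<n. (cmod (G (oth p) k))\<^sup>2)"
        by (intro mult_left_mono sum_mono2) (auto simp: K_def)
      also have "\<dots> \<le> \<epsilon>\<^sup>2 * (1 / Im z)\<^sup>2"
        unfolding G_def by (intro mult_left_mono resolvent_row_bound[OF B z' othK[OF p]]) auto
      finally have "v p * (\<Sum>q\<in>J. v q * (cmod (G (oth p) (oth q)))\<^sup>2) \<le> v p * (\<epsilon>\<^sup>2 / 4)"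
        using z by (intro mult_left_mono row_variance_nonneg) (simp add: power_divide)
      then show "(\<Sum>q\<in>J. v p * v q * (cmod (G (oth p) (oth q)))\<^sup>2) \<le> v p * (\<epsilon>\<^sup>2 / 4)"
        by (simp add: sum_distrib_left mult.assoc)
    qed
    also have "\<dots> = (\<Sum>p\<in>J. v p) * (\<epsilon>\<^sup>2 / 4)" by (simp add: sum_distrib_right)
    also have "\<dots> \<le> 2 * (\<epsilon>\<^sup>2 / 4)" using sumv by (intro mult_right_mono) auto
    finally show "(\<Sum>p\<in>J. \<Sum>q\<in>J. v p * v q * (cmod (G (oth p) (oth q)))\<^sup>2) \<le> \<epsilon>\<^sup>2 / 2" by simp
    have "(\<Sum>p\<in>J. v p * (cmod (G (oth p) (oth p)))\<^sup>2) \<le> (\<Sum>p\<in>J. v p * (1 / 4))"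
    proof (intro sum_mono mult_left_mono row_variance_nonneg)
      fix p assume p: "p \<in> J"
      have "cmod (G (oth p) (oth p)) \<le> 1 / 2"
        using resolvent_diag_bound[OF B z' othK[OF p]] z by (simp add: G_def)
      from power_mono[OF this, of 2] show "(cmod (G (oth p) (oth p)))\<^sup>2 \<le> 1 / 4" by (simp add: power_divide)
    qed
    also have "\<dots> \<le> 1 / 2" using sumv by (simp add: sum_divide_distrib[symmetric])
    finally show "(\<Sum>p\<in>J. v p * (cmod (G (oth p) (oth p)))\<^sup>2) \<le> 1 / 2" .
  qed auto
  also have "\<dots> = 5 * \<epsilon>\<^sup>2" by simp
  finally show ?thesis unfolding cmodQ J_def .
qed

abbreviation "joint_law \<equiv> Pi\<^sub>M (upper_index n) \<mu>"

lemma prob_space_joint_law: "prob_space joint_law"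
  by (intro prob_space_PiM \<mu>)

lemma bdd_meas_trunc_sym_of:
  assumes "i < n" "j < n"
  shows "bdd_meas joint_law (\<lambda>x. complex_of_real (trunc \<epsilon> (sym_of x i j)))"
proof (rule bdd_measI[where C=\<epsilon>])
  have [measurable]: "(\<lambda>x. sym_of x i j) \<in> borel_measurable joint_law" by (rule sym_of_measurable[OF sets_\<mu> assms])
  show "(\<lambda>x. complex_of_real (trunc \<epsilon> (sym_of x i j))) \<in> borel_measurable joint_law" by measurable
qed (use trunc_bound in auto)

text \<open>The quadratic form of the Schur complement with truncated off-diagonal entries of row
  \<open>i\<close>, minus its conditional mean given all other coordinates.\<close>

definition fluctuation :: "nat \<Rightarrow> (nat \<times> nat \<Rightarrow> real) \<Rightarrow> complex" where
  "fluctuation i x =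
     (\<Sum>k\<in>{..<n}-{i}. \<Sum>l\<in>{..<n}-{i}. of_real (trunc \<epsilon> (sym_of x i k)) * of_real (trunc \<epsilon> (sym_of x i l))
        * resolvent n (zero_row i (sym_of x)) z l k)
      - (\<Sum>k\<in>{..<n}-{i}. of_real (v (sorted_pair i k)) * resolvent n (zero_row i (sym_of x)) z k k)"

lemma bdd_meas_fluctuation:
  assumes "i < n"
  shows "bdd_meas joint_law (fluctuation i)"
  unfolding fluctuation_def using assms
  by (intro bdd_meas_diff bdd_meas_sum bdd_meas_mult bdd_meas_const
      bdd_meas_trunc_sym_of bdd_meas_resolvent[OF sets_\<mu>]) (auto simp: z)

text \<open>The resolvent without row \<open>i\<close> depends only on the coordinates
  \<open>R\<close> outside the off-diagonal part \<open>J\<close> of the row, so Fubini freezes it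
  and reduces to \<open>row_quadratic_form\<close>.\<close>

lemma fluctuation_second_moment:
  assumes i: "i < n"
  shows "(\<integral>x. (cmod (fluctuation i x))\<^sup>2 \<partial>joint_law) \<le> 5 * \<epsilon>\<^sup>2"
proof -
  define K where "K = {..<n} - {i}"
  define J where "J = sorted_pair i ` K"
  define R where "R = upper_index n - J"
  have JI: "J \<subseteq> upper_index n" using i by (auto simp: J_def K_def intro: sorted_pair_in_upper_index)
  then have RJ: "R \<union> J = upper_index n" by (auto simp: R_def)
  have d: "R \<inter> J = {}" "finite R" "finite J" by (auto simp: R_def J_def K_def)
  interpret product_sigma_finite \<mu> by (intro product_sigma_finite.intro prob_space_imp_sigma_finite \<mu>)
  have pA: "prob_space (Pi\<^sub>M A \<mu>)" for A by (intro prob_space_PiM \<mu>)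
  interpret R: prob_space "Pi\<^sub>M R \<mu>" by (rule pA)
  let ?F = "\<lambda>x. (cmod (fluctuation i x))\<^sup>2"
  have bF: "bdd_meas (Pi\<^sub>M (R \<union> J) \<mu>) ?F"
    unfolding RJ by (intro bdd_meas_power2 bdd_meas_norm bdd_meas_fluctuation i)
  have "(\<integral>x. ?F x \<partial>joint_law) = (\<integral>y. (\<integral>x. ?F (merge R J (y, x)) \<partial>Pi\<^sub>M J \<mu>) \<partial>Pi\<^sub>M R \<mu>)"
    using product_integral_fold[OF d bdd_meas_integrable[OF pA bF]] by (simp add: RJ)
  also have "\<dots> \<le> 5 * \<epsilon>\<^sup>2"
  proof (rule R.integral_le_const)
    show "integrable (Pi\<^sub>M R \<mu>) (\<lambda>y. \<integral>x. ?F (merge R J (y, x)) \<partial>Pi\<^sub>M J \<mu>)"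
      by (intro bdd_meas_integrable[OF pA]
          bdd_meas_integral[OF pA, where f="\<lambda>p. ?F (merge R J p)"] bdd_meas_compose[OF bF measurable_merge])
    show "AE y in Pi\<^sub>M R \<mu>. (\<integral>x. ?F (merge R J (y, x)) \<partial>Pi\<^sub>M J \<mu>) \<le> 5 * \<epsilon>\<^sup>2"
    proof (rule AE_I2)
      fix y assume y: "y \<in> space (Pi\<^sub>M R \<mu>)"
      have row: "sym_of (merge R J (y, x)) i k = x (sorted_pair i k)" if "k \<in> K" for x k
        using that d by (auto simp: sym_of_def merge_def J_def)
      \<comment> \<open>Points of the product space are \<open>undefined\<close> off
        \<open>R\<close>, as \<open>merge\<close> is off \<open>R \<union> J\<close>; thus
        \<open>y\<close> and the merged point agree everywhere outside \<open>J\<close>.\<close>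
      have yR: "y p = undefined" if "p \<notin> R" for p
        using y that by (auto simp: space_PiM intro: PiE_arb)
      have rest: "zero_row i (sym_of (merge R J (y, x))) = zero_row i (sym_of y)" for x
      proof (intro ext)
        fix k l
        have "sorted_pair k l \<notin> J" if "k \<noteq> i" "l \<noteq> i"
          using that by (auto simp: J_def sorted_pair_def min_def max_def split: if_splits)
        then show "zero_row i (sym_of (merge R J (y, x))) k l = zero_row i (sym_of y) k l"
          using yR by (auto simp: zero_row_def sym_of_def merge_def)
      qed
      have "fluctuation i (merge R J (y, x)) =
         (\<Sum>k\<in>K. \<Sum>l\<in>K. of_real (trunc \<epsilon> (x (sorted_pair i k))) * of_real (trunc \<epsilon> (x (sorted_pair i l)))
            * resolvent n (zero_row i (sym_of y)) z l k)
         - (\<Sum>k\<in>K. of_real (v (sorted_pair i k)) * resolvent n (zero_row i (sym_of y)) z k k)" for x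
        unfolding fluctuation_def rest K_def[symmetric] by (simp add: row)
      then show "(\<integral>x. ?F (merge R J (y, x)) \<partial>Pi\<^sub>M J \<mu>) \<le> 5 * \<epsilon>\<^sup>2"
        using row_quadratic_form[OF symmetric_zero_row[OF symmetric_sym_of] i, of i y] by (simp add: J_def K_def)
    qed
  qed
  finally show ?thesis .
qed

text \<open>A row with a large entry is paid for by the indicators, since the left side never
  exceeds 1. Otherwise the truncation is exact on the row and the Schur complement becomes a
  perturbed copy of \<open>m * (- z - m) = 1\<close>; the factor 1/4 is the bound on
  \<open>\<bar>G_ii\<bar> * \<bar>m\<bar>\<close>.\<close>

lemma resolvent_diag_self_consistent:
  assumes i: "i < n"
  shows "cmod (resolvent n (sym_of x) z i i - m) \<le>
     (\<Sum>j<n. indicator {y. \<bar>y\<bar> > \<epsilon>} (sym_of x i j)) +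
     1 / 4 * ((\<Sum>k<n. v (sorted_pair i k) * cmod (resolvent n (sym_of x) z k k - m)) + 5 / 2 * \<epsilon> + cmod (fluctuation i x))"
    (is "?L \<le> ?b + 1 / 4 * (?s + _ + _)")
proof -
  let ?G = "resolvent n (sym_of x) z" and ?H = "resolvent n (zero_row i (sym_of x)) z"
  let ?K = "{..<n} - {i}"
  have z': "Im z > 0" using z by simp
  have Gb: "cmod (?G k k) \<le> 1 / 2" if "k < n" for k
    using resolvent_diag_bound[OF symmetric_sym_of z' that] z by simp
  have s0: "0 \<le> ?s" by (intro sum_nonneg mult_nonneg_nonneg row_variance_nonneg) auto
  show ?thesis
  proof (cases "\<exists>j<n. \<bar>sym_of x i j\<bar> > \<epsilon>")
    case True
    then obtain j where j: "j < n" "\<bar>sym_of x i j\<bar> > \<epsilon>" by blast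
    have "?L \<le> cmod (?G i i) + cmod m" by (rule norm_triangle_ineq4)
    also have "\<dots> \<le> 1" using Gb[OF i] m(2) by simp
    also have "1 = (indicator {y. \<bar>y\<bar> > \<epsilon>} (sym_of x i j) :: real)" using j by simp
    also have "\<dots> \<le> ?b" using j by (intro member_le_sum) auto
    finally show ?thesis using s0 \<epsilon> by (smt (verit) norm_ge_zero mult_nonneg_nonneg divide_nonneg_nonneg)
  next
    case False
    then have t: "trunc \<epsilon> (sym_of x i j) = sym_of x i j" if "j < n" for j
      using that by (auto simp: trunc_def)
    let ?v = "\<lambda>k. of_real (v (sorted_pair i k))"
    define d1 where "d1 = (\<Sum>k\<in>?K. ?v k * (?G k k - ?H k k))"
    define S where "S = (\<Sum>k<n. ?v k * ?G k k)"
    \<comment> \<open>All deviations from \<open>G_ii * (- z - S) = 1\<close>: the diagonal entry,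
      the fluctuation, the exchange of the reduced resolvent for the full one, and the extra term
      \<open>k = i\<close> in \<open>S\<close>. Apart from the fluctuation they cost
      \<open>\<epsilon> + \<epsilon> / 2 + \<epsilon> / 2\<close>; the defect of the row variance
      adds another \<open>\<epsilon> / 2\<close>, whence \<open>5 / 2 * \<epsilon>\<close>.\<close>
    define e where "e = of_real (sym_of x i i) - fluctuation i x + d1 + ?v i * ?G i i"
    have fl: "(\<Sum>k\<in>?K. \<Sum>l\<in>?K. of_real (sym_of x i k) * of_real (sym_of x i l) * ?H l k)
        = fluctuation i x + (\<Sum>k\<in>?K. ?v k * ?H k k)"
      unfolding fluctuation_def by (simp add: t)
    have S: "S = ?v i * ?G i i + (\<Sum>k\<in>?K. ?v k * ?G k k)"
      unfolding S_def using i by (subst sum.remove[of _ i]) auto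
    have "?G i i * (of_real (sym_of x i i) - z - (fluctuation i x + (\<Sum>k\<in>?K. ?v k * ?H k k))) = 1"
      using schur_complement[OF symmetric_sym_of z' i, of x] unfolding fl .
    moreover have "of_real (sym_of x i i) - z - (fluctuation i x + (\<Sum>k\<in>?K. ?v k * ?H k k)) = - z - S + e"
      unfolding e_def S d1_def by (simp add: right_diff_distrib sum_subtractf)
    ultimately have G1: "?G i i * (- z - S + e) = 1" by simp
    \<comment> \<open>Each term is multiplied by the other equation's 1, so the unknown difference
      appears without dividing.\<close>
    have "?G i i - m = ?G i i * (m * (- z - m)) - m * (?G i i * (- z - S + e))" unfolding G1 m(1) by simp
    also have "\<dots> = ?G i i * m * (S - m - e)" by (simp add: algebra_simps)
    finally have L: "?L = cmod (?G i i) * cmod m * cmod (S - m - e)" by (simp add: norm_mult)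
    have "cmod (?G i i) * cmod m \<le> 1 / 2 * (1 / 2)"
      by (intro mult_mono Gb i m) auto
    then have L': "?L \<le> 1 / 4 * cmod (S - m - e)"
      unfolding L by (intro mult_right_mono) auto
    have "S - m = (\<Sum>k<n. ?v k * (?G k k - m)) + of_real ((\<Sum>k<n. v (sorted_pair i k)) - 1) * m"
      unfolding S_def by (simp add: algebra_simps sum_subtractf sum_distrib_left sum_distrib_right)
    then have "cmod (S - m) \<le> cmod (\<Sum>k<n. ?v k * (?G k k - m)) + cmod (of_real ((\<Sum>k<n. v (sorted_pair i k)) - 1) * m)"
      by (simp only: norm_triangle_ineq)
    also have "\<dots> = cmod (\<Sum>k<n. ?v k * (?G k k - m)) + \<bar>(\<Sum>k<n. v (sorted_pair i k)) - 1\<bar> * cmod m"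
      by (simp only: norm_mult norm_of_real)
    also have "\<dots> \<le> ?s + \<epsilon> * (1 / 2)"
      using \<epsilon> by (intro add_mono mult_mono var i m sum_norm_le) (auto simp: norm_mult row_variance_nonneg)
    finally have Sm: "cmod (S - m) \<le> ?s + \<epsilon> / 2" by simp
    have e2: "\<epsilon>\<^sup>2 \<le> \<epsilon>" using \<epsilon> by (simp add: power2_eq_square mult_left_le)
    have "cmod d1 \<le> \<epsilon>\<^sup>2 * (1 / Im z)"
      unfolding d1_def by (intro sum_offdiag_weights row_variance_nonneg row_variance_le resolvent_diag_diff_sum[OF symmetric_sym_of z' i]) auto
    then have d1: "cmod d1 \<le> \<epsilon> / 2" using e2 z by simp
    have "cmod (?v i * ?G i i) \<le> \<epsilon>\<^sup>2 * (1 / 2)"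
      unfolding norm_mult norm_of_real using row_variance_nonneg row_variance_le by (intro mult_mono Gb i) auto
    then have d2: "cmod (?v i * ?G i i) \<le> \<epsilon> / 2" using e2 by simp
    have d3: "cmod (of_real (sym_of x i i)) \<le> \<epsilon>"
      using trunc_bound[of "sym_of x i i"] t[OF i] by simp
    have "cmod e \<le> cmod (of_real (sym_of x i i)) + cmod (fluctuation i x) + cmod d1 + cmod (?v i * ?G i i)"
      unfolding e_def by (intro norm_triangle_le add_mono norm_triangle_ineq4 order_refl)
    then have e: "cmod e \<le> 2 * \<epsilon> + cmod (fluctuation i x)" using d1 d2 d3 by simp
    have "cmod (S - m - e) \<le> ?s + 5 / 2 * \<epsilon> + cmod (fluctuation i x)"
      using norm_triangle_ineq4[of "S - m" e] Sm e by linarith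
    moreover have "0 \<le> ?b" by (intro sum_nonneg) auto
    ultimately show ?thesis using L' by (simp add: field_simps)
  qed
qed

text \<open>Average the pointwise inequality and bound all means on the right by their maximum
  \<open>D\<close>. The weights sum to at most 2, so \<open>D\<close> returns with coefficient 1/2
  and can be absorbed.\<close>

lemma resolvent_diag_mean:
  assumes i: "i < n"
  shows "(\<integral>x. cmod (resolvent n (sym_of x) z i i - m) \<partial>joint_law) \<le> 5 * \<epsilon>"
proof -
  interpret P: prob_space joint_law by (rule prob_space_joint_law)
  note int = bdd_meas_integrable[OF prob_space_joint_law]
  define g where "g k x = cmod (resolvent n (sym_of x) z k k - m)" for k x
  have g: "bdd_meas joint_law (g k)" if "k < n" for k
    unfolding g_def using that z
    by (intro bdd_meas_norm bdd_meas_diff bdd_meas_const bdd_meas_resolvent[OF sets_\<mu>]) auto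
  define E where "E k = (\<integral>x. g k x \<partial>joint_law)" for k
  define D where "D = Max (E ` {..<n})"
  have ED: "E k \<le> D" if "k < n" for k unfolding D_def using that by (intro Max_ge) auto
  have "D \<in> E ` {..<n}" unfolding D_def using i by (intro Max_in) auto
  then obtain k0 where k0: "k0 < n" "D = E k0" by auto
  have D0: "0 \<le> D" unfolding k0 E_def g_def by (intro integral_nonneg_AE AE_I2) auto
  have bound: "E i \<le> \<epsilon> + 1 / 4 * (2 * D + 5 / 2 * \<epsilon> + 3 * \<epsilon>)" if i: "i < n" for i
  proof -
    let ?ind = "\<lambda>j x. indicator {y. \<bar>y\<bar> > \<epsilon>} (sym_of x i j) :: real"
    have ind: "bdd_meas joint_law (?ind j)" if "j < n" for j
    proof (rule bdd_measI[where C=1])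
      have [measurable]: "(\<lambda>x. sym_of x i j) \<in> borel_measurable joint_law" by (rule sym_of_measurable[OF sets_\<mu> i that])
      show "?ind j \<in> borel_measurable joint_law" by measurable
    qed (auto simp: indicator_def)
    have ind_int: "(\<integral>x. ?ind j x \<partial>joint_law) = measure (\<mu> (sorted_pair i j)) {y. \<bar>y\<bar> > \<epsilon>}" if "j < n" for j
    proof -
      have p: "sorted_pair i j \<in> upper_index n" by (rule sorted_pair_in_upper_index[OF i that])
      have s: "space (\<mu> (sorted_pair i j)) = UNIV" using sets_eq_imp_space_eq[OF sets_\<mu>] by simp
      have "(\<integral>x. ?ind j x \<partial>joint_law) = (\<integral>y. indicator {y. \<bar>y\<bar> > \<epsilon>} y \<partial>distr joint_law (\<mu> (sorted_pair i j)) (\<lambda>x. x (sorted_pair i j)))"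
        unfolding sym_of_def using p sets_\<mu>[of "sorted_pair i j"]
        by (subst integral_distr) (auto intro!: measurable_component_singleton simp: measurable_cong_sets[OF sets_\<mu> refl])
      also have "distr joint_law (\<mu> (sorted_pair i j)) (\<lambda>x. x (sorted_pair i j)) = \<mu> (sorted_pair i j)"
        by (rule distr_PiM_component[OF \<mu> p])
      finally show ?thesis using s sets_\<mu> by simp
    qed
    \<comment> \<open>First moment from the second by the arithmetic-geometric mean inequality at
      scale \<open>\<epsilon>\<close>: \<open>5 / 2 * \<epsilon> + \<epsilon> / 2\<close>.\<close>
    have fl: "(\<integral>x. cmod (fluctuation i x) \<partial>joint_law) \<le> 3 * \<epsilon>"
    proof -
      have "(\<integral>x. cmod (fluctuation i x) \<partial>joint_law) \<le> (\<integral>x. 1 / (2 * \<epsilon>) * (cmod (fluctuation i x))\<^sup>2 + \<epsilon> / 2 \<partial>joint_law)"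
      proof (intro integral_mono int bdd_meas_add bdd_meas_mult bdd_meas_const
          bdd_meas_power2 bdd_meas_norm bdd_meas_fluctuation i)
        fix x
        have "0 \<le> (cmod (fluctuation i x) - \<epsilon>)\<^sup>2" by simp
        then show "cmod (fluctuation i x) \<le> 1 / (2 * \<epsilon>) * (cmod (fluctuation i x))\<^sup>2 + \<epsilon> / 2"
          using \<epsilon> by (simp add: power2_diff field_simps power2_eq_square)
      qed
      also have "\<dots> = 1 / (2 * \<epsilon>) * (\<integral>x. (cmod (fluctuation i x))\<^sup>2 \<partial>joint_law) + \<epsilon> / 2"
        using int[OF bdd_meas_power2[OF bdd_meas_norm[OF bdd_meas_fluctuation[OF i]]]]
        by (simp add: P.prob_space)
      also have "\<dots> \<le> 1 / (2 * \<epsilon>) * (5 * \<epsilon>\<^sup>2) + \<epsilon> / 2"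
        using \<epsilon> by (intro add_right_mono mult_left_mono fluctuation_second_moment i) auto
      also have "\<dots> = 3 * \<epsilon>" using \<epsilon> by (simp add: power2_eq_square)
      finally show ?thesis .
    qed
    have i_g: "integrable joint_law (g k)" if "k < n" for k by (intro int g that)
    have i_ind: "integrable joint_law (?ind j)" if "j < n" for j by (intro int ind that)
    have i_fl: "integrable joint_law (\<lambda>x. cmod (fluctuation i x))"
      by (intro int bdd_meas_norm bdd_meas_fluctuation i)
    have "E i \<le> (\<integral>x. (\<Sum>j<n. ?ind j x) + 1 / 4 * ((\<Sum>k<n. v (sorted_pair i k) * g k x) + 5 / 2 * \<epsilon> + cmod (fluctuation i x)) \<partial>joint_law)"
      unfolding E_def
    proof (rule integral_mono)
      show "integrable joint_law (\<lambda>x. (\<Sum>j<n. ?ind j x) + 1 / 4 * ((\<Sum>k<n. v (sorted_pair i k) * g k x) + 5 / 2 * \<epsilon> + cmod (fluctuation i x)))"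
        using i by (intro int bdd_meas_add bdd_meas_mult bdd_meas_const bdd_meas_sum
          bdd_meas_norm bdd_meas_fluctuation ind g) auto
      show "g i x \<le> (\<Sum>j<n. ?ind j x) + 1 / 4 * ((\<Sum>k<n. v (sorted_pair i k) * g k x) + 5 / 2 * \<epsilon> + cmod (fluctuation i x))" for x
        unfolding g_def by (rule resolvent_diag_self_consistent[OF i])
    qed (use i_g i in auto)
    also have "\<dots> = (\<Sum>j<n. \<integral>x. ?ind j x \<partial>joint_law) + 1 / 4 * ((\<Sum>k<n. v (sorted_pair i k) * E k) + 5 / 2 * \<epsilon> + (\<integral>x. cmod (fluctuation i x) \<partial>joint_law))"
    proof -
      have "integrable joint_law (\<lambda>x. \<Sum>j<n. ?ind j x)" "integrable joint_law (\<lambda>x. \<Sum>k<n. v (sorted_pair i k) * g k x)"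
        using i_g i_ind by (auto intro!: Bochner_Integration.integrable_sum)
      then have "(\<integral>x. (\<Sum>j<n. ?ind j x) + 1 / 4 * ((\<Sum>k<n. v (sorted_pair i k) * g k x) + 5 / 2 * \<epsilon> + cmod (fluctuation i x)) \<partial>joint_law)
          = (\<integral>x. (\<Sum>j<n. ?ind j x) \<partial>joint_law) + 1 / 4 * ((\<integral>x. (\<Sum>k<n. v (sorted_pair i k) * g k x) \<partial>joint_law) + 5 / 2 * \<epsilon> + (\<integral>x. cmod (fluctuation i x) \<partial>joint_law))"
        using i_fl by (simp add: P.prob_space)
      moreover have "(\<integral>x. (\<Sum>j<n. ?ind j x) \<partial>joint_law) = (\<Sum>j<n. \<integral>x. ?ind j x \<partial>joint_law)"
        using i_ind by (intro Bochner_Integration.integral_sum) auto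
      moreover have "(\<integral>x. (\<Sum>k<n. v (sorted_pair i k) * g k x) \<partial>joint_law) = (\<Sum>k<n. v (sorted_pair i k) * E k)"
        unfolding E_def using i_g by (subst Bochner_Integration.integral_sum) auto
      ultimately show ?thesis by (simp only:)
    qed
    also have "\<dots> \<le> \<epsilon> + 1 / 4 * (2 * D + 5 / 2 * \<epsilon> + 3 * \<epsilon>)"
    proof (intro add_mono mult_left_mono fl order_refl)
      show "(\<Sum>j<n. \<integral>x. ?ind j x \<partial>joint_law) \<le> \<epsilon>" using tail[OF i] by (simp add: ind_int)
      have "(\<Sum>k<n. v (sorted_pair i k) * E k) \<le> (\<Sum>k<n. v (sorted_pair i k) * D)"
        by (intro sum_mono mult_left_mono row_variance_nonneg ED) auto
      also have "\<dots> = (\<Sum>k<n. v (sorted_pair i k)) * D" by (simp add: sum_distrib_right)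
      also have "\<dots> \<le> 2 * D" using var[OF i] \<epsilon> D0 by (intro mult_right_mono) (auto simp: abs_le_iff)
      finally show "(\<Sum>k<n. v (sorted_pair i k) * E k) \<le> 2 * D" .
    qed auto
    finally show ?thesis .
  qed
  \<comment> \<open>The bound reads \<open>D <= D / 2 + 19 / 8 * \<epsilon>\<close>, that is
    \<open>D <= 19 / 4 * \<epsilon>\<close>.\<close>
  have "D \<le> 5 * \<epsilon>" using bound[OF k0(1)] k0(2) \<epsilon> by (simp add: field_simps)
  with ED[OF i] show ?thesis by (simp add: E_def g_def)
qed

end

section \<open>Almost sure convergence\<close>

lemma sum_mset_eq_sum_count:
  fixes f :: "'a \<Rightarrow> 'b::comm_semiring_1"
  assumes "finite S" "set_mset A \<subseteq> S"
  shows "(\<Sum>x\<in>#A. f x) = (\<Sum>x\<in>S. of_nat (count A x) * f x)"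
  using assms(2)
proof (induction A)
  case (add a A)
  have "(\<Sum>x\<in>S. of_nat (count (add_mset a A) x) * f x) = (\<Sum>x\<in>S. (if x = a then f x else 0) + of_nat (count A x) * f x)"
    by (intro sum.cong refl) (auto simp: algebra_simps)
  also have "\<dots> = f a + (\<Sum>x\<in>#A. f x)" using add assms(1) by (simp add: sum.distrib)
  finally show ?case by simp
qed simp

text \<open>This covers every matrix, even one with an empty eigenvalue multiset, because
  \<open>pmf_of_multiset\<close> always returns a pmf; the index \<open>n = 0\<close> thus fits into
  the convergence lemmas.\<close>

lemma real_distribution_esd: "real_distribution (esd A)"
  unfolding esd_def
  by (auto simp: real_distribution_def real_distribution_axioms_def intro!: measure_pmf.prob_space_distr)

lemma stieltjes_esd:
  assumes A: "symmetric_upto n A" and n: "n > 0" and z: "Im z > 0"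
  shows "stieltjes (esd (mat n n (\<lambda>(i, j). A i j))) z = (\<Sum>j<n. resolvent n A z j j) / of_nat n"
proof -
  define E where "E = eigvals_mset (mat n n (\<lambda>(i, j). A i j))"
  have size: "size E = n" using symmetric_eigvals(1)[OF A] by (simp add: E_def)
  then have ne: "E \<noteq> {#}" using n by auto
  have "stieltjes (esd (mat n n (\<lambda>(i, j). A i j))) z = (\<integral>x. 1 / (complex_of_real x - z) \<partial>measure_pmf (pmf_of_multiset E))"
    unfolding stieltjes_def esd_def E_def[symmetric] by (subst integral_distr) auto
  also have "\<dots> = (\<Sum>x\<in>set_mset E. pmf (pmf_of_multiset E) x *\<^sub>R (1 / (complex_of_real x - z)))"
    using ne by (intro integral_measure_pmf) auto
  also have "\<dots> = (\<Sum>x\<in>set_mset E. of_nat (count E x) * (1 / (complex_of_real x - z))) / of_nat n"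
    using ne size by (simp add: scaleR_conv_of_real sum_divide_distrib mult.commute)
  also have "(\<Sum>x\<in>set_mset E. of_nat (count E x) * (1 / (complex_of_real x - z))) = (\<Sum>x\<in>#E. 1 / (complex_of_real x - z))"
    by (rule sum_mset_eq_sum_count[symmetric]) auto
  also have "\<dots> = (\<Sum>j<n. resolvent n A z j j)"
    using symmetric_eigvals(2)[OF A z] by (simp add: E_def)
  finally show ?thesis .
qed

lemma resolvent_cong:
  assumes "\<And>a b. a < n \<Longrightarrow> b < n \<Longrightarrow> A a b = B a b"
  shows "resolvent n A z i j = resolvent n B z i j"
proof -
  have "shifted_mat n A z = shifted_mat n B z"
    unfolding shifted_mat_def using assms by (intro eq_matI) auto
  then show ?thesis by (simp add: resolvent_def)
qed

section \<open>Concentration of the mean trace\<close>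

text \<open>Only the part of row \<open>k\<close> from the diagonal on, so that the blocks partition
  the independent coordinates; a change in one block affects just row and column \<open>k\<close> of
  the symmetric matrix.\<close>

definition row_block :: "nat \<Rightarrow> nat \<Rightarrow> (nat \<times> nat) set" where
  "row_block n k = {(i, j). i = k \<and> i \<le> j \<and> j < n}"

lemma Union_row_block: "(\<Union>k<n. row_block n k) = upper_index n"
  by (auto simp: row_block_def upper_index_def)

lemma finite_row_block: "finite (row_block n k)"
  by (rule finite_subset[of _ "{k} \<times> {..<n}"]) (auto simp: row_block_def)

definition mean_trace :: "nat \<Rightarrow> complex \<Rightarrow> (nat \<times> nat \<Rightarrow> real) \<Rightarrow> complex" where
  "mean_trace n z x = (\<Sum>j<n. resolvent n (sym_of x) z j j) / of_nat n"

lemma bdd_meas_mean_trace: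
  assumes "\<And>p. sets (\<mu> p) = sets borel" "Im z > 0"
  shows "bdd_meas (Pi\<^sub>M (upper_index n) \<mu>) (mean_trace n z)"
proof -
  have "bdd_meas (Pi\<^sub>M (upper_index n) \<mu>) (\<lambda>x. (\<Sum>j<n. resolvent n (sym_of x) z j j) * (1 / of_nat n))"
    by (intro bdd_meas_mult bdd_meas_sum bdd_meas_const bdd_meas_resolvent(1)[OF assms]) auto
  then show ?thesis by (simp add: mean_trace_def[abs_def])
qed

text \<open>Both matrices coincide once row and column \<open>k\<close> are zeroed; passing through
  this common matrix costs \<open>3 / Im z = 3 / 2\<close> on either side.\<close>

lemma mean_trace_diff:
  assumes n: "k < n" and z: "Im z = 2"
    and eq: "\<And>p. p \<in> upper_index n - row_block n k \<Longrightarrow> x p = y p"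
  shows "cmod (mean_trace n z x - mean_trace n z y) \<le> 3 / real n"
proof -
  have z': "Im z > 0" using z by simp
  have "resolvent n (zero_row k (sym_of x)) z i j = resolvent n (zero_row k (sym_of y)) z i j" for i j
  proof (rule resolvent_cong)
    fix a b assume ab: "a < n" "b < n"
    have "sorted_pair a b \<notin> row_block n k" if "a \<noteq> k" "b \<noteq> k"
      using that by (auto simp: sorted_pair_def row_block_def min_def split: if_splits)
    then show "zero_row k (sym_of x) a b = zero_row k (sym_of y) a b"
      using eq sorted_pair_in_upper_index[OF ab] by (auto simp: zero_row_def sym_of_def)
  qed
  then have t: "(\<Sum>j<n. resolvent n (zero_row k (sym_of x)) z j j) = (\<Sum>j<n. resolvent n (zero_row k (sym_of y)) z j j)"
    by simp
  let ?T = "\<lambda>x. \<Sum>j<n. resolvent n (sym_of x) z j j"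
  have "cmod (?T x - ?T y) \<le> 3 / 2 + 3 / 2"
    using resolvent_trace_zero_row[OF symmetric_sym_of z' n, of x] resolvent_trace_zero_row[OF symmetric_sym_of z' n, of y]
      norm_triangle_ineq4[of "?T x - (\<Sum>j<n. resolvent n (zero_row k (sym_of x)) z j j)" "?T y - (\<Sum>j<n. resolvent n (zero_row k (sym_of y)) z j j)"]
    unfolding t using z by simp
  moreover have "mean_trace n z x - mean_trace n z y = (?T x - ?T y) / of_nat n"
    by (simp add: mean_trace_def diff_divide_distrib)
  ultimately show ?thesis using n by (simp add: norm_divide divide_right_mono)
qed

text \<open>Bounded differences with \<open>c = 3 / n\<close> over \<open>n\<close> rows give the
  exponent \<open>n * \<epsilon>^2 / 18\<close>. Using single entries as variables with the same
  \<open>c\<close> would mean about \<open>n^2 / 2\<close> blocks and no decay in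
  \<open>n\<close>.\<close>

lemma mean_trace_concentration:
  fixes \<mu> :: "nat \<times> nat \<Rightarrow> real measure" and n :: nat
  defines "P \<equiv> Pi\<^sub>M (upper_index n) \<mu>"
  assumes \<mu>: "\<And>p. prob_space (\<mu> p)" and sets_\<mu>: "\<And>p. sets (\<mu> p) = sets borel"
    and n: "n > 0" and z: "Im z = 2" and \<epsilon>: "\<epsilon> > 0"
    and \<phi>: "\<phi> = Re \<or> \<phi> = Im"
  shows "measure P {x\<in>space P. \<bar>\<phi> (mean_trace n z x) - (\<integral>x. \<phi> (mean_trace n z x) \<partial>P)\<bar> \<ge> \<epsilon>} \<le> 2 * exp (- (\<epsilon>\<^sup>2 / 18)) ^ n"
proof -
  have z': "Im z > 0" using z by simp
  have bm: "bdd_meas P (mean_trace n z)" unfolding P_def by (rule bdd_meas_mean_trace[OF sets_\<mu> z'])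
  have bm\<phi>: "bdd_meas P (\<lambda>x. \<phi> (mean_trace n z x))"
    using bm \<phi> by (auto simp: bdd_meas_def intro!: exI intro: order_trans[OF abs_Re_le_cmod] order_trans[OF abs_Im_le_cmod])
  have "measure P {x\<in>space P. \<bar>\<phi> (mean_trace n z x) - (\<integral>x. \<phi> (mean_trace n z x) \<partial>P)\<bar> \<ge> \<epsilon>} \<le> 2 * exp (- (\<epsilon>\<^sup>2 / (2 * real n * (3 / real n)\<^sup>2)))"
    unfolding P_def Union_row_block[symmetric]
  proof (rule mcdiarmid)
    show "bdd_meas (Pi\<^sub>M (\<Union>k<n. row_block n k) \<mu>) (\<lambda>x. \<phi> (mean_trace n z x))"
      using bm\<phi> by (simp add: Union_row_block P_def)
    fix k and x y :: "nat \<times> nat \<Rightarrow> real"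
    assume k: "k < n" and eq: "\<And>i. i \<in> (\<Union>k<n. row_block n k) - row_block n k \<Longrightarrow> x i = y i"
    have "\<bar>\<phi> (mean_trace n z x) - \<phi> (mean_trace n z y)\<bar> = \<bar>\<phi> (mean_trace n z x - mean_trace n z y)\<bar>"
      using \<phi> by auto
    also have "\<dots> \<le> cmod (mean_trace n z x - mean_trace n z y)"
      using \<phi> abs_Re_le_cmod abs_Im_le_cmod by auto
    also have "\<dots> \<le> 3 / real n"
      by (rule mean_trace_diff[OF k z]) (use eq in \<open>auto simp: Union_row_block\<close>)
    finally show "\<bar>\<phi> (mean_trace n z x) - \<phi> (mean_trace n z y)\<bar> \<le> 3 / real n" .
  qed (use \<mu> n \<epsilon> finite_row_block in \<open>auto simp: row_block_def\<close>)
  also have "\<epsilon>\<^sup>2 / (2 * real n * (3 / real n)\<^sup>2) = real n * (\<epsilon>\<^sup>2 / 18)"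
    using n by (simp add: field_simps power2_eq_square)
  also have "exp (- (real n * (\<epsilon>\<^sup>2 / 18))) = exp (- (\<epsilon>\<^sup>2 / 18)) ^ n"
    by (simp add: exp_of_nat_mult[symmetric])
  finally show ?thesis .
qed

section \<open>Symmetric laws and assembly of the proof\<close>

lemma symmetric_distribution_odd_integral:
  fixes \<nu> :: "real measure" and f :: "real \<Rightarrow> real"
  assumes \<nu>: "sets \<nu> = sets borel" and sym: "distr \<nu> borel uminus = \<nu>"
    and f: "f \<in> borel_measurable borel" and odd: "\<And>x. f (- x) = - f x"
  shows "(\<integral>x. f x \<partial>\<nu>) = 0"
proof -
  have "(\<integral>x. f x \<partial>\<nu>) = (\<integral>x. f x \<partial>distr \<nu> borel uminus)" by (simp add: sym)
  also have "\<dots> = (\<integral>x. f (- x) \<partial>\<nu>)"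
    using f by (intro integral_distr) (auto simp: measurable_cong_sets[OF \<nu> refl])
  finally show ?thesis by (simp add: odd)
qed

lemma char_symmetric:
  assumes \<nu>: "real_distribution \<nu>" and sym: "distr \<nu> borel uminus = \<nu>"
  shows "char \<nu> t = complex_of_real (\<integral>x. cos (t * x) \<partial>\<nu>)"
proof -
  interpret real_distribution \<nu> by fact
  have i: "integrable \<nu> (\<lambda>x. iexp (t * x))" by (rule integrable_iexp) auto
  have "(\<integral>x. sin (t * x) \<partial>\<nu>) = 0"
    by (rule symmetric_distribution_odd_integral[OF _ sym]) auto
  then have "Im (char \<nu> t) = 0"
    unfolding char_def integral_Im[OF i, symmetric] by (simp add: Im_exp)
  moreover have "Re (char \<nu> t) = (\<integral>x. cos (t * x) \<partial>\<nu>)"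
    unfolding char_def integral_Re[OF i, symmetric] by (simp add: Re_exp)
  ultimately show ?thesis by (simp add: complex_eq_iff)
qed

text \<open>At \<open>n = 0\<close> the chosen index lies outside the matrix and nothing is known
  about the law, so the sequence is shifted by one before Levy's theorem is applied.\<close>

lemma weak_conv_m_char:
  assumes "\<And>n. n > 0 \<Longrightarrow> real_distribution (\<mu> n)" "real_distribution \<nu>" "weak_conv_m \<mu> \<nu>"
  shows "(\<lambda>n. char (\<mu> n) t) \<longlonglongrightarrow> char \<nu> t"
proof -
  have "weak_conv_m (\<lambda>n. \<mu> (Suc n)) \<nu>"
    using assms(3) by (auto simp: weak_conv_m_def weak_conv_def intro: LIMSEQ_Suc)
  from levy_continuity1[OF assms(1) assms(2) this] show ?thesis
    by (auto intro: LIMSEQ_imp_Suc)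
qed

lemma real_distribution_return: "real_distribution (return borel (c::real))"
  by (auto simp: real_distribution_def real_distribution_axioms_def intro: prob_space_return)

lemma char_return_0: "char (return borel 0) t = 1"
  unfolding char_def by (subst integral_return) auto

theorem theorem5p2:
  fixes M :: "'a measure"
    and W :: "nat \<Rightarrow> nat \<Rightarrow> nat \<Rightarrow> 'a \<Rightarrow> real"
  assumes "prob_space M"
    and meas: "\<And>n i j. i < n \<Longrightarrow> j < n \<Longrightarrow> W n i j \<in> borel_measurable M"
    and symm: "\<And>n i j \<omega>. i < n \<Longrightarrow> j < n \<Longrightarrow> W n i j \<omega> = W n j i \<omega>"
    and indep: "\<And>n. prob_space.indep_vars M (\<lambda>_. borel) (\<lambda>(i, j). W n i j)
                       {(i, j). i \<le> j \<and> j < n}"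
    and symdist: "\<And>n i j. i < n \<Longrightarrow> j < n \<Longrightarrow>
                    distr M borel (W n i j) = distr M borel (\<lambda>\<omega>. - W n i j \<omega>)"
    and entries_to_0: "\<And>I J :: nat \<Rightarrow> nat. (\<forall>n>0. I n < n \<and> J n < n) \<Longrightarrow>
                    weak_conv_m (\<lambda>n. distr M borel (W n (I n) (J n))) (return borel 0)"
    and rowsum_normal: "\<And>I :: nat \<Rightarrow> nat. (\<forall>n>0. I n < n) \<Longrightarrow>
                    weak_conv_m (\<lambda>n. distr M borel (\<lambda>\<omega>. \<Sum>j<n. W n (I n) j \<omega>))
                      std_normal_distribution"
  shows "AE \<omega> in M. weak_conv_m (\<lambda>n. esd (mat n n (\<lambda>(i, j). W n i j \<omega>)))
                        semicircle_distribution"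
proof -
  interpret M: prob_space M by fact
  \<comment> \<open>The point mass at 0 off the upper triangle is a filler that makes every
    component a probability measure, as the product-measure lemmas require.\<close>
  define \<mu> where "\<mu> n p = (if p \<in> upper_index n then distr M borel (W n (fst p) (snd p)) else return borel 0)" for n p
  define X where "X n \<omega> = (\<lambda>p\<in>upper_index n. W n (fst p) (snd p) \<omega>)" for n \<omega>
  have meas': "W n (fst p) (snd p) \<in> borel_measurable M" if "p \<in> upper_index n" for n p
    using that by (auto simp: upper_index_def intro: meas)
  have \<mu>: "prob_space (\<mu> n p)" and sets_\<mu>: "sets (\<mu> n p) = sets borel" for n p
    using meas' by (auto simp: \<mu>_def intro: M.prob_space_distr prob_space_return)
  have Wsym: "W n i j = W n j i" if "i < n" "j < n" for n i j using symm[OF that] by auto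
  have pair: "W n (fst (sorted_pair i j)) (snd (sorted_pair i j)) = W n i j" if "i < n" "j < n" for n i j
    using Wsym[OF that] by (auto simp: sorted_pair_def min_def max_def)
  have \<mu>_pair: "\<mu> n (sorted_pair i j) = distr M borel (W n i j)" if "i < n" "j < n" for n i j
    using sorted_pair_in_upper_index[OF that] by (simp add: \<mu>_def pair[OF that])
  have rd: "real_distribution (distr M borel (W n i j))" if "i < n" "j < n" for n i j
    using meas[OF that] by (auto simp: real_distribution_def real_distribution_axioms_def intro: M.prob_space_distr)
  have reflect: "distr (distr M borel (W n i j)) borel uminus = distr M borel (W n i j)" if "i < n" "j < n" for n i j
    using meas[OF that] symdist[OF that] by (subst distr_distr) (auto simp: comp_def)
  have indep': "M.indep_vars (\<lambda>_. borel) (\<lambda>p. W n (fst p) (snd p)) (upper_index n)" for n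
    using indep[of n] by (simp add: upper_index_def case_prod_beta')
  have X_meas: "X n \<in> measurable M (Pi\<^sub>M (upper_index n) (\<mu> n))" for n
    unfolding X_def using meas' by (intro measurable_restrict) (simp add: measurable_cong_sets[OF refl sets_\<mu>])
  have law: "distr M (Pi\<^sub>M (upper_index n) (\<mu> n)) (X n) = Pi\<^sub>M (upper_index n) (\<mu> n)" if n: "n > 0" for n
  proof -
    have ne: "upper_index n \<noteq> {}" using n by (auto simp: upper_index_def)
    have "distr M (Pi\<^sub>M (upper_index n) (\<mu> n)) (X n) = distr M (Pi\<^sub>M (upper_index n) (\<lambda>_. borel)) (\<lambda>\<omega>. \<lambda>p\<in>upper_index n. W n (fst p) (snd p) \<omega>)"
      unfolding X_def by (intro distr_cong refl sets_PiM_cong) (auto simp: sets_\<mu>)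
    also have "\<dots> = Pi\<^sub>M (upper_index n) (\<lambda>p. distr M borel (W n (fst p) (snd p)))"
      using M.indep_vars_iff_distr_eq_PiM'[OF ne, where M'="\<lambda>_. borel" and X="\<lambda>p. W n (fst p) (snd p)"] meas' indep' by blast
    also have "\<dots> = Pi\<^sub>M (upper_index n) (\<mu> n)" by (intro PiM_cong) (auto simp: \<mu>_def)
    finally show ?thesis .
  qed
  have rows: "\<forall>\<^sub>F n in sequentially. \<forall>i<n. (\<Sum>j<n. measure (\<mu> n (sorted_pair i j)) {x. \<bar>x\<bar> > \<epsilon>}) \<le> \<epsilon> \<and>
           \<bar>(\<Sum>j<n. \<integral>x. (trunc \<epsilon> x)\<^sup>2 \<partial>\<mu> n (sorted_pair i j)) - 1\<bar> \<le> \<epsilon>" if \<epsilon>: "0 < \<epsilon>" "\<epsilon> \<le> 1" for \<epsilon>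
  proof (rule eventually_all_indices)
    fix I :: "nat \<Rightarrow> nat" assume I: "\<forall>n>0. I n < n"
    have In: "I n < n" if "j < n" for n j using I that by auto
    have "\<forall>\<^sub>F n in sequentially. (\<Sum>j<n. measure (distr M borel (W n (I n) j)) {x. \<bar>x\<bar> > \<epsilon>}) \<le> \<epsilon> \<and>
           \<bar>(\<Sum>j<n. \<integral>x. (trunc \<epsilon> x)\<^sup>2 \<partial>distr M borel (W n (I n) j)) - 1\<bar> \<le> \<epsilon>"
    proof (rule triangular_array_normal_limit[OF _ _ _ _ \<epsilon>])
      show "real_distribution (distr M borel (W n (I n) j))" if "j < n" for n j
        using In[OF that] that by (rule rd)
      show "char (distr M borel (W n (I n) j)) t = complex_of_real (\<integral>x. cos (t * x) \<partial>distr M borel (W n (I n) j))" if "j < n" for n j t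
        using In[OF that] that by (intro char_symmetric rd reflect)
      show "(\<lambda>n. char (distr M borel (W n (I n) (J n))) t) \<longlonglongrightarrow> 1" if J: "\<forall>n>0. J n < n" for J t
        using weak_conv_m_char[OF rd real_distribution_return entries_to_0[of I J]] I J by (simp add: char_return_0)
      fix t
      have "(\<Prod>j<n. char (distr M borel (W n (I n) j)) t) = char (distr M borel (\<lambda>\<omega>. \<Sum>j<n. W n (I n) j \<omega>)) t" if n: "n > 0" for n
      proof -
        have i: "I n < n" using I n by simp
        \<comment> \<open>The coordinates behind row \<open>I n\<close>: distinct positions on or
          above the diagonal, so independence covers the whole row including the entries left of the
          diagonal.\<close>
        let ?S = "sorted_pair (I n) ` {..<n}"
        have inj: "inj_on (sorted_pair (I n)) {..<n}" by (auto simp: inj_on_def sorted_pair_eq_iff)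
        have "M.indep_vars (\<lambda>_. borel) (\<lambda>p. W n (fst p) (snd p)) ?S"
          by (rule M.indep_vars_subset[OF indep']) (use sorted_pair_in_upper_index i in auto)
        from M.char_distr_sum[OF this, of t]
        have "char (distr M borel (\<lambda>\<omega>. \<Sum>j<n. W n (fst (sorted_pair (I n) j)) (snd (sorted_pair (I n) j)) \<omega>)) t
            = (\<Prod>j<n. char (distr M borel (W n (fst (sorted_pair (I n) j)) (snd (sorted_pair (I n) j)))) t)"
          by (simp add: sum.reindex[OF inj] prod.reindex[OF inj])
        then show ?thesis using pair[OF i] by simp
      qed
      moreover have "(\<lambda>n. char (distr M borel (\<lambda>\<omega>. \<Sum>j<n. W n (I n) j \<omega>)) t) \<longlonglongrightarrow> char std_normal_distribution t"
      proof (rule weak_conv_m_char[OF _ real_dist_normal_dist rowsum_normal[OF I]])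
        fix n :: nat assume n: "n > 0"
        have "(\<lambda>\<omega>. \<Sum>j<n. W n (I n) j \<omega>) \<in> borel_measurable M"
          using I n by (intro borel_measurable_sum meas) auto
        then show "real_distribution (distr M borel (\<lambda>\<omega>. \<Sum>j<n. W n (I n) j \<omega>))"
          by (auto simp: real_distribution_def real_distribution_axioms_def intro: M.prob_space_distr)
      qed
      ultimately show "(\<lambda>n. \<Prod>j<n. char (distr M borel (W n (I n) j)) t) \<longlonglongrightarrow> complex_of_real (exp (- (t\<^sup>2) / 2))"
        unfolding char_std_normal_distribution
        by (rule_tac Lim_transform_eventually) (auto intro!: eventually_mono[OF eventually_gt_at_top[of 0]])
    qed
    then show "\<forall>\<^sub>F n in sequentially. (\<Sum>j<n. measure (\<mu> n (sorted_pair (I n) j)) {x. \<bar>x\<bar> > \<epsilon>}) \<le> \<epsilon> \<and>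
           \<bar>(\<Sum>j<n. \<integral>x. (trunc \<epsilon> x)\<^sup>2 \<partial>\<mu> n (sorted_pair (I n) j)) - 1\<bar> \<le> \<epsilon>"
      using eventually_gt_at_top[of 0] by eventually_elim (use I \<mu>_pair in simp)
  qed
  have centred: "(\<integral>x. trunc \<epsilon> x \<partial>\<mu> n p) = 0" if "p \<in> upper_index n" for \<epsilon> n p
  proof -
    obtain i j where p: "p = (i, j)" by (cases p)
    have ij: "i < n" "j < n" "i \<le> j" using that by (auto simp: p upper_index_def)
    have "\<mu> n p = distr M borel (W n i j)" using that by (simp add: \<mu>_def p)
    then show ?thesis
      by (simp add: symmetric_distribution_odd_integral[OF _ reflect[OF ij(1,2)]] trunc_def)
  qed
  let ?sc = "semicircle_distribution"
  have st: "AE \<omega> in M. (\<lambda>n. mean_trace n z (X n \<omega>)) \<longlonglongrightarrow> stieltjes ?sc z" if z: "Im z = 2" for z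
  proof -
    have z': "Im z > 0" using z by simp
    define m where "m = stieltjes ?sc z"
    have m: "m * (- z - m) = 1" "cmod m \<le> 1 / 2"
      using stieltjes_semicircle[OF z'] real_distribution.stieltjes_bound[OF real_distribution_semicircle, of z] z
      by (simp_all add: m_def)
    define P where "P n = Pi\<^sub>M (upper_index n) (\<mu> n)" for n
    have pP: "prob_space (P n)" for n unfolding P_def by (intro prob_space_PiM \<mu>)
    have bm: "bdd_meas (P n) (\<lambda>x. resolvent n (sym_of x) z i i)" if "i < n" for n i
      unfolding P_def by (intro bdd_meas_resolvent(1)[OF sets_\<mu> z'] that)
    have bmt: "bdd_meas (P n) (mean_trace n z)" for n
      unfolding P_def by (rule bdd_meas_mean_trace[OF sets_\<mu> z'])
    have mt_meas [measurable]: "mean_trace n z \<in> borel_measurable (P n)" for n using bmt by (auto simp: bdd_meas_def)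
    have mean: "(\<lambda>n. \<integral>x. mean_trace n z x \<partial>P n) \<longlonglongrightarrow> m"
    proof (rule tendstoI)
      fix e :: real assume e: "e > 0"
      \<comment> \<open>The mean error \<open>5 * \<epsilon>\<close> of
        \<open>resolvent_diag_mean\<close> is then at most \<open>e / 2\<close>.\<close>
      define \<epsilon> where "\<epsilon> = min 1 (e / 10)"
      have \<epsilon>: "0 < \<epsilon>" "\<epsilon> \<le> 1" "5 * \<epsilon> < e" using e by (auto simp: \<epsilon>_def min_def)
      show "\<forall>\<^sub>F n in sequentially. dist (\<integral>x. mean_trace n z x \<partial>P n) m < e"
        using rows[OF \<epsilon>(1,2)] eventually_gt_at_top[of 0]
      proof eventually_elim
        case (elim n)
        interpret P: prob_space "P n" by (rule pP)
        have E: "(\<integral>x. cmod (resolvent n (sym_of x) z i i - m) \<partial>P n) \<le> 5 * \<epsilon>" if "i < n" for i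
          unfolding P_def
          by (rule resolvent_diag_mean[OF \<mu> sets_\<mu> \<epsilon>(1,2) z m centred _ _ that]) (use elim in auto)
        have i: "integrable (P n) (\<lambda>x. resolvent n (sym_of x) z i i - m)" if "i < n" for i
          by (intro bdd_meas_integrable[OF pP] bdd_meas_diff bm that bdd_meas_const)
        have eq: "mean_trace n z x - m = (\<Sum>i<n. resolvent n (sym_of x) z i i - m) / of_nat n" for x
          using elim by (simp add: mean_trace_def sum_subtractf diff_divide_distrib)
        have "(\<integral>x. mean_trace n z x \<partial>P n) - m = (\<integral>x. mean_trace n z x - m \<partial>P n)"
          using bdd_meas_integrable[OF pP bmt[of n]] by (simp add: P.prob_space)
        also have "\<dots> = (\<integral>x. (\<Sum>i<n. resolvent n (sym_of x) z i i - m) / of_nat n \<partial>P n)"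
          by (simp only: eq)
        also have "\<dots> = (\<Sum>i<n. \<integral>x. resolvent n (sym_of x) z i i - m \<partial>P n) / of_nat n"
          using i by (simp add: Bochner_Integration.integral_sum)
        finally have "dist (\<integral>x. mean_trace n z x \<partial>P n) m = cmod (\<Sum>i<n. \<integral>x. resolvent n (sym_of x) z i i - m \<partial>P n) / real n"
          by (simp add: dist_norm norm_divide)
        also have "\<dots> \<le> (\<Sum>i<n. 5 * \<epsilon>) / real n"
          by (intro divide_right_mono sum_norm_le order_trans[OF integral_norm_bound E]) auto
        also have "\<dots> = 5 * \<epsilon>" using elim by simp
        finally show ?case using \<epsilon> by simp
      qed
    qed
    have conc: "AE \<omega> in M. (\<lambda>n. \<phi> (mean_trace n z (X n \<omega>)) - (\<integral>x. \<phi> (mean_trace n z x) \<partial>P n)) \<longlonglongrightarrow> 0"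
      if \<phi>: "\<phi> = Re \<or> \<phi> = Im" for \<phi>
    proof -
      have [measurable]: "\<phi> \<in> borel_measurable borel" using \<phi> by auto
      define A where "A e n = {\<omega> \<in> space M. \<bar>\<phi> (mean_trace n z (X n \<omega>)) - (\<integral>x. \<phi> (mean_trace n z x) \<partial>P n)\<bar> \<ge> e}" for e n
      have "AE \<omega> in M. \<forall>\<^sub>F n in sequentially. \<omega> \<in> space M - A e n" if e: "e > 0" for e
      proof (rule borel_cantelli_AE1)
        have Xm [measurable]: "X n \<in> measurable M (P n)" for n unfolding P_def by (rule X_meas)
        show "A e n \<in> sets M" for n unfolding A_def by measurable
        have "measure M (A e n) \<le> 2 * exp (- (e\<^sup>2 / 18)) ^ n" if n: "n > 0" for n
        proof -
          let ?B = "{x\<in>space (P n). \<bar>\<phi> (mean_trace n z x) - (\<integral>x. \<phi> (mean_trace n z x) \<partial>P n)\<bar> \<ge> e}"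
          \<comment> \<open>The event is pulled back along \<open>X n\<close> from the product
            space, where the bounded differences estimate lives.\<close>
          have "A e n = X n -` ?B \<inter> space M" using measurable_space[OF Xm[of n]] by (auto simp: A_def)
          then have "measure M (A e n) = measure (distr M (P n) (X n)) ?B"
            by (subst measure_distr) auto
          also have "distr M (P n) (X n) = P n" unfolding P_def by (rule law[OF n])
          also have "measure (P n) ?B \<le> 2 * exp (- (e\<^sup>2 / 18)) ^ n"
            unfolding P_def by (rule mean_trace_concentration[OF \<mu> sets_\<mu> n z e \<phi>])
          finally show ?thesis .
        qed
        then have le: "\<forall>\<^sub>F n in sequentially. norm (measure M (A e n)) \<le> 2 * exp (- (e\<^sup>2 / 18)) ^ n"
          by (auto intro!: eventually_mono[OF eventually_gt_at_top[of 0]])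
        have "summable (\<lambda>n. 2 * exp (- (e\<^sup>2 / 18)) ^ n)" using e by (intro summable_mult summable_geometric) auto
        then show "summable (\<lambda>n. measure M (A e n))" by (rule summable_comparison_test_ev[OF le])
        show "emeasure M (A e n) < \<infinity>" for n by (simp add: M.emeasure_eq_measure)
      qed
      \<comment> \<open>Restricting to \<open>e = 1 / (k + 1)\<close> keeps the union of exceptional
        sets countable.\<close>
      then have "AE \<omega> in M. \<forall>k::nat. \<forall>\<^sub>F n in sequentially. \<omega> \<in> space M - A (1 / Suc k) n"
        unfolding AE_all_countable by (auto simp del: of_nat_Suc)
      then show ?thesis
      proof eventually_elim
        case (elim \<omega>)
        show ?case
        proof (rule tendstoI)
          fix e :: real assume "e > 0"
          then obtain k where k: "1 / real (Suc k) < e" using nat_approx_posE by blast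
          from elim have "\<forall>\<^sub>F n in sequentially. \<omega> \<in> space M - A (1 / Suc k) n" by blast
          then show "\<forall>\<^sub>F n in sequentially. dist (\<phi> (mean_trace n z (X n \<omega>)) - (\<integral>x. \<phi> (mean_trace n z x) \<partial>P n)) 0 < e"
            by eventually_elim (use k in \<open>auto simp: A_def dist_real_def\<close>)
        qed
      qed
    qed
    have Re_Im: "(\<integral>x. Re (mean_trace n z x) \<partial>P n) = Re (\<integral>x. mean_trace n z x \<partial>P n)"
      "(\<integral>x. Im (mean_trace n z x) \<partial>P n) = Im (\<integral>x. mean_trace n z x \<partial>P n)" for n
      using bdd_meas_integrable[OF pP bmt] by (auto intro: integral_Re integral_Im)
    have "AE \<omega> in M. (\<lambda>n. Re (mean_trace n z (X n \<omega>)) - (\<integral>x. Re (mean_trace n z x) \<partial>P n)) \<longlonglongrightarrow> 0"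
      "AE \<omega> in M. (\<lambda>n. Im (mean_trace n z (X n \<omega>)) - (\<integral>x. Im (mean_trace n z x) \<partial>P n)) \<longlonglongrightarrow> 0"
      by (intro conc; simp)+
    then show ?thesis
    proof eventually_elim
      case (elim \<omega>)
      have "(\<lambda>n. Re (mean_trace n z (X n \<omega>))) \<longlonglongrightarrow> Re m"
        using tendsto_add[OF elim(1) tendsto_Re[OF mean]] by (simp add: Re_Im)
      moreover have "(\<lambda>n. Im (mean_trace n z (X n \<omega>))) \<longlonglongrightarrow> Im m"
        using tendsto_add[OF elim(2) tendsto_Im[OF mean]] by (simp add: Re_Im)
      ultimately show ?case by (simp add: tendsto_complex_iff m_def)
    qed
  qed
  \<comment> \<open>The null set in \<open>st\<close> depends on \<open>z\<close>; rational
    abscissae keep the union of these sets null.\<close>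
  have "AE \<omega> in M. \<forall>r\<in>\<rat>. (\<lambda>n. mean_trace n (Complex r 2) (X n \<omega>)) \<longlonglongrightarrow> stieltjes ?sc (Complex r 2)"
    using st by (subst AE_ball_countable) (auto simp: countable_rat)
  then show ?thesis
  proof eventually_elim
    case (elim \<omega>)
    show ?case
    proof (rule weak_conv_stieltjes[OF real_distribution_esd real_distribution_semicircle, of 2])
      fix a
      show "(\<lambda>n. stieltjes (esd (mat n n (\<lambda>(i, j). W n i j \<omega>))) (Complex a 2)) \<longlonglongrightarrow> stieltjes ?sc (Complex a 2)"
      proof (rule stieltjes_tendsto_rational_points[OF real_distribution_esd real_distribution_semicircle])
        fix r :: real assume r: "r \<in> \<rat>"
        have "mean_trace n (Complex r 2) (X n \<omega>) = stieltjes (esd (mat n n (\<lambda>(i, j). W n i j \<omega>))) (Complex r 2)" if n: "n > 0" for n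
        proof -
          have "mat n n (\<lambda>(i, j). W n i j \<omega>) = mat n n (\<lambda>(i, j). sym_of (X n \<omega>) i j)"
            using pair sorted_pair_in_upper_index by (intro eq_matI) (auto simp: sym_of_def X_def)
          then show ?thesis
            using stieltjes_esd[OF symmetric_sym_of n, of "Complex r 2" "X n \<omega>"] by (simp add: mean_trace_def)
        qed
        then have ev: "\<forall>\<^sub>F n in sequentially. mean_trace n (Complex r 2) (X n \<omega>) = stieltjes (esd (mat n n (\<lambda>(i, j). W n i j \<omega>))) (Complex r 2)"
          by (auto intro!: eventually_mono[OF eventually_gt_at_top[of 0]])
        have "(\<lambda>n. mean_trace n (Complex r 2) (X n \<omega>)) \<longlonglongrightarrow> stieltjes ?sc (Complex r 2)"
          using elim r by blast
        from Lim_transform_eventually[OF this ev]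
        show "(\<lambda>n. stieltjes (esd (mat n n (\<lambda>(i, j). W n i j \<omega>))) (Complex r 2)) \<longlonglongrightarrow> stieltjes ?sc (Complex r 2)" .
      qed simp
    qed simp
  qed
qed

end
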